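(* Let $d \geq 1$ and $0 < \delta < 1$. Suppose that for every $m,n \in \mathbb{Z}_{+}$ and every $\omega \in \Omega$ there are given a number $\lambda_{m,n}^{\omega} \in \mathbb{R}$ with $|\lambda_{m,n}^{\omega}| \leq 2^{-(m+n)\delta}$ and a Haar shift $\mathbb{S}_{m,n}^{\omega}$ on the dyadic grid $\mathcal{D}_{\omega}$ of complexity type $(m,n)$ with $\|\mathbb{S}_{m,n}^{\omega}\|_{L^{2}\to L^{2}} \leq 1$. Let $S \colon L^{2}(\mathbb{R}^{d}) \to L^{2}(\mathbb{R}^{d})$ be the bounded linear operator defined by \[ \langle Sf,g\rangle := \mathbb{E}_{\omega} \sum_{m,n \in \mathbb{Z}_{+}} \lambda_{m,n}^{\omega} \langle \mathbb{S}_{m,n}^{\omega} f, g\rangle, \qquad f,g \in L^{2}(\mathbb{R}^{d}). \] Then $S$ is a Calder\'on-Zygmund operator.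
   Context: $\mathbb{Z}_{+}$ denotes the set of nonnegative integers. A Calder\'on-Zygmund operator is a bounded linear map $T \colon L^{2}(\mathbb{R}^{d}) \to L^{2}(\mathbb{R}^{d})$ for which there is a function $K \colon \{(x,y) \in \mathbb{R}^{d}\times\mathbb{R}^{d} : x \neq y\} \to \mathbb{R}$ such that $\langle Tf,g\rangle = \iint f(y)g(x)K(x,y)\,dx\,dy$ whenever $f,g \colon \mathbb{R}^{d}\to\mathbb{R}$ are bounded with compact and disjoint supports, and $K$ is a standard kernel: $|K(x,y)| \leq C|x-y|^{-d}$ and $|K(x,y)-K(x',y)| + |K(y,x)-K(y,x')| \leq C |x-x'|^{\delta}|x-y|^{-\delta-d}$ for some $C,\delta>0$ and all $x,x',y$ with $x\neq y$, $|x-x'|<|x-y|/2$. Dyadic grids: a dyadic grid is a collection $\mathcal{D}$ of cubes in $\mathbb{R}^{d}$ such that for each $k\in\mathbb{Z}$ the cubes $\mathcal{D}^{k}=\{Q\in\mathcal{D}:\ell(Q)=2^{k}\}$ partition $\mathbb{R}^{d}$, and each $Q\in\mathcal{D}^{k}$ is the disjoint union of $2^{d}$ cubes of $\mathcal{D}^{k-1}$ (its children $ch(Q)$). The standard grid $\mathcal{D}_{0}$ consists of all cubes $2^{k}([n_{1},n_{1}+1)\times\cdots\times[n_{d},n_{d}+1))$, $k,n_{i}\in\mathbb{Z}$; $\mathcal{D}_{0}^{k}$ are those of side $2^{k}$. Random grids: $\Omega = (\{0,1\}^{d})^{\mathbb{Z}}$ with the product probability measure $\mathbb{P}$ (uniform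 on each factor), $\mathbb{E}_{\omega}$ the expectation. For $Q\in\mathcal{D}_{0}^{k}$ and $\omega\in\Omega$, $Q+\omega := Q + \sum_{j<k}\omega_{j}2^{j}$; $\mathcal{D}_{\omega}^{k} = \{Q+\omega : Q\in\mathcal{D}_{0}^{k}\}$ and $\mathcal{D}_{\omega}=\bigcup_{k}\mathcal{D}_{\omega}^{k}$. A Haar function associated with a cube $Q$ of a dyadic grid is any function of the form $\sum_{Q'\in ch(Q)} c_{Q'}\mathbf{1}_{Q'}$ with $c_{Q'}\in\mathbb{R}$ (no vanishing-integral condition is required). A Haar shift on $\mathcal{D}$ of complexity type $(m,n)$ is an operator of the form \[ \mathbb{S}f(x) = \sum_{Q\in\mathcal{D}} \frac{1}{|Q|} \sum_{\substack{Q',Q''\in\mathcal{D},\ Q',Q''\subset Q\\ \ell(Q')=2^{-m}\ell(Q),\ \ell(Q'')=2^{-n}\ell(Q)}} \langle f, h^{Q'}_{Q''}\rangle\, h^{Q''}_{Q'}(x), \] where $h^{Q'}_{Q''}$ is a Haar function associated with $Q''$, $h^{Q''}_{Q'}$ is a Haar function associated with $Q'$, and $\|h^{Q'}_{Q''}h^{Q''}_{Q'}\|_{\infty}\leq 1$.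
   Formalization: Each term λ^ω_{m,n}⟨S^ω_{m,n}f,g⟩ is assumed measurable in ω, so that the expectation is defined; the normalization of the Haar functions is read as the product of their sup norms being at most 1, since the pointwise product is no condition on disjoint cubes. *)

theory Defs
  imports "HOL-Probability.Probability"
begin

section \<open>L^2(R^d) on functions (classes modulo a.e. equality are handled explicitly)\<close>

type_synonym 'n rfun = "real^'n \<Rightarrow> real"

definition L2 :: "'n::finite rfun \<Rightarrow> bool" where
  "L2 f \<longleftrightarrow> f \<in> borel_measurable lborel \<and> integrable lborel (\<lambda>x. (f x)\<^sup>2)"

definition l2inner :: "'n::finite rfun \<Rightarrow> 'n rfun \<Rightarrow> real" where
  "l2inner f g = (\<integral>x. f x * g x \<partial>lborel)"

definition l2norm :: "'n::finite rfun \<Rightarrow> real" where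
  "l2norm f = sqrt (\<integral>x. (f x)\<^sup>2 \<partial>lborel)"

text \<open>omega = (omega_j)_{j in Z} with omega_j in {0,1}^d, coded as a boolean vector.\<close>
type_synonym 'n rgrid = "int \<Rightarrow> 'n \<Rightarrow> bool"

definition Omega :: "'n::finite rgrid measure" where
  "Omega = PiM (UNIV :: int set) (\<lambda>_. measure_pmf (pmf_of_set (UNIV :: ('n \<Rightarrow> bool) set)))"

text \<open>The translation sum_{j<k} omega_j 2^j (i-th coordinate).\<close>
definition gshift :: "'n rgrid \<Rightarrow> int \<Rightarrow> 'n \<Rightarrow> real" where
  "gshift \<omega> k i = (\<Sum>l. if \<omega> (k - int l - 1) i then (2::real) powr (real_of_int (k - int l - 1)) else 0)"

text \<open>The cube (Q + omega) for Q = 2^k([n_1,n_1+1) x ... x [n_d,n_d+1)) in the standard grid.\<close>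
definition dcube :: "'n::finite rgrid \<Rightarrow> int \<Rightarrow> ('n \<Rightarrow> int) \<Rightarrow> (real^'n) set" where
  "dcube \<omega> k n = {x. \<forall>i. (2::real) powr k * of_int (n i) + gshift \<omega> k i \<le> x $ i \<and>
                          x $ i < (2::real) powr k * (of_int (n i) + 1) + gshift \<omega> k i}"

definition dlevel :: "'n::finite rgrid \<Rightarrow> int \<Rightarrow> (real^'n) set set" where
  "dlevel \<omega> k = range (dcube \<omega> k)"

definition dsub :: "'n::finite rgrid \<Rightarrow> int \<Rightarrow> nat \<Rightarrow> (real^'n) set \<Rightarrow> (real^'n) set set" where
  "dsub \<omega> k m Q = {Q' \<in> dlevel \<omega> (k - int m). Q' \<subseteq> Q}"

text \<open>Haar function associated with the cube Q of side 2^k of D_omega: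
  a linear combination of the indicators of the children of Q (no cancellation required).\<close>
definition haar_fun :: "'n::finite rgrid \<Rightarrow> int \<Rightarrow> (real^'n) set \<Rightarrow> 'n rfun \<Rightarrow> bool" where
  "haar_fun \<omega> k Q h \<longleftrightarrow> Q \<in> dlevel \<omega> k \<and>
     (\<exists>c. \<forall>x. h x = (\<Sum>Q'\<in>dsub \<omega> k 1 Q. c Q' * indicator Q' x))"

text \<open>The term of the Haar shift series corresponding to a cube Q of side 2^k, tested against f, g:
  (1/|Q|) sum_{Q',Q''} <f, hA Q' Q''> <hB Q'' Q', g>,
  where hA Q' Q'' stands for h^{Q'}_{Q''} and hB Q'' Q' for h^{Q''}_{Q'}.\<close>
definition shift_term ::
  "'n::finite rgrid \<Rightarrow> int \<Rightarrow> nat \<Rightarrow> nat \<Rightarrow> ((real^'n) set \<Rightarrow> (real^'n) set \<Rightarrow> 'n rfun)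
     \<Rightarrow> ((real^'n) set \<Rightarrow> (real^'n) set \<Rightarrow> 'n rfun) \<Rightarrow> (real^'n) set \<Rightarrow> 'n rfun \<Rightarrow> 'n rfun \<Rightarrow> real" where
  "shift_term \<omega> k m n hA hB Q f g =
     (1 / measure lborel Q) *
       (\<Sum>Q'\<in>dsub \<omega> k m Q. \<Sum>Q''\<in>dsub \<omega> k n Q. l2inner f (hA Q' Q'') * l2inner (hB Q'' Q') g)"

text \<open>T is a Haar shift on D_omega of complexity type (m,n). The series over Q in D_omega is
  understood weakly on L^2: the sum over the cubes of a fixed side 2^k (absolutely convergent),
  then the symmetric limit over the scales -N <= k <= N.\<close>
definition haar_shift :: "'n::finite rgrid \<Rightarrow> nat \<Rightarrow> nat \<Rightarrow> ('n rfun \<Rightarrow> 'n rfun) \<Rightarrow> bool" where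
  "haar_shift \<omega> m n T \<longleftrightarrow>
     (\<exists>hA hB.
        (\<forall>k. \<forall>Q\<in>dlevel \<omega> k. \<forall>Q'\<in>dsub \<omega> k m Q. \<forall>Q''\<in>dsub \<omega> k n Q.
            haar_fun \<omega> (k - int n) Q'' (hA Q' Q'') \<and>
            haar_fun \<omega> (k - int m) Q' (hB Q'' Q') \<and>
            (\<forall>x y. \<bar>hA Q' Q'' y * hB Q'' Q' x\<bar> \<le> 1)) \<and>
        (\<forall>f g. L2 f \<longrightarrow> L2 g \<longrightarrow>
            (\<lambda>N::nat. \<Sum>k\<in>{- int N..int N}. \<Sum>\<^sub>\<infinity>Q\<in>dlevel \<omega> k. shift_term \<omega> k m n hA hB Q f g)
              \<longlonglongrightarrow> l2inner (T f) g))"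

definition bounded_linear_L2 :: "('n::finite rfun \<Rightarrow> 'n rfun) \<Rightarrow> bool" where
  "bounded_linear_L2 T \<longleftrightarrow>
     (\<forall>f. L2 f \<longrightarrow> L2 (T f)) \<and>
     (\<forall>f g a b. L2 f \<longrightarrow> L2 g \<longrightarrow>
        (AE x in lborel. T (\<lambda>y. a * f y + b * g y) x = a * T f x + b * T g x)) \<and>
     (\<exists>C. \<forall>f. L2 f \<longrightarrow> l2norm (T f) \<le> C * l2norm f)"

definition standard_kernel :: "(real^'n::finite \<Rightarrow> real^'n \<Rightarrow> real) \<Rightarrow> bool" where
  "standard_kernel K \<longleftrightarrow>
     (\<exists>C \<delta>. C > 0 \<and> \<delta> > 0 \<and>
        (\<forall>x y. x \<noteq> y \<longrightarrow> \<bar>K x y\<bar> \<le> C / dist x y ^ CARD('n)) \<and>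
        (\<forall>x x' y. x \<noteq> y \<longrightarrow> dist x x' < dist x y / 2 \<longrightarrow>
            \<bar>K x y - K x' y\<bar> + \<bar>K y x - K y x'\<bar>
              \<le> C * dist x x' powr \<delta> / dist x y powr (\<delta> + real CARD('n))))"

definition bdd_cpt_fun :: "'n::finite rfun \<Rightarrow> bool" where
  "bdd_cpt_fun f \<longleftrightarrow> f \<in> borel_measurable lborel \<and> (\<exists>B. \<forall>x. \<bar>f x\<bar> \<le> B) \<and>
     compact (closure {x. f x \<noteq> 0})"

definition CZO :: "('n::finite rfun \<Rightarrow> 'n rfun) \<Rightarrow> bool" where
  "CZO T \<longleftrightarrow> bounded_linear_L2 T \<and>
     (\<exists>K. standard_kernel K \<and>
        (\<forall>f g. bdd_cpt_fun f \<longrightarrow> bdd_cpt_fun g \<longrightarrow>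
           closure {x. f x \<noteq> 0} \<inter> closure {x. g x \<noteq> 0} = {} \<longrightarrow>
           l2inner (T f) g = (\<integral>(x,y). f y * g x * K x y \<partial>(lborel \<Otimes>\<^sub>M lborel))))"

end

theory Submission
  imports Defs
begin

text \<open>
  For \<open>f\<close>, \<open>g\<close> with separated supports, the part of a Haar shift living on the cubes of side \<open>2^k\<close> is
  at most \<open>2^(-kd)\<close> times the \<open>L^1\<close> norms of \<open>f\<close> and \<open>g\<close>, vanishes when \<open>2^k\<close> is much smaller than the
  distance of the supports, and is a constant multiple of \<open>(\<integral> f) (\<integral> g)\<close> as soon as each support lies
  in a single grid cube of side \<open>2^(k-n-1)\<close> resp. \<open>2^(k-m-1)\<close>. For supports in cubes of side \<open>h\<close> the
  last condition fails with probability \<open>O(2^(m+n-k) h)\<close>. Averaging over the random grids and summing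
  over the scales thus shows that the form \<open><S f, g>\<close> is a multiple of \<open>(\<integral> f) (\<integral> g)\<close> up to a Hoelder error;
  taking half of the decay exponent \<open>\<delta>\<close> as Hoelder exponent pays for the growth in \<open>m\<close> and \<open>n\<close>.

  The kernel is then the limit of \<open><S f, g>\<close> over normalised indicators of shrinking cubes. In this way
  the kernels of the individual shifts, whose measurability in the grid is not given, never appear.
\<close>

section \<open>Probability that a random grid separates points\<close>

text \<open>The Haar functions have no cancellation, so decay at large scales comes only from the
  factor 1/|Q|. The kernel of one scale of a shift is piecewise constant, so smoothness can come
  only from the random position of its jumps. The obstacle is the factor in front of (\<integral> f)
  (\<integral> g): it varies with the grid in an uncontrolled way. Two pairs of functions in the
  same two boxes share this factor, and cross-multiplying with their integrals eliminates it. What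
  remains is bounded grid by grid by a function of the crossing events alone, and these depend only
  on the bits of \<omega>, so the bound is measurable. The Hoelder exponent \<eta> enters by
  interpolation: a probability bounded by 1 and by t is bounded by t^\<eta>, and with \<eta> < 1 the
  loss 2^(m+n) shrinks to 2^((m+n)\<eta>). That the limit kernel represents the form is seen by
  cutting f and g along a fixed grid of side 2^k. The error on a pair of pieces is O(2^(k\<eta>))
  times the product of their L^1 norms, so the errors add up to O(2^(k\<eta>)) however many pieces
  there are, and k tends to minus infinity.\<close>

definition flip_bit :: "int \<Rightarrow> 'n \<Rightarrow> 'n rgrid \<Rightarrow> 'n rgrid" where
  "flip_bit j i \<omega> = (\<lambda>l l'. if l = j \<and> l' = i then \<not> \<omega> l l' else \<omega> l l')"

lemma space_Omega [simp]: "space (Omega :: 'n::finite rgrid measure) = UNIV"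
  by (simp add: Omega_def space_PiM PiE_UNIV_domain)

lemma product_prob_space_Omega:
  "product_prob_space (\<lambda>_::int. measure_pmf (pmf_of_set (UNIV :: ('n::finite \<Rightarrow> bool) set)))"
  by (intro product_prob_spaceI measure_pmf.prob_space_axioms)

interpretation Omega: prob_space "Omega :: 'n::finite rgrid measure"
  unfolding Omega_def by (intro prob_space_PiM measure_pmf.prob_space_axioms)

lemma measurable_Omega_coord [measurable]:
  "Measurable.pred (Omega :: 'n::finite rgrid measure) (\<lambda>\<omega>. \<omega> j i)"
proof -
  have "(\<lambda>\<omega>. \<omega> j) \<in> measurable (Omega :: 'n rgrid measure) (count_space UNIV)"
    unfolding Omega_def
    using measurable_component_singleton[of j UNIV "\<lambda>_. measure_pmf (pmf_of_set (UNIV :: ('n \<Rightarrow> bool) set))"]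
    by (simp cong: measurable_cong_sets)
  then have "(\<lambda>v. v i) \<circ> (\<lambda>\<omega>. \<omega> j) \<in> measurable (Omega :: 'n rgrid measure) (count_space UNIV)"
    by (rule measurable_comp) simp
  then show ?thesis
    by (simp add: o_def)
qed

text \<open>Flipping one entry permutes the finite set carrying a single factor, so it preserves the
  uniform measure there and leaves the other factors alone. Agreement on finite cylinders then
  determines the product measure.\<close>

lemma distr_flip_bit:
  "distr Omega Omega (flip_bit j i) = (Omega :: 'n::finite rgrid measure)"
  and measurable_flip_bit [measurable]: "flip_bit j i \<in> measurable Omega (Omega :: 'n::finite rgrid measure)"
proof -
  let ?p = "pmf_of_set (UNIV :: ('n \<Rightarrow> bool) set)"
  interpret product_prob_space "\<lambda>_::int. measure_pmf ?p" UNIV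
    by (rule product_prob_space_Omega)
  define \<phi> :: "('n \<Rightarrow> bool) \<Rightarrow> ('n \<Rightarrow> bool)" where "\<phi> v = (\<lambda>l. if l = i then \<not> v l else v l)" for v
  have comp: "(\<lambda>\<omega>. \<omega> l) \<in> measurable (Omega :: 'n rgrid measure) (measure_pmf ?p)" for l
    unfolding Omega_def using measurable_component_singleton[of l UNIV "\<lambda>_. measure_pmf ?p"] by simp
  show meas: "flip_bit j i \<in> measurable Omega (Omega :: 'n rgrid measure)"
  proof -
    have "(\<lambda>\<omega>. flip_bit j i \<omega> l) \<in> measurable (Omega :: 'n rgrid measure) (measure_pmf ?p)" for l
    proof (cases "l = j")
      case True
      have "\<phi> \<circ> (\<lambda>\<omega>. \<omega> j) \<in> measurable (Omega :: 'n rgrid measure) (measure_pmf ?p)"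
        by (rule measurable_comp[OF comp]) simp
      then show ?thesis using True by (simp add: flip_bit_def \<phi>_def o_def)
    next
      case False
      then show ?thesis using comp[of l] by (simp add: flip_bit_def)
    qed
    then show ?thesis
      unfolding Omega_def by (intro measurable_PiM_single') (auto simp: Omega_def)
  qed
  have "bij \<phi>"
    by (rule o_bij[of \<phi>]) (auto simp: \<phi>_def fun_eq_iff)
  then have map: "map_pmf \<phi> ?p = ?p"
    by (intro map_pmf_of_set_bij_betw) auto
  have inv: "emeasure (measure_pmf ?p) (\<phi> -` X) = emeasure (measure_pmf ?p) X" for X
    by (metis map emeasure_map_pmf)
  show "distr Omega Omega (flip_bit j i) = (Omega :: 'n rgrid measure)"
    unfolding Omega_def
  proof (rule PiM_eq)
    fix J :: "int set" and F assume J: "finite J"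
    let ?X = "\<lambda>l. if l = j then \<phi> -` F l else F l"
    have fb: "flip_bit j i \<omega> l = (if l = j then \<phi> (\<omega> j) else \<omega> l)" for \<omega> l
      by (auto simp: flip_bit_def \<phi>_def)
    have "flip_bit j i \<omega> l \<in> F l \<longleftrightarrow> \<omega> l \<in> ?X l" for \<omega> l
      by (simp add: fb)
    then have "flip_bit j i -` prod_emb UNIV (\<lambda>_. measure_pmf ?p) J (Pi\<^sub>E J F)
        = prod_emb UNIV (\<lambda>_. measure_pmf ?p) J (Pi\<^sub>E J ?X)"
      by (auto simp: prod_emb_def PiE_iff)
    moreover have "emeasure (distr Omega Omega (flip_bit j i)) (prod_emb UNIV (\<lambda>_. measure_pmf ?p) J (Pi\<^sub>E J F))
        = emeasure Omega (flip_bit j i -` prod_emb UNIV (\<lambda>_. measure_pmf ?p) J (Pi\<^sub>E J F))"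
      by (subst emeasure_distr[OF meas]) (auto simp: Omega_def space_PiM PiE_UNIV_domain intro!: sets_PiM_I J)
    moreover have "emeasure Omega (prod_emb UNIV (\<lambda>_. measure_pmf ?p) J (Pi\<^sub>E J ?X))
        = (\<Prod>l\<in>J. emeasure (measure_pmf ?p) (?X l))"
      unfolding Omega_def by (rule emeasure_PiM_emb) (auto simp: J)
    moreover have "(\<Prod>l\<in>J. emeasure (measure_pmf ?p) (?X l)) = (\<Prod>l\<in>J. emeasure (measure_pmf ?p) (F l))"
      by (intro prod.cong) (auto simp: inv)
    ultimately show "emeasure (distr (Pi\<^sub>M UNIV (\<lambda>_. measure_pmf ?p)) (Pi\<^sub>M UNIV (\<lambda>_. measure_pmf ?p)) (flip_bit j i))
          (prod_emb UNIV (\<lambda>_. measure_pmf ?p) J (Pi\<^sub>E J F)) = (\<Prod>l\<in>J. emeasure (measure_pmf ?p) (F l))"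
      by (simp add: Omega_def)
  qed simp
qed

section \<open>Grid translations as binary expansions, and the grid faces inside an interval\<close>

lemma summable_gshift:
  "summable (\<lambda>l. if \<omega> (k - int l - 1) i then (2::real) powr (real_of_int (k - int l - 1)) else 0)"
proof (rule summable_comparison_test)
  have "(2::real) powr (real_of_int (k - int l - 1)) = 2 powr (k - 1) * (1/2)^l" for l
    by (simp add: powr_diff powr_realpow power_one_over)
  then show "\<exists>N. \<forall>l\<ge>N. norm (if \<omega> (k - int l - 1) i then (2::real) powr (real_of_int (k - int l - 1)) else 0)
       \<le> 2 powr (k - 1) * (1/2)^l"
    by auto
qed (auto intro!: summable_mult summable_geometric)

text \<open>Going up one level reveals exactly one new bit per coordinate; this drives the induction
  over scales.\<close>

lemma gshift_step:
  "gshift \<omega> k i = (if \<omega> (k - 1) i then 2 powr (k - 1) else 0) + gshift \<omega> (k - 1) i"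
proof -
  have shift: "k - int (Suc n) - 1 = k - 1 - int n - 1" for n by simp
  show ?thesis
    using suminf_split_head[OF summable_gshift[of \<omega> k i]] unfolding gshift_def shift by simp
qed

lemma gshift_flip_bit: "j \<ge> k \<Longrightarrow> gshift (flip_bit j i \<omega>) k i' = gshift \<omega> k i'"
  unfolding gshift_def flip_bit_def by (intro suminf_cong) auto

lemma measurable_gshift [measurable]:
  "(\<lambda>\<omega>. gshift \<omega> k i) \<in> borel_measurable (Omega :: 'n::finite rgrid measure)"
  unfolding gshift_def by measurable

text \<open>The two floors are the indices of the level-\<open>k\<close> grid intervals containing
  \<open>a\<close> and \<open>b\<close> along axis \<open>i\<close>. For \<open>a \<le> b\<close>
  they differ exactly when a level-\<open>k\<close> grid face orthogonal to that axis passes through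
  (a, b].\<close>

definition cut :: "'n rgrid \<Rightarrow> int \<Rightarrow> 'n \<Rightarrow> real \<Rightarrow> real \<Rightarrow> bool" where
  "cut \<omega> k i a b \<longleftrightarrow> \<lfloor>(a - gshift \<omega> k i) / 2 powr k\<rfloor> \<noteq> \<lfloor>(b - gshift \<omega> k i) / 2 powr k\<rfloor>"

lemma measurable_cut [measurable]:
  "Measurable.pred (Omega :: 'n::finite rgrid measure) (\<lambda>\<omega>. cut \<omega> k i a b)"
  unfolding cut_def by measurable

lemma cut_iff:
  assumes "a \<le> b"
  shows "cut \<omega> k i a b \<longleftrightarrow>
    (\<exists>n::int. a - gshift \<omega> k i < of_int n * 2 powr k \<and> of_int n * 2 powr k \<le> b - gshift \<omega> k i)"
proof -
  let ?u = "(a - gshift \<omega> k i) / 2 powr k" and ?v = "(b - gshift \<omega> k i) / 2 powr k"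
  have "?u \<le> ?v" using assms by (simp add: divide_right_mono)
  then have "\<lfloor>?u\<rfloor> \<noteq> \<lfloor>?v\<rfloor> \<longleftrightarrow> (\<exists>n::int. ?u < of_int n \<and> of_int n \<le> ?v)"
  proof (intro iffI)
    assume ne: "\<lfloor>?u\<rfloor> \<noteq> \<lfloor>?v\<rfloor>"
    have "\<lfloor>?u\<rfloor> \<le> \<lfloor>?v\<rfloor>" using \<open>?u \<le> ?v\<close> by (rule floor_mono)
    with ne have "\<lfloor>?u\<rfloor> < \<lfloor>?v\<rfloor>" by linarith
    then have "?u < of_int \<lfloor>?v\<rfloor>" by (simp only: floor_less_iff)
    then show "\<exists>n::int. ?u < of_int n \<and> of_int n \<le> ?v"
      using of_int_floor_le by blast
  next
    assume "\<exists>n::int. ?u < of_int n \<and> of_int n \<le> ?v"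
    then obtain n :: int where "?u < of_int n" "of_int n \<le> ?v" by blast
    then have "\<lfloor>?u\<rfloor> < n" "n \<le> \<lfloor>?v\<rfloor>" by (simp_all only: floor_less_iff le_floor_iff)
    then show "\<lfloor>?u\<rfloor> \<noteq> \<lfloor>?v\<rfloor>" by linarith
  qed
  then show ?thesis
    by (simp add: cut_def pos_divide_less_eq pos_le_divide_eq)
qed

text \<open>Every face of level \<open>k\<close> is also a face of level \<open>k - 1\<close>: by
  \<open>gshift_step\<close>, index n at level \<open>k\<close> becomes index 2n plus the bit
  \<open>\<omega> (k - 1) i\<close> at level \<open>k - 1\<close>. The parity of the finer index
  therefore records that bit.\<close>

lemma cut_pred:
  assumes "a \<le> b" "cut \<omega> k i a b"
  obtains n :: int where
    "a - gshift \<omega> (k - 1) i < of_int n * 2 powr (k - 1)"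
    "of_int n * 2 powr (k - 1) \<le> b - gshift \<omega> (k - 1) i" "odd n \<longleftrightarrow> \<omega> (k - 1) i"
proof -
  obtain n :: int where n: "a - gshift \<omega> k i < of_int n * 2 powr k" "of_int n * 2 powr k \<le> b - gshift \<omega> k i"
    using assms(2) unfolding cut_iff[OF assms(1)] by blast
  have p: "(2::real) powr k = 2 * 2 powr (k - 1)"
    by (simp add: powr_diff)
  show ?thesis
    by (rule that[of "2 * n + (if \<omega> (k - 1) i then 1 else 0)"])
       (use n in \<open>auto simp: gshift_step[of \<omega> k] p algebra_simps\<close>)
qed

text \<open>A cut at level \<open>k\<close> forces one at level \<open>k - 1\<close>, and given the
  latter the bit \<open>\<omega> (k - 1) i\<close> decides whether the face survives. Flipping this
  bit preserves the measure and the coarser event \<open>?A'\<close>, but turns \<open>?A\<close>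
  into a disjoint event; hence each level halves the probability.\<close>

lemma prob_cut_dyadic:
  assumes "a \<le> b" "b - a \<le> 2 powr (k - int L)"
  shows "measure Omega {\<omega> :: 'n::finite rgrid. cut \<omega> k i a b} \<le> (1/2) ^ L"
  using assms(2)
proof (induction L arbitrary: k)
  case 0
  show ?case by simp
next
  case (Suc L)
  let ?A = "{\<omega> :: 'n rgrid. cut \<omega> k i a b}" and ?A' = "{\<omega> :: 'n rgrid. cut \<omega> (k - 1) i a b}"
  let ?F = "flip_bit (k - 1) i :: 'n rgrid \<Rightarrow> 'n rgrid"
  have m[measurable]: "?A \<in> sets Omega" "?A' \<in> sets Omega"
    using measurable_cut unfolding pred_def by auto
  have mF: "?F -` ?A \<in> sets Omega"
    using measurable_sets[OF measurable_flip_bit m(1)] by simp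
  have mA: "measure Omega (?F -` ?A) = measure Omega ?A"
    using measure_distr[OF measurable_flip_bit m(1), of "k - 1" i] by (simp add: distr_flip_bit)
  have inA': "cut \<omega> k i a b \<Longrightarrow> cut \<omega> (k - 1) i a b" for \<omega> :: "'n rgrid"
    by (erule cut_pred[OF assms(1)]) (auto simp: cut_iff[OF assms(1)])
  have inv: "cut (?F \<omega>) (k - 1) i a b \<longleftrightarrow> cut \<omega> (k - 1) i a b" for \<omega>
    by (simp add: cut_def gshift_flip_bit)
  have sub: "?A \<union> ?F -` ?A \<subseteq> ?A'"
    using inA' inv by blast
  have "b - a \<le> 2 powr (k - 1 - int L)"
    using Suc.prems by (simp add: algebra_simps)
  moreover have "(2::real) powr (k - 1 - int L) \<le> 2 powr (k - 1)"
    by simp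
  ultimately have len: "b - a \<le> 2 powr (k - 1)" by linarith
  \<comment> \<open>A half-open interval of length at most 2^(k-1) contains at most one face of
    level \<open>k - 1\<close>. If both grids cut at level \<open>k\<close>, this single face would
    have an index of both parities.\<close>
  have disj: "?A \<inter> ?F -` ?A = {}"
  proof (rule ccontr)
    assume "\<not> ?thesis"
    then obtain \<omega> where *: "cut \<omega> k i a b" "cut (?F \<omega>) k i a b" by auto
    let ?s = "gshift \<omega> (k - 1) i" and ?h = "2 powr (real_of_int k - 1) :: real"
    obtain n where n: "a - ?s < of_int n * ?h" "of_int n * ?h \<le> b - ?s" "odd n \<longleftrightarrow> \<omega> (k - 1) i"
      using *(1) by (elim cut_pred[OF assms(1)])
    obtain n' where "a - gshift (?F \<omega>) (k - 1) i < of_int n' * ?h"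
        "of_int n' * ?h \<le> b - gshift (?F \<omega>) (k - 1) i" "odd n' \<longleftrightarrow> ?F \<omega> (k - 1) i"
      using *(2) by (elim cut_pred[OF assms(1)])
    then have n': "a - ?s < of_int n' * ?h" "of_int n' * ?h \<le> b - ?s" "odd n' \<longleftrightarrow> \<not> \<omega> (k - 1) i"
      by (simp_all only: gshift_flip_bit[OF order_refl]) (simp add: flip_bit_def)
    have "of_int n * ?h - of_int n' * ?h < ?h" "of_int n' * ?h - of_int n * ?h < ?h"
      using n n' len unfolding of_int_diff of_int_1 by linarith+
    then have "of_int (n - n') * ?h < 1 * ?h" "of_int (n' - n) * ?h < 1 * ?h"
      by (simp_all add: left_diff_distrib)
    then have "real_of_int (n - n') < 1" "real_of_int (n' - n) < 1"
      by (simp_all only: mult_less_cancel_right) auto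
    then have "n = n'" by linarith
    with n(3) n'(3) show False by blast
  qed
  have "2 * measure Omega ?A = measure Omega (?A \<union> ?F -` ?A)"
    using Omega.finite_measure_Union[OF m(1) mF disj] mA by simp
  also have "\<dots> \<le> measure Omega ?A'"
    by (rule Omega.finite_measure_mono[OF sub m(2)])
  also have "\<dots> \<le> (1/2) ^ L"
    using Suc.IH[of "k - 1"] \<open>b - a \<le> 2 powr (k - 1 - int L)\<close> by simp
  finally show ?case by simp
qed

text \<open>The factor 2 is the price of rounding the relative length \<open>t\<close> up to a power
  of 1/2; for \<open>t \<ge> 1\<close> the bound is trivial.\<close>

lemma prob_cut:
  assumes "a \<le> b"
  shows "measure Omega {\<omega> :: 'n::finite rgrid. cut \<omega> k i a b} \<le> 2 * (b - a) / 2 powr k"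
proof (cases "a = b")
  case True
  then show ?thesis by (simp add: cut_def)
next
  case False
  define t where "t = (b - a) / 2 powr k"
  have t: "t > 0" "b - a = t * 2 powr k" using False assms by (auto simp: t_def)
  show ?thesis
  proof (cases "t \<ge> 1")
    case True
    have "measure Omega {\<omega> :: 'n::finite rgrid. cut \<omega> k i a b} \<le> 1" by simp
    also have "1 \<le> 2 * t" using True by simp
    finally show ?thesis by (simp add: t_def)
  next
    case False
    define L where "L = nat \<lfloor>- log 2 t\<rfloor>"
    have "log 2 t < 0" using False t by simp
    then have L: "real L \<le> - log 2 t" "- log 2 t < real L + 1"
      unfolding L_def by linarith+
    have "t = 2 powr (log 2 t)" using t by simp
    also have "\<dots> \<le> 2 powr (- real L)" using L by (intro powr_mono) auto
    finally have "b - a \<le> 2 powr (- real L) * 2 powr k"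
      unfolding t(2) by (intro mult_right_mono) auto
    then have "b - a \<le> 2 powr (k - int L)"
      by (simp add: powr_diff powr_minus field_simps)
    then have "measure Omega {\<omega> :: 'n::finite rgrid. cut \<omega> k i a b} \<le> (1/2) ^ L"
      using prob_cut_dyadic assms by blast
    also have "(1/2) ^ L = 2 * 2 powr (- (real L + 1))"
      by (simp add: powr_minus powr_add powr_diff powr_realpow power_one_over inverse_eq_divide)
    also have "\<dots> \<le> 2 * 2 powr (log 2 t)"
      using L by (intro mult_left_mono powr_mono) auto
    also have "\<dots> = 2 * t" using t by simp
    finally show ?thesis by (simp add: t_def)
  qed
qed

section \<open>Haar shifts at a single scale\<close>

text \<open>Nothing is asked of \<open>u\<close> beyond the pointwise bound: if \<open>u\<close> is
  not integrable, its integral is 0 by convention. This keeps measurability questions out of the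
  estimates below.\<close>

lemma abs_integral_le:
  fixes u v :: "'a \<Rightarrow> real"
  assumes "integrable M v" "\<And>x. \<bar>u x\<bar> \<le> v x"
  shows "\<bar>integral\<^sup>L M u\<bar> \<le> integral\<^sup>L M v"
proof (cases "integrable M u")
  case True
  then have "norm (integral\<^sup>L M u) \<le> (\<integral>x. norm (u x) \<partial>M)" by simp
  also have "\<dots> \<le> integral\<^sup>L M v"
    using assms True by (intro integral_mono) auto
  finally show ?thesis by simp
next
  case False
  have "0 \<le> v x" for x using assms(2)[of x] by linarith
  then show ?thesis using False by (simp add: not_integrable_integral_eq integral_nonneg)
qed

section \<open>Geometry of the cubes through their integer coordinates\<close>

definition cell :: "'n::finite rgrid \<Rightarrow> int \<Rightarrow> real^'n \<Rightarrow> 'n \<Rightarrow> int" where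
  "cell \<omega> k x = (\<lambda>i. \<lfloor>(x $ i - gshift \<omega> k i) / 2 powr k\<rfloor>)"

text \<open>Disjointness of cubes and membership in a common cube thereby become statements about
  equality of integer vectors.\<close>

lemma mem_dcube_iff: "x \<in> dcube \<omega> k n \<longleftrightarrow> cell \<omega> k x = n"
proof -
  have "2 powr k * of_int (n i) + gshift \<omega> k i \<le> x $ i \<and> x $ i < 2 powr k * (of_int (n i) + 1) + gshift \<omega> k i
     \<longleftrightarrow> \<lfloor>(x $ i - gshift \<omega> k i) / 2 powr k\<rfloor> = n i" for i
    by (simp add: floor_eq_iff pos_le_divide_eq pos_divide_less_eq algebra_simps)
  then show ?thesis
    by (auto simp: dcube_def cell_def fun_eq_iff)
qed

lemma dlevel_disjoint: "A \<in> dlevel \<omega> k \<Longrightarrow> B \<in> dlevel \<omega> k \<Longrightarrow> A \<noteq> B \<Longrightarrow> A \<inter> B = {}"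
  by (auto simp: dlevel_def mem_dcube_iff)

lemma dlevel_cell_iff:
  "A \<in> dlevel \<omega> k \<Longrightarrow> cell \<omega> k x = cell \<omega> k y \<Longrightarrow> x \<in> A \<longleftrightarrow> y \<in> A"
  by (auto simp: dlevel_def mem_dcube_iff)

lemma dlevel_cell_eq: "A \<in> dlevel \<omega> k \<Longrightarrow> x \<in> A \<Longrightarrow> y \<in> A \<Longrightarrow> cell \<omega> k x = cell \<omega> k y"
  by (auto simp: dlevel_def mem_dcube_iff)

text \<open>The Euclidean distance is estimated by the l^1 distance, which explains the dimension as
  a factor here and in all later comparisons of scales with distances.\<close>

lemma cell_eq_dist:
  assumes "cell \<omega> k x = cell \<omega> k (y :: real^'n::finite)"
  shows "dist x y < real CARD('n) * 2 powr k"
proof -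
  have "\<bar>x $ i - y $ i\<bar> < 2 powr k" for i
  proof -
    have "\<lfloor>(x $ i - gshift \<omega> k i) / 2 powr k\<rfloor> = \<lfloor>(y $ i - gshift \<omega> k i) / 2 powr k\<rfloor>"
      using assms by (simp add: cell_def fun_eq_iff)
    then have "\<bar>(x $ i - gshift \<omega> k i) / 2 powr k - (y $ i - gshift \<omega> k i) / 2 powr k\<bar> < 1"
      by linarith
    then show ?thesis
      by (simp add: diff_divide_distrib[symmetric] abs_divide)
  qed
  then have "(\<Sum>i\<in>UNIV. \<bar>x $ i - y $ i\<bar>) < (\<Sum>i\<in>(UNIV::'n set). 2 powr k)"
    by (intro sum_strict_mono) auto
  moreover have "dist x y \<le> (\<Sum>i\<in>UNIV. \<bar>x $ i - y $ i\<bar>)"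
    using norm_le_l1_cart[of "x - y"] by (simp add: dist_norm)
  ultimately show ?thesis by simp
qed

lemma dcube_borel [measurable]: "dcube \<omega> k n \<in> sets (borel :: (real^'n::finite) measure)"
  unfolding dcube_def by measurable

lemma dlevel_borel: "Q \<in> dlevel \<omega> k \<Longrightarrow> Q \<in> sets (borel :: (real^'n::finite) measure)"
  by (auto simp: dlevel_def)

lemma emeasure_dlevel:
  assumes "Q \<in> dlevel \<omega> k"
  shows "emeasure lborel (Q :: (real^'n::finite) set) = ennreal ((2 powr k) ^ CARD('n))"
proof -
  obtain n where Q: "Q = dcube \<omega> k n" using assms by (auto simp: dlevel_def)
  define a b :: "real^'n" where
    "a = (\<chi> i. 2 powr k * of_int (n i) + gshift \<omega> k i)" and
    "b = (\<chi> i. 2 powr k * (of_int (n i) + 1) + gshift \<omega> k i)"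
  have ab: "a $ i \<le> b $ i" "b $ i - a $ i = 2 powr k" for i
    by (auto simp: a_def b_def algebra_simps)
  have le: "a \<bullet> c \<le> b \<bullet> c" if "c \<in> Basis" for c
    using that ab by (auto simp: Basis_vec_def inner_axis)
  have "(\<Prod>c\<in>Basis. (b - a) \<bullet> c) = (\<Prod>c\<in>(Basis :: (real^'n) set). 2 powr k)"
    using ab by (intro prod.cong) (auto simp: Basis_vec_def inner_axis)
  then have P: "(\<Prod>c\<in>Basis. (b - a) \<bullet> c) = (2 powr k) ^ CARD('n)"
    by simp
  have "box a b \<subseteq> Q" "Q \<subseteq> cbox a b"
    by (force simp: Q dcube_def mem_box_cart a_def b_def less_imp_le)+
  then have "emeasure lborel (box a b) \<le> emeasure lborel Q" "emeasure lborel Q \<le> emeasure lborel (cbox a b)"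
    using dlevel_borel[OF assms] by (auto intro!: emeasure_mono)
  moreover have "emeasure lborel (box a b) = ennreal ((2 powr k) ^ CARD('n))"
      "emeasure lborel (cbox a b) = ennreal ((2 powr k) ^ CARD('n))"
    using le by (auto simp: emeasure_lborel_box_eq emeasure_lborel_cbox_eq P)
  ultimately show ?thesis by simp
qed

lemma measure_dlevel:
  "Q \<in> dlevel \<omega> k \<Longrightarrow> measure lborel (Q :: (real^'n::finite) set) = (2 powr k) ^ CARD('n)"
  by (simp add: measure_def emeasure_dlevel)

text \<open>A Haar function jumps only across faces of the children of its cube, hence at level
  \<open>k - 1\<close>. This is the origin of the extra \<open>- 1\<close> in the scales below. The
  points may lie outside \<open>Q\<close>, where the function vanishes.\<close>

lemma haar_fun_const:
  "haar_fun \<omega> k Q h \<Longrightarrow> cell \<omega> (k - 1) x = cell \<omega> (k - 1) y \<Longrightarrow> h x = h y"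
proof -
  assume h: "haar_fun \<omega> k Q h" and eq: "cell \<omega> (k - 1) x = cell \<omega> (k - 1) y"
  have "indicator Q' x = (indicator Q' y :: real)" if "Q' \<in> dsub \<omega> k 1 Q" for Q'
    using that dlevel_cell_iff[OF _ eq] by (auto simp: dsub_def split: split_indicator)
  then show ?thesis
    using h unfolding haar_fun_def by (auto intro!: sum.cong)
qed

lemma haar_fun_support: "haar_fun \<omega> k Q h \<Longrightarrow> x \<notin> Q \<Longrightarrow> h x = 0"
proof -
  assume h: "haar_fun \<omega> k Q h" and x: "x \<notin> Q"
  have "indicator Q' x = (0 :: real)" if "Q' \<in> dsub \<omega> k 1 Q" for Q'
    using that x by (auto simp: dsub_def split: split_indicator)
  then show ?thesis
    using h unfolding haar_fun_def by (auto intro!: sum.neutral)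
qed

section \<open>Square-integrable functions and their masses on cubes\<close>

lemma L2_measurable [measurable_dest]: "L2 f \<Longrightarrow> f \<in> borel_measurable borel"
  by (simp add: L2_def)

lemma L2_sq_integrable: "L2 f \<Longrightarrow> integrable lborel (\<lambda>x. (f x)\<^sup>2)"
  by (simp add: L2_def)

lemma L2_lincomb:
  assumes "L2 f" "L2 g"
  shows "L2 (\<lambda>x. a * f x + b * g x)"
proof -
  note [measurable] = assms
  have "integrable lborel (\<lambda>x. (a * f x + b * g x)\<^sup>2)"
  proof (rule Bochner_Integration.integrable_bound)
    show "integrable lborel (\<lambda>x. 2 * a\<^sup>2 * (f x)\<^sup>2 + 2 * b\<^sup>2 * (g x)\<^sup>2)"
      using assms by (auto intro!: Bochner_Integration.integrable_add integrable_mult_right simp: L2_def)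
    have "(s + t)\<^sup>2 \<le> 2 * s\<^sup>2 + 2 * t\<^sup>2" for s t :: real
      using zero_le_power2[of "s - t"] by (simp add: power2_sum power2_diff)
    from this[of "a * f x" "b * g x" for x]
    show "AE x in lborel. norm ((a * f x + b * g x)\<^sup>2) \<le> norm (2 * a\<^sup>2 * (f x)\<^sup>2 + 2 * b\<^sup>2 * (g x)\<^sup>2)"
      by (auto simp: power_mult_distrib mult.assoc)
  qed measurable
  then show ?thesis by (simp add: L2_def)
qed

lemma L2_sum:
  assumes "\<And>i. i \<in> F \<Longrightarrow> L2 (u i)"
  shows "L2 (\<lambda>x. \<Sum>i\<in>F. u i x)"
proof -
  have zero: "L2 (\<lambda>x. 0 :: real)" by (simp add: L2_def)
  show ?thesis
    using assms
  proof (induction F rule: infinite_finite_induct)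
    case (insert i F)
    then show ?case using L2_lincomb[of "u i" "\<lambda>x. \<Sum>i\<in>F. u i x" 1 1] by simp
  qed (use zero in simp_all)
qed

lemma L2_mult_integrable:
  assumes "L2 f" "L2 g"
  shows "integrable lborel (\<lambda>x. f x * g x)"
proof -
  note [measurable] = assms
  show ?thesis
  proof (rule Bochner_Integration.integrable_bound)
    show "integrable lborel (\<lambda>x. (f x)\<^sup>2 + (g x)\<^sup>2)"
      using assms by (auto simp: L2_def)
    have "\<bar>s * t\<bar> \<le> s\<^sup>2 + t\<^sup>2" for s t :: real
      using zero_le_power2[of "\<bar>s\<bar> - \<bar>t\<bar>"] zero_le_power2[of "\<bar>s\<bar>"] zero_le_power2[of "\<bar>t\<bar>"]
      unfolding power2_diff power2_abs abs_mult by linarith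
    then show "AE x in lborel. norm (f x * g x) \<le> norm ((f x)\<^sup>2 + (g x)\<^sup>2)"
      by auto
  qed measurable
qed

lemma L2_indicator:
  assumes "Q \<in> sets borel" "emeasure lborel Q < \<infinity>"
  shows "L2 (\<lambda>x. indicator Q x :: real)"
proof -
  have "(indicator Q x :: real)\<^sup>2 = indicator Q x" for x by (simp split: split_indicator)
  then show ?thesis using assms by (simp add: L2_def)
qed

lemma l2norm_nonneg [simp]: "0 \<le> l2norm f"
  by (simp add: l2norm_def)

lemma l2norm_sq: "(l2norm f)\<^sup>2 = (\<integral>x. (f x)\<^sup>2 \<partial>lborel)"
  by (simp add: l2norm_def)

lemma l2inner_bound:
  assumes "L2 f" "L2 g"
  shows "\<bar>l2inner f g\<bar> \<le> l2norm f * l2norm g"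
proof -
  define A B C where "A = (\<integral>x. (f x)\<^sup>2 \<partial>lborel)" and "B = (\<integral>x. (g x)\<^sup>2 \<partial>lborel)" and "C = l2inner f g"
  have nn: "A \<ge> 0" "B \<ge> 0" by (auto simp: A_def B_def)
  have "C\<^sup>2 \<le> A * B"
  proof -
    have I: "0 \<le> s\<^sup>2 * A + 2 * s * t * C + t\<^sup>2 * B" for s t
    proof -
      have "0 \<le> (\<integral>x. (s * f x + t * g x)\<^sup>2 \<partial>lborel)" by simp
      also have "\<dots> = (\<integral>x. s\<^sup>2 * (f x)\<^sup>2 + (2 * s * t) * (f x * g x) + t\<^sup>2 * (g x)\<^sup>2 \<partial>lborel)"
        by (intro Bochner_Integration.integral_cong) (auto simp: power2_eq_square algebra_simps)
      also have "\<dots> = s\<^sup>2 * A + 2 * s * t * C + t\<^sup>2 * B"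
        using L2_mult_integrable[OF assms] assms[THEN L2_sq_integrable]
        by (simp add: A_def B_def C_def l2inner_def)
      finally show ?thesis .
    qed
    \<comment> \<open>The choice s = B, t = -C minimises the quadratic form in t for the given s,
      provided B is not 0.\<close>
    have "0 \<le> B * (A * B - C\<^sup>2)"
      using I[of B "- C"] by (simp add: power2_eq_square algebra_simps)
    then show ?thesis
    proof (cases "B = 0")
      case True
      have "0 \<le> A + 2 * t * C" for t using I[of 1 t] True by simp
      \<comment> \<open>For B = 0 the form is affine in t; if C were nonzero, this t would give it
        the value -1.\<close>
      from this[of "- (A + 1) / (2 * C)"] have "C = 0"
        by (cases "C = 0") (auto simp: field_simps)
      then show ?thesis using True by simp
    next
      case False
      then show ?thesis using \<open>0 \<le> B * (A * B - C\<^sup>2)\<close> nn by (auto simp: zero_le_mult_iff)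
    qed
  qed
  then have "sqrt (C\<^sup>2) \<le> sqrt (A * B)" by (rule real_sqrt_le_mono)
  then show ?thesis by (simp add: A_def B_def C_def l2norm_def real_sqrt_mult)
qed

definition mass :: "('n::finite) rfun \<Rightarrow> (real^'n) set \<Rightarrow> real" where
  "mass f Q = (\<integral>x. indicator Q x * \<bar>f x\<bar> \<partial>lborel)"

lemma mass_nonneg [simp]: "0 \<le> mass f Q"
  by (simp add: mass_def integral_nonneg)

lemma integrable_mass:
  assumes "L2 f" "Q \<in> sets borel" "emeasure lborel Q < \<infinity>"
  shows "integrable lborel (\<lambda>x. indicator Q x * f x)" "integrable lborel (\<lambda>x. indicator Q x * \<bar>f x\<bar>)"
proof -
  show *: "integrable lborel (\<lambda>x. indicator Q x * f x)"
    using assms by (intro L2_mult_integrable L2_indicator)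
  from integrable_abs[OF this] show "integrable lborel (\<lambda>x. indicator Q x * \<bar>f x\<bar>)"
    by (simp add: abs_mult)
qed

lemma integrable_mass_dlevel:
  assumes "L2 f" "Q \<in> dlevel \<omega> k"
  shows "integrable lborel (\<lambda>x. indicator Q x * f x)" "integrable lborel (\<lambda>x. indicator Q x * \<bar>f x\<bar>)"
  using integrable_mass[OF assms(1), of Q] emeasure_dlevel[OF assms(2)] dlevel_borel[OF assms(2)] by auto

lemma sum_disjoint_integral_le:
  assumes "finite F" "F \<subseteq> dlevel \<omega> k" "\<And>A. A \<in> F \<Longrightarrow> A \<subseteq> Q" "\<And>x. 0 \<le> u x"
    and "integrable lborel (\<lambda>x. indicator Q x * u x)"
    and "\<And>A. A \<in> F \<Longrightarrow> integrable lborel (\<lambda>x. indicator A x * (u x :: real))"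
  shows "(\<Sum>A\<in>F. \<integral>x. indicator A x * u x \<partial>lborel) \<le> (\<integral>x. indicator Q x * u x \<partial>lborel)"
proof -
  have "(\<Sum>A\<in>F. \<integral>x. indicator A x * u x \<partial>lborel) = (\<integral>x. (\<Sum>A\<in>F. indicator A x * u x) \<partial>lborel)"
    using assms(6) by (simp add: integral_sum)
  also have "\<dots> \<le> (\<integral>x. indicator Q x * u x \<partial>lborel)"
  proof (rule integral_mono)
    fix x
    have "disjoint F"
      using assms(2) dlevel_disjoint unfolding pairwise_def disjnt_def by blast
    then have "indicator (\<Union>A\<in>F. A) x = (\<Sum>A\<in>F. indicator A x :: real)"
      by (intro indicator_UN_disjoint assms(1)) (simp add: disjoint_family_on_def pairwise_def disjnt_def)
    then have "(\<Sum>A\<in>F. indicator A x :: real) = indicator (\<Union>F) x"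
      by simp
    also have "\<dots> \<le> indicator Q x"
      using assms(3) by (auto split: split_indicator)
    finally show "(\<Sum>A\<in>F. indicator A x * u x) \<le> indicator Q x * u x"
      using assms(4)[of x] by (simp add: sum_distrib_right[symmetric] mult_right_mono)
  next
    show "integrable lborel (\<lambda>x. \<Sum>A\<in>F. indicator A x * u x)"
      using assms(6) by (rule Bochner_Integration.integrable_sum)
  qed (fact assms(5))
  finally show ?thesis .
qed

text \<open>The cubes of one level are disjoint, so their masses add up. A sum over an infinite
  \<open>F\<close> is 0 by convention, so that the finiteness of \<open>dsub\<close> never has to be
  checked.\<close>

lemma sum_mass_le:
  assumes "L2 f" "F \<subseteq> dlevel \<omega> k" "\<And>A. A \<in> F \<Longrightarrow> A \<subseteq> Q" "integrable lborel (\<lambda>x. indicator Q x * \<bar>f x\<bar>)"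
  shows "(\<Sum>A\<in>F. mass f A) \<le> mass f Q"
proof (cases "finite F")
  case True
  then show ?thesis unfolding mass_def
    using assms by (intro sum_disjoint_integral_le) (auto intro: integrable_mass_dlevel)
qed simp

lemma mass_sq_le:
  assumes "L2 f" "Q \<in> dlevel \<omega> k"
  shows "(mass f Q)\<^sup>2 \<le> measure lborel Q * (\<integral>x. indicator Q x * (f x)\<^sup>2 \<partial>lborel)"
proof -
  have Qm: "Q \<in> sets borel" "emeasure lborel Q < \<infinity>"
    using emeasure_dlevel[OF assms(2)] dlevel_borel[OF assms(2)] by auto
  have L2Q: "L2 (\<lambda>x. indicator Q x * f x)"
  proof -
    have "integrable lborel (\<lambda>x. indicator Q x * (f x)\<^sup>2)"
      using integrable_mult_indicator[of Q lborel "\<lambda>x. (f x)\<^sup>2"] Qm L2_sq_integrable[OF assms(1)] by simp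
    moreover have "(indicator Q x * f x)\<^sup>2 = indicator Q x * (f x)\<^sup>2" for x
      by (simp split: split_indicator)
    ultimately show ?thesis
      using Qm assms(1) by (auto simp: L2_def)
  qed
  then have L2Q': "L2 (\<lambda>x. indicator Q x * \<bar>f x\<bar>)"
  proof -
    have [measurable]: "f \<in> borel_measurable borel" using assms(1) by measurable
    have "(indicator Q x * \<bar>f x\<bar>)\<^sup>2 = (indicator Q x * f x)\<^sup>2" for x
      by (simp add: power_mult_distrib)
    then show ?thesis
      using Qm L2_sq_integrable[OF L2Q] by (simp add: L2_def)
  qed
  have "\<bar>l2inner (\<lambda>x. indicator Q x) (\<lambda>x. indicator Q x * \<bar>f x\<bar>)\<bar>
     \<le> l2norm (\<lambda>x. indicator Q x) * l2norm (\<lambda>x. indicator Q x * \<bar>f x\<bar>)"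
    by (rule l2inner_bound[OF L2_indicator[OF Qm] L2Q'])
  moreover have "l2inner (\<lambda>x. indicator Q x) (\<lambda>x. indicator Q x * \<bar>f x\<bar>) = mass f Q"
    unfolding l2inner_def mass_def by (intro Bochner_Integration.integral_cong) (auto split: split_indicator)
  moreover have "l2norm (\<lambda>x. indicator Q x) = sqrt (measure lborel Q)"
  proof -
    have "(indicator Q x :: real)\<^sup>2 = indicator Q x" for x by (simp split: split_indicator)
    then show ?thesis using Qm by (simp add: l2norm_def)
  qed
  moreover have "l2norm (\<lambda>x. indicator Q x * \<bar>f x\<bar>) = sqrt (\<integral>x. indicator Q x * (f x)\<^sup>2 \<partial>lborel)"
  proof -
    have "(indicator Q x * \<bar>f x\<bar>)\<^sup>2 = indicator Q x * (f x)\<^sup>2" for x by (simp split: split_indicator)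
    then show ?thesis by (simp add: l2norm_def)
  qed
  ultimately have "\<bar>mass f Q\<bar> \<le> sqrt (measure lborel Q * (\<integral>x. indicator Q x * (f x)\<^sup>2 \<partial>lborel))"
    by (simp add: real_sqrt_mult)
  then have "\<bar>mass f Q\<bar>\<^sup>2 \<le> (sqrt (measure lborel Q * (\<integral>x. indicator Q x * (f x)\<^sup>2 \<partial>lborel)))\<^sup>2"
    by (rule power_mono) simp
  then show ?thesis by (simp add: integral_nonneg)
qed

text \<open>The normalisation bounds only the products of the two Haar functions, so neither factor
  can be estimated separately.\<close>

lemma product_normalised_bound:
  assumes prod: "\<And>x y. \<bar>h1 y * h2 x\<bar> \<le> (1::real)"
    and supp: "\<And>y. y \<notin> A \<Longrightarrow> h1 y = 0" "\<And>x. x \<notin> B \<Longrightarrow> h2 x = 0"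
    and int: "integrable lborel (\<lambda>x. indicator A x * \<bar>f x\<bar>)" "integrable lborel (\<lambda>x. indicator B x * \<bar>g x\<bar>)"
  shows "\<bar>l2inner f h1 * l2inner h2 g\<bar> \<le> mass f A * mass g B"
proof -
  define \<alpha> where "\<alpha> = l2inner f h1"
  \<comment> \<open>Pulling the number \<open>h2 x\<close> into the integral defining
    \<open>\<alpha>\<close> brings both Haar functions under one integral sign, where the bound on
    their product applies.\<close>
  have A: "\<bar>\<alpha> * h2 x\<bar> \<le> mass f A" for x
  proof -
    have "\<alpha> * h2 x = (\<integral>y. f y * h1 y * h2 x \<partial>lborel)"
      by (simp add: \<alpha>_def l2inner_def)
    also have "\<bar>\<dots>\<bar> \<le> mass f A"
      unfolding mass_def
    proof (rule abs_integral_le[OF int(1)])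
      fix y show "\<bar>f y * h1 y * h2 x\<bar> \<le> indicator A y * \<bar>f y\<bar>"
        using prod[of y x] supp(1)[of y] mult_left_mono[OF prod[of y x], of "\<bar>f y\<bar>"]
        by (cases "y \<in> A") (auto simp: abs_mult mult.assoc)
    qed
    finally show ?thesis .
  qed
  have "\<alpha> * l2inner h2 g = (\<integral>x. \<alpha> * (h2 x * g x) \<partial>lborel)"
    by (simp add: l2inner_def)
  also have "\<bar>\<dots>\<bar> \<le> (\<integral>x. mass f A * (indicator B x * \<bar>g x\<bar>) \<partial>lborel)"
  proof (rule abs_integral_le)
    show "integrable lborel (\<lambda>x. mass f A * (indicator B x * \<bar>g x\<bar>))" using int(2) by simp
    fix x show "\<bar>\<alpha> * (h2 x * g x)\<bar> \<le> mass f A * (indicator B x * \<bar>g x\<bar>)"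
      using mult_right_mono[OF A[of x], of "\<bar>g x\<bar>"] supp(2)[of x]
      by (cases "x \<in> B") (auto simp: abs_mult mult.assoc)
  qed
  also have "\<dots> = mass f A * mass g B" by (simp add: mass_def)
  finally show ?thesis by (simp add: \<alpha>_def)
qed

section \<open>One scale of a shift: size, support, linearity and local constancy\<close>

definition shift_data :: "'n::finite rgrid \<Rightarrow> nat \<Rightarrow> nat \<Rightarrow> ((real^'n) set \<Rightarrow> (real^'n) set \<Rightarrow> 'n rfun)
     \<Rightarrow> ((real^'n) set \<Rightarrow> (real^'n) set \<Rightarrow> 'n rfun) \<Rightarrow> bool" where
  "shift_data \<omega> m n hA hB \<longleftrightarrow>
     (\<forall>k. \<forall>Q\<in>dlevel \<omega> k. \<forall>Q'\<in>dsub \<omega> k m Q. \<forall>Q''\<in>dsub \<omega> k n Q.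
            haar_fun \<omega> (k - int n) Q'' (hA Q' Q'') \<and>
            haar_fun \<omega> (k - int m) Q' (hB Q'' Q') \<and>
            (\<forall>x y. \<bar>hA Q' Q'' y * hB Q'' Q' x\<bar> \<le> 1))"

lemma shift_dataD:
  assumes "shift_data \<omega> m n hA hB" "Q \<in> dlevel \<omega> k" "Q' \<in> dsub \<omega> k m Q" "Q'' \<in> dsub \<omega> k n Q"
  shows "haar_fun \<omega> (k - int n) Q'' (hA Q' Q'')" "haar_fun \<omega> (k - int m) Q' (hB Q'' Q')"
    "\<bar>hA Q' Q'' y * hB Q'' Q' x\<bar> \<le> 1"
  using assms unfolding shift_data_def by blast+

definition scale_form :: "'n::finite rgrid \<Rightarrow> int \<Rightarrow> nat \<Rightarrow> nat \<Rightarrow> ((real^'n) set \<Rightarrow> (real^'n) set \<Rightarrow> 'n rfun)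
     \<Rightarrow> ((real^'n) set \<Rightarrow> (real^'n) set \<Rightarrow> 'n rfun) \<Rightarrow> 'n rfun \<Rightarrow> 'n rfun \<Rightarrow> real" where
  "scale_form \<omega> k m n hA hB f g = (\<Sum>\<^sub>\<infinity>Q\<in>dlevel \<omega> k. shift_term \<omega> k m n hA hB Q f g)"

lemma haar_shift_iff:
  "haar_shift \<omega> m n T \<longleftrightarrow> (\<exists>hA hB. shift_data \<omega> m n hA hB \<and> (\<forall>f g. L2 f \<longrightarrow> L2 g \<longrightarrow>
     (\<lambda>N::nat. \<Sum>k\<in>{- int N..int N}. scale_form \<omega> k m n hA hB f g) \<longlonglongrightarrow> l2inner (T f) g))"
  unfolding haar_shift_def shift_data_def scale_form_def ..

text \<open>The bound on each summand is a product of a mass on \<open>Q''\<close> and a mass on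
  \<open>Q'\<close>, so the double sum factorises and each factor is at most the mass on
  \<open>Q\<close>. The number of subcubes does not enter, which makes the bound uniform in
  \<open>m\<close> and \<open>n\<close>.\<close>

lemma shift_term_bound:
  assumes sd: "shift_data \<omega> m n hA hB" and Q: "Q \<in> dlevel \<omega> k" and L2: "L2 f" "L2 g"
  shows "\<bar>shift_term \<omega> k m n hA hB Q f g\<bar> \<le> mass f Q * mass g Q / measure lborel Q"
proof -
  let ?s = "\<Sum>Q'\<in>dsub \<omega> k m Q. \<Sum>Q''\<in>dsub \<omega> k n Q. l2inner f (hA Q' Q'') * l2inner (hB Q'' Q') g"
  have "\<bar>?s\<bar> \<le> (\<Sum>Q'\<in>dsub \<omega> k m Q. \<Sum>Q''\<in>dsub \<omega> k n Q. mass f Q'' * mass g Q')"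
  proof (rule order_trans[OF sum_abs], rule sum_mono, rule order_trans[OF sum_abs], rule sum_mono)
    fix Q' Q'' assume Q': "Q' \<in> dsub \<omega> k m Q" "Q'' \<in> dsub \<omega> k n Q"
    note D = shift_dataD[OF sd Q Q']
    show "\<bar>l2inner f (hA Q' Q'') * l2inner (hB Q'' Q') g\<bar> \<le> mass f Q'' * mass g Q'"
      using Q' L2 by (intro product_normalised_bound D haar_fun_support[OF D(1)] haar_fun_support[OF D(2)]
            integrable_mass_dlevel(2)) (auto simp: dsub_def)
  qed
  also have "\<dots> = (\<Sum>Q''\<in>dsub \<omega> k n Q. mass f Q'') * (\<Sum>Q'\<in>dsub \<omega> k m Q. mass g Q')"
    by (simp add: sum_product sum_distrib_left sum_distrib_right)
  also have "\<dots> \<le> mass f Q * mass g Q"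
    using L2 Q by (intro mult_mono sum_mass_le sum_nonneg) (auto simp: dsub_def intro: integrable_mass_dlevel)
  finally show ?thesis
    by (simp add: shift_term_def abs_mult divide_right_mono)
qed

text \<open>By Cauchy-Schwarz on each cube the factor 1/|Q| cancels, leaving the integrals of the
  squares over disjoint cubes. Absolute summability is what permits splitting the infinite sum in
  \<open>scale_form_linear\<close>.\<close>

lemma shift_term_abs_summable:
  assumes sd: "shift_data \<omega> m n hA hB" and L2: "L2 f" "L2 g"
  shows "(\<lambda>Q. norm (shift_term \<omega> k m n hA hB Q f g)) summable_on dlevel \<omega> k"
proof (rule nonneg_bdd_above_summable_on)
  let ?B = "((\<integral>x. (f x)\<^sup>2 \<partial>lborel) + (\<integral>x. (g x)\<^sup>2 \<partial>lborel))"
  have int: "integrable lborel (\<lambda>x. indicator Q x * (u x)\<^sup>2)" if "L2 u" "Q \<in> dlevel \<omega> k" for u Q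
    using integrable_mult_indicator[of Q lborel "\<lambda>x. (u x)\<^sup>2"] dlevel_borel that L2_sq_integrable by auto
  have "(\<Sum>Q\<in>F. norm (shift_term \<omega> k m n hA hB Q f g)) \<le> ?B" if F: "F \<subseteq> dlevel \<omega> k" "finite F" for F
  proof -
    have "(\<Sum>Q\<in>F. norm (shift_term \<omega> k m n hA hB Q f g)) \<le>
       (\<Sum>Q\<in>F. (\<integral>x. indicator Q x * (f x)\<^sup>2 \<partial>lborel) + (\<integral>x. indicator Q x * (g x)\<^sup>2 \<partial>lborel))"
    proof (rule sum_mono)
      fix Q assume "Q \<in> F"
      then have Q: "Q \<in> dlevel \<omega> k" using F by blast
      have pos: "0 < measure lborel Q" by (simp add: measure_dlevel[OF Q])
      let ?X = "\<integral>x. indicator Q x * (f x)\<^sup>2 \<partial>lborel" and ?Y = "\<integral>x. indicator Q x * (g x)\<^sup>2 \<partial>lborel"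
      have "0 \<le> (mass f Q - mass g Q)\<^sup>2" "0 \<le> mass f Q * mass g Q" by simp_all
      then have "mass f Q * mass g Q \<le> (mass f Q)\<^sup>2 + (mass g Q)\<^sup>2"
        unfolding power2_diff by linarith
      also have "\<dots> \<le> measure lborel Q * (?X + ?Y)"
        using mass_sq_le[OF L2(1) Q] mass_sq_le[OF L2(2) Q] by (simp add: distrib_left)
      finally have "mass f Q * mass g Q / measure lborel Q \<le> ?X + ?Y"
        using pos by (simp add: divide_le_eq mult.commute)
      then show "norm (shift_term \<omega> k m n hA hB Q f g) \<le> ?X + ?Y"
        using shift_term_bound[OF sd Q L2] by simp
    qed
    also have "\<dots> \<le> ?B"
      using F sum_disjoint_integral_le[OF F(2,1), of UNIV "\<lambda>x. (f x)\<^sup>2"]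
        sum_disjoint_integral_le[OF F(2,1), of UNIV "\<lambda>x. (g x)\<^sup>2"] int[OF L2(1)] int[OF L2(2)]
        L2_sq_integrable[OF L2(1)] L2_sq_integrable[OF L2(2)]
      by (auto simp: sum.distrib intro!: add_mono)
    finally show ?thesis .
  qed
  then show "bdd_above (sum (\<lambda>Q. norm (shift_term \<omega> k m n hA hB Q f g)) ` {F. F \<subseteq> dlevel \<omega> k \<and> finite F})"
    by (intro bdd_aboveI2[of _ _ ?B]) auto
qed simp

lemma shift_term_summable:
  assumes sd: "shift_data \<omega> m n hA hB" and L2: "L2 f" "L2 g"
  shows "(\<lambda>Q. shift_term \<omega> k m n hA hB Q f g) summable_on dlevel \<omega> k"
  by (rule summable_on_iff_abs_summable_on_real[THEN iffD2, OF shift_term_abs_summable[OF assms]])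

lemma haar_fun_mult_integrable:
  assumes "haar_fun \<omega> k Q h" "L2 f"
  shows "integrable lborel (\<lambda>x. f x * h x)"
proof -
  obtain c where h: "h = (\<lambda>x. \<Sum>Q'\<in>dsub \<omega> k 1 Q. c Q' * indicator Q' x)"
    using assms(1) by (auto simp: haar_fun_def fun_eq_iff)
  have "integrable lborel (\<lambda>x. \<Sum>Q'\<in>dsub \<omega> k 1 Q. c Q' * (indicator Q' x * f x))"
    using assms(2) by (intro Bochner_Integration.integrable_sum integrable_mult_right integrable_mass_dlevel(1))
       (auto simp: dsub_def)
  then show ?thesis
    by (simp add: h sum_distrib_left mult_ac)
qed

lemma scale_form_linear:
  assumes sd: "shift_data \<omega> m n hA hB" and L2: "L2 f" "L2 f'" "L2 g"
  shows "scale_form \<omega> k m n hA hB (\<lambda>x. a * f x + b * f' x) g =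
     a * scale_form \<omega> k m n hA hB f g + b * scale_form \<omega> k m n hA hB f' g"
proof -
  let ?st = "shift_term \<omega> k m n hA hB"
  have "?st Q (\<lambda>x. a * f x + b * f' x) g = a * ?st Q f g + b * ?st Q f' g" if Q: "Q \<in> dlevel \<omega> k" for Q
  proof -
    have "l2inner (\<lambda>x. a * f x + b * f' x) (hA Q' Q'') * l2inner (hB Q'' Q') g =
        a * (l2inner f (hA Q' Q'') * l2inner (hB Q'' Q') g) + b * (l2inner f' (hA Q' Q'') * l2inner (hB Q'' Q') g)"
      if "Q' \<in> dsub \<omega> k m Q" "Q'' \<in> dsub \<omega> k n Q" for Q' Q''
    proof -
      note D = shift_dataD[OF sd Q that]
      have "l2inner (\<lambda>x. a * f x + b * f' x) (hA Q' Q'') = a * l2inner f (hA Q' Q'') + b * l2inner f' (hA Q' Q'')"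
        using haar_fun_mult_integrable[OF D(1) L2(1)] haar_fun_mult_integrable[OF D(1) L2(2)]
        by (simp add: l2inner_def distrib_right mult.assoc)
      then show ?thesis by (simp add: distrib_right mult.assoc)
    qed
    then show ?thesis
      by (simp add: shift_term_def sum.distrib sum_distrib_left distrib_left mult_ac cong: sum.cong)
  qed
  then have "scale_form \<omega> k m n hA hB (\<lambda>x. a * f x + b * f' x) g =
      (\<Sum>\<^sub>\<infinity>Q\<in>dlevel \<omega> k. a * ?st Q f g + b * ?st Q f' g)"
    unfolding scale_form_def by (rule infsum_cong)
  also have "\<dots> = (\<Sum>\<^sub>\<infinity>Q\<in>dlevel \<omega> k. a * ?st Q f g) + (\<Sum>\<^sub>\<infinity>Q\<in>dlevel \<omega> k. b * ?st Q f' g)"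
    using L2 by (intro infsum_add summable_on_cmult_right shift_term_summable[OF sd])
  finally show ?thesis
    by (simp add: scale_form_def infsum_cmult_right')
qed

text \<open>The operator enters only through its weak series, so linearity is inherited from the
  single scales after pairing with \<open>g\<close>.\<close>

lemma haar_shift_linear:
  assumes T: "haar_shift \<omega> m n T" and L2: "L2 f" "L2 f'" "L2 g"
  shows "l2inner (T (\<lambda>x. a * f x + b * f' x)) g = a * l2inner (T f) g + b * l2inner (T f') g"
proof -
  obtain hA hB where sd: "shift_data \<omega> m n hA hB" and
    lim: "\<And>f g. L2 f \<Longrightarrow> L2 g \<Longrightarrow>
      (\<lambda>N::nat. \<Sum>k\<in>{- int N..int N}. scale_form \<omega> k m n hA hB f g) \<longlonglongrightarrow> l2inner (T f) g"
    using T by (auto simp: haar_shift_iff)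
  have "(\<lambda>N::nat. \<Sum>k\<in>{- int N..int N}. scale_form \<omega> k m n hA hB (\<lambda>x. a * f x + b * f' x) g)
     \<longlonglongrightarrow> a * l2inner (T f) g + b * l2inner (T f') g"
    unfolding scale_form_linear[OF sd L2] sum.distrib sum_distrib_left[symmetric]
    by (intro tendsto_intros lim L2)
  with lim[OF L2_lincomb[OF L2(1,2)] L2(3)] show ?thesis
    by (rule LIMSEQ_unique)
qed

text \<open>All cubes of the level have the same volume. One mass is estimated by the full L^1 norm,
  and the masses of the other function are summed over the disjoint cubes.\<close>

lemma scale_form_bound:
  assumes sd: "shift_data \<omega> m n hA hB" and L2: "L2 (f :: 'n::finite rfun)" "L2 g"
    and int: "integrable lborel f" "integrable lborel g"
  shows "\<bar>scale_form \<omega> k m n hA hB f g\<bar> \<le>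
    (\<integral>x. \<bar>f x\<bar> \<partial>lborel) * (\<integral>x. \<bar>g x\<bar> \<partial>lborel) / (2 powr k) ^ CARD('n)"
proof -
  let ?st = "\<lambda>Q. shift_term \<omega> k m n hA hB Q f g" and ?V = "(2 powr k) ^ CARD('n) :: real"
  have le: "mass u Q \<le> (\<integral>x. \<bar>u x\<bar> \<partial>lborel)" if "integrable lborel u" "L2 u" "Q \<in> dlevel \<omega> k" for u Q
    unfolding mass_def using that
    by (intro integral_mono integrable_mass_dlevel(2)) (auto split: split_indicator)
  have "\<bar>scale_form \<omega> k m n hA hB f g\<bar> \<le> (\<Sum>\<^sub>\<infinity>Q\<in>dlevel \<omega> k. norm (?st Q))"
    unfolding scale_form_def using norm_infsum_bound[OF shift_term_abs_summable[OF sd L2]] by simp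
  also have "\<dots> \<le> (\<integral>x. \<bar>f x\<bar> \<partial>lborel) * (\<integral>x. \<bar>g x\<bar> \<partial>lborel) / ?V"
  proof (rule infsum_le_finite_sums[OF shift_term_abs_summable[OF sd L2]])
    fix F assume F: "finite F" "F \<subseteq> dlevel \<omega> k"
    have "(\<Sum>Q\<in>F. norm (?st Q)) \<le> (\<Sum>Q\<in>F. (\<integral>x. \<bar>f x\<bar> \<partial>lborel) * mass g Q / ?V)"
    proof (rule sum_mono)
      fix Q assume "Q \<in> F"
      then have Q: "Q \<in> dlevel \<omega> k" using F by blast
      have "norm (?st Q) \<le> mass f Q * mass g Q / ?V"
        using shift_term_bound[OF sd Q L2] by (simp add: measure_dlevel[OF Q])
      also have "\<dots> \<le> (\<integral>x. \<bar>f x\<bar> \<partial>lborel) * mass g Q / ?V"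
        using le[OF int(1) L2(1) Q] by (intro divide_right_mono mult_right_mono) auto
      finally show "norm (?st Q) \<le> (\<integral>x. \<bar>f x\<bar> \<partial>lborel) * mass g Q / ?V" .
    qed
    also have "\<dots> = (\<integral>x. \<bar>f x\<bar> \<partial>lborel) * (\<Sum>Q\<in>F. mass g Q) / ?V"
      by (simp add: sum_distrib_left sum_divide_distrib)
    also have "\<dots> \<le> (\<integral>x. \<bar>f x\<bar> \<partial>lborel) * (\<integral>x. \<bar>g x\<bar> \<partial>lborel) / ?V"
      using sum_mass_le[OF L2(2) F(2), of UNIV] int
      by (intro divide_right_mono mult_left_mono) (auto simp: mass_def)
    finally show "(\<Sum>Q\<in>F. norm (?st Q)) \<le> (\<integral>x. \<bar>f x\<bar> \<partial>lborel) * (\<integral>x. \<bar>g x\<bar> \<partial>lborel) / ?V" .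
  qed
  finally show ?thesis .
qed

lemma scale_form_separated:
  assumes sd: "shift_data \<omega> m n hA hB" and L2: "L2 (f :: 'n::finite rfun)" "L2 g"
    and sep: "\<And>x y. g x \<noteq> 0 \<Longrightarrow> f y \<noteq> 0 \<Longrightarrow> real CARD('n) * 2 powr k \<le> dist x y"
  shows "scale_form \<omega> k m n hA hB f g = 0"
proof -
  have "shift_term \<omega> k m n hA hB Q f g = 0" if Q: "Q \<in> dlevel \<omega> k" for Q
  proof -
    have "(\<forall>x\<in>Q. g x = 0) \<or> (\<forall>y\<in>Q. f y = 0)"
      using sep cell_eq_dist dlevel_cell_eq[OF Q] by (metis linorder_not_less)
    then have "mass f Q = 0 \<or> mass g Q = 0"
    proof
      assume "\<forall>x\<in>Q. g x = 0"
      then have "(\<lambda>x. indicator Q x * \<bar>g x\<bar>) = (\<lambda>x. 0)" by (auto split: split_indicator)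
      then show ?thesis by (simp add: mass_def)
    next
      assume "\<forall>x\<in>Q. f x = 0"
      then have "(\<lambda>x. indicator Q x * \<bar>f x\<bar>) = (\<lambda>x. 0)" by (auto split: split_indicator)
      then show ?thesis by (simp add: mass_def)
    qed
    then show ?thesis using shift_term_bound[OF sd Q L2] by auto
  qed
  then show ?thesis by (simp add: scale_form_def cong: infsum_cong)
qed

text \<open>On a cell of level \<open>k - int n - 1\<close> resp. \<open>k - int m - 1\<close> every
  Haar function involved is constant, so it comes out of the integral. It is essential that
  \<open>\<kappa>\<close> is chosen before \<open>f\<close> and \<open>g\<close>: two pairs living
  in the same cells share it.\<close>

lemma scale_form_same_cell:
  assumes sd: "shift_data \<omega> m n hA hB"
  obtains \<kappa> where "\<And>f g. (\<And>y. f y \<noteq> 0 \<Longrightarrow> cell \<omega> (k - int n - 1) y = cell \<omega> (k - int n - 1) y0) \<Longrightarrow>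
      (\<And>x. g x \<noteq> 0 \<Longrightarrow> cell \<omega> (k - int m - 1) x = cell \<omega> (k - int m - 1) x0) \<Longrightarrow>
      scale_form \<omega> k m n hA hB f g = \<kappa> * ((\<integral>y. f y \<partial>lborel) * (\<integral>x. g x \<partial>lborel))"
proof
  \<comment> \<open>This is the contribution of \<open>Q\<close> to the kernel of the scale,
    evaluated at \<open>(x0, y0)\<close>.\<close>
  let ?\<kappa> = "\<lambda>Q. 1 / measure lborel Q * (\<Sum>Q'\<in>dsub \<omega> k m Q. \<Sum>Q''\<in>dsub \<omega> k n Q. hA Q' Q'' y0 * hB Q'' Q' x0)"
  fix f g :: "'a rfun"
  assume f: "\<And>y. f y \<noteq> 0 \<Longrightarrow> cell \<omega> (k - int n - 1) y = cell \<omega> (k - int n - 1) y0"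
    and g: "\<And>x. g x \<noteq> 0 \<Longrightarrow> cell \<omega> (k - int m - 1) x = cell \<omega> (k - int m - 1) x0"
  let ?c = "(\<integral>y. f y \<partial>lborel) * (\<integral>x. g x \<partial>lborel)"
  have "shift_term \<omega> k m n hA hB Q f g = ?\<kappa> Q * ?c" if Q: "Q \<in> dlevel \<omega> k" for Q
  proof -
    have "l2inner f (hA Q' Q'') * l2inner (hB Q'' Q') g = hA Q' Q'' y0 * hB Q'' Q' x0 * ?c"
      if "Q' \<in> dsub \<omega> k m Q" "Q'' \<in> dsub \<omega> k n Q" for Q' Q''
    proof -
      note D = shift_dataD[OF sd Q that]
      have "(\<lambda>y. f y * hA Q' Q'' y) = (\<lambda>y. f y * hA Q' Q'' y0)"
      proof
        fix y show "f y * hA Q' Q'' y = f y * hA Q' Q'' y0"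
          using f[of y] haar_fun_const[OF D(1), of y y0] by (cases "f y = 0") auto
      qed
      moreover have "(\<lambda>x. hB Q'' Q' x * g x) = (\<lambda>x. hB Q'' Q' x0 * g x)"
      proof
        fix x show "hB Q'' Q' x * g x = hB Q'' Q' x0 * g x"
          using g[of x] haar_fun_const[OF D(2), of x x0] by (cases "g x = 0") auto
      qed
      ultimately show ?thesis by (simp add: l2inner_def)
    qed
    then show ?thesis
      by (simp add: shift_term_def sum_distrib_right mult.assoc cong: sum.cong)
  qed
  then show "scale_form \<omega> k m n hA hB f g = (\<Sum>\<^sub>\<infinity>Q\<in>dlevel \<omega> k. ?\<kappa> Q) * ?c"
    unfolding scale_form_def infsum_cmult_left'[symmetric] by (intro infsum_cong)
qed

section \<open>Haar shifts on separated supports\<close>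

definition l1norm :: "'n::finite rfun \<Rightarrow> real" where
  "l1norm f = (\<integral>x. \<bar>f x\<bar> \<partial>lborel)"

lemma l1norm_nonneg [simp]: "0 \<le> l1norm f"
  by (simp add: l1norm_def)

definition separated :: "real \<Rightarrow> 'n::finite rfun \<Rightarrow> 'n rfun \<Rightarrow> bool" where
  "separated \<rho> f g \<longleftrightarrow> (\<forall>x y. f y \<noteq> 0 \<longrightarrow> g x \<noteq> 0 \<longrightarrow> \<rho> \<le> dist x y)"

definition in_box :: "real \<Rightarrow> real^'n::finite \<Rightarrow> 'n rfun \<Rightarrow> bool" where
  "in_box h a f \<longleftrightarrow> (\<forall>x. f x \<noteq> 0 \<longrightarrow> (\<forall>i. a $ i \<le> x $ i \<and> x $ i \<le> a $ i + h))"

lemma bdd_cpt_fun_bound: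
  assumes "bdd_cpt_fun f"
  shows "\<exists>Z B. compact Z \<and> B \<ge> 0 \<and> (\<forall>x. \<bar>f x\<bar> \<le> B * indicator Z x)"
proof -
  obtain B where B: "\<And>x. \<bar>f x\<bar> \<le> B" using assms by (auto simp: bdd_cpt_fun_def)
  have "B \<ge> 0" using B[of 0] by linarith
  have "\<bar>f x\<bar> \<le> B * indicator (closure {x. f x \<noteq> 0}) x" for x
  proof (cases "f x = 0")
    case True
    then show ?thesis using \<open>B \<ge> 0\<close> by simp
  next
    case False
    then have "x \<in> closure {x. f x \<noteq> 0}" using closure_subset[of "{x. f x \<noteq> 0}"] by auto
    then show ?thesis using B[of x] by simp
  qed
  then show ?thesis
    using assms \<open>B \<ge> 0\<close> unfolding bdd_cpt_fun_def by blast
qed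

lemma bdd_cpt_fun_measurable [measurable_dest]: "bdd_cpt_fun f \<Longrightarrow> f \<in> borel_measurable borel"
  by (simp add: bdd_cpt_fun_def)

lemma bdd_cpt_fun_integrable:
  assumes "bdd_cpt_fun f"
  shows "integrable lborel f"
proof -
  obtain B Z where Z: "compact Z" "B \<ge> 0" "\<And>x. \<bar>f x\<bar> \<le> B * indicator Z x"
    using bdd_cpt_fun_bound[OF assms] by blast
  show ?thesis
  proof (rule Bochner_Integration.integrable_bound)
    have "integrable lborel (indicat_real Z)"
      using borel_compact[OF Z(1)] emeasure_compact_finite[OF Z(1)] by (intro integrable_real_indicator) simp_all
    then show "integrable lborel (\<lambda>x. B * indicator Z x)"
      by (rule integrable_mult_right)
    show "f \<in> borel_measurable lborel" using assms by (simp add: bdd_cpt_fun_def)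
    show "AE x in lborel. norm (f x) \<le> norm (B * indicator Z x)"
      using Z(2,3) by (auto intro!: AE_I2 simp: abs_mult)
  qed
qed

lemma bdd_cpt_fun_L2:
  assumes "bdd_cpt_fun f"
  shows "L2 f"
proof -
  obtain B where B: "\<And>x. \<bar>f x\<bar> \<le> B" using assms by (auto simp: bdd_cpt_fun_def)
  note [measurable] = assms
  have "integrable lborel (\<lambda>x. (f x)\<^sup>2)"
  proof (rule Bochner_Integration.integrable_bound)
    show "integrable lborel (\<lambda>x. B * f x)"
      using bdd_cpt_fun_integrable[OF assms] by simp
    have "\<bar>f x\<bar> * \<bar>f x\<bar> \<le> \<bar>B\<bar> * \<bar>f x\<bar>" for x
      using B[of x] by (intro mult_right_mono) auto
    then show "AE x in lborel. norm ((f x)\<^sup>2) \<le> norm (B * f x)"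
      by (simp add: power2_eq_square abs_mult)
  qed measurable
  then show ?thesis by (simp add: L2_def)
qed

lemma same_cell_of_not_cut:
  assumes "\<And>i. \<not> cut \<omega> k i (a $ i) (a $ i + h)" "\<And>i. a $ i \<le> x $ i \<and> x $ i \<le> a $ i + h"
  shows "cell \<omega> k x = cell \<omega> k (a :: real^'n::finite)"
proof
  fix i
  let ?c = "\<lambda>t. \<lfloor>(t - gshift \<omega> k i) / 2 powr k\<rfloor>"
  have "?c (a $ i) \<le> ?c (x $ i)" "?c (x $ i) \<le> ?c (a $ i + h)"
    using assms(2)[of i] by (auto intro!: floor_mono divide_right_mono)
  moreover have "?c (a $ i) = ?c (a $ i + h)" using assms(1)[of i] by (simp add: cut_def)
  ultimately show "cell \<omega> k x i = cell \<omega> k a i" by (simp add: cell_def)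
qed

text \<open>The event that a jump of a Haar function of scale \<open>k\<close> may meet one of the
  two boxes. The box at \<open>a\<close> carries \<open>g\<close>, which is tested on cubes
  \<open>m\<close> levels down, and the box at \<open>b\<close> carries \<open>f\<close>, tested
  \<open>n\<close> levels down; the further \<open>- 1\<close> passes to the children. Only the grid
  enters, not the Haar functions.\<close>

definition crossing :: "'n::finite rgrid \<Rightarrow> nat \<Rightarrow> nat \<Rightarrow> real^'n \<Rightarrow> real^'n \<Rightarrow> real \<Rightarrow> int \<Rightarrow> bool" where
  "crossing \<omega> m n a b h k \<longleftrightarrow> (\<exists>i. cut \<omega> (k - int m - 1) i (a $ i) (a $ i + h) \<or>
                                cut \<omega> (k - int n - 1) i (b $ i) (b $ i + h))"

lemma measurable_crossing [measurable]:
  "Measurable.pred (Omega :: 'n::finite rgrid measure) (\<lambda>\<omega>. crossing \<omega> m n a b h k)"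
  unfolding crossing_def by measurable

text \<open>Without a crossing both forms equal the same \<open>\<kappa>\<close> times the product
  of their integrals, so the cross-multiplied difference vanishes. With a crossing each of the two
  terms is bounded by size alone, hence the factor 2.\<close>

lemma scale_form_diff:
  fixes f g f' g' :: "'n::finite rfun"
  assumes sd: "shift_data \<omega> m n hA hB"
    and bc: "bdd_cpt_fun f" "bdd_cpt_fun f'" "bdd_cpt_fun g" "bdd_cpt_fun g'"
    and box: "in_box h b f" "in_box h b f'" "in_box h a g" "in_box h a g'"
  defines "M \<equiv> \<lambda>u. \<integral>x. u x \<partial>lborel"
  shows "\<bar>scale_form \<omega> k m n hA hB f g * (M f' * M g') - scale_form \<omega> k m n hA hB f' g' * (M f * M g)\<bar>
     \<le> (if crossing \<omega> m n a b h k then 2 / (2 powr k) ^ CARD('n) else 0)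
        * (l1norm f * l1norm g * (l1norm f' * l1norm g'))"
proof (cases "crossing \<omega> m n a b h k")
  case False
  obtain \<kappa> where \<kappa>: "\<And>f g. (\<And>y. f y \<noteq> 0 \<Longrightarrow> cell \<omega> (k - int n - 1) y = cell \<omega> (k - int n - 1) b) \<Longrightarrow>
      (\<And>x. g x \<noteq> 0 \<Longrightarrow> cell \<omega> (k - int m - 1) x = cell \<omega> (k - int m - 1) a) \<Longrightarrow>
      scale_form \<omega> k m n hA hB f g = \<kappa> * (M f * M g)"
    unfolding M_def by (rule scale_form_same_cell[OF sd, of k b a]) blast
  have B: "cell \<omega> (k - int n - 1) y = cell \<omega> (k - int n - 1) b" if "u y \<noteq> 0" "in_box h b u" for u y
    using False that by (intro same_cell_of_not_cut) (auto simp: crossing_def in_box_def)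
  have A: "cell \<omega> (k - int m - 1) y = cell \<omega> (k - int m - 1) a" if "u y \<noteq> 0" "in_box h a u" for u y
    using False that by (intro same_cell_of_not_cut) (auto simp: crossing_def in_box_def)
  have "scale_form \<omega> k m n hA hB f g = \<kappa> * (M f * M g)"
      "scale_form \<omega> k m n hA hB f' g' = \<kappa> * (M f' * M g')"
    using box by (auto intro!: \<kappa> A B)
  then show ?thesis using False by simp
next
  case True
  have M: "\<bar>M u\<bar> \<le> l1norm u" for u
    using integral_abs_bound[of lborel u] by (simp add: M_def l1norm_def)
  have P: "\<bar>scale_form \<omega> k m n hA hB u v * (M u' * M v')\<bar>
      \<le> 1 / (2 powr k) ^ CARD('n) * (l1norm u * l1norm v * (l1norm u' * l1norm v'))"
    if "bdd_cpt_fun u" "bdd_cpt_fun v" for u v u' v' :: "'n rfun"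
  proof -
    have "\<bar>scale_form \<omega> k m n hA hB u v\<bar> * (\<bar>M u'\<bar> * \<bar>M v'\<bar>)
       \<le> (l1norm u * l1norm v / (2 powr k) ^ CARD('n)) * (l1norm u' * l1norm v')"
      using scale_form_bound[OF sd that[THEN bdd_cpt_fun_L2] that[THEN bdd_cpt_fun_integrable], of k] M
      by (intro mult_mono) (auto simp: l1norm_def)
    then show ?thesis by (simp add: abs_mult)
  qed
  let ?X = "scale_form \<omega> k m n hA hB f g * (M f' * M g')" and ?Y = "scale_form \<omega> k m n hA hB f' g' * (M f * M g)"
  have "\<bar>?X - ?Y\<bar> \<le> \<bar>?X\<bar> + \<bar>?Y\<bar>" by (rule abs_triangle_ineq4)
  also have "\<dots> \<le> 2 * (1 / (2 powr k) ^ CARD('n) * (l1norm f * l1norm g * (l1norm f' * l1norm g')))"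
    unfolding mult_2
  proof (rule add_mono[OF P[OF bc(1,3)]])
    show "\<bar>?Y\<bar> \<le> 1 / (2 powr k) ^ CARD('n) * (l1norm f * l1norm g * (l1norm f' * l1norm g'))"
      using P[OF bc(2,4), of f g] by (simp only: mult_ac)
  qed
  finally show ?thesis using True by simp
qed

section \<open>Summation over the scales\<close>

lemma symmetric_limit_bound:
  fixes s c :: "int \<Rightarrow> real"
  assumes lim: "(\<lambda>N::nat. \<Sum>k\<in>{- int N..int N}. s k) \<longlonglongrightarrow> l"
    and s: "\<And>k. k \<ge> k0 \<Longrightarrow> \<bar>s k\<bar> \<le> c k" "\<And>k. k < k0 \<Longrightarrow> s k = 0"
    and c: "summable (\<lambda>j. c (k0 + int j))"
  shows "\<bar>l\<bar> \<le> (\<Sum>j. c (k0 + int j))"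
proof -
  have c0: "0 \<le> c (k0 + int j)" for j using s(1)[of "k0 + int j"] by linarith
  have "\<bar>\<Sum>k\<in>{- int N..int N}. s k\<bar> \<le> (\<Sum>j. c (k0 + int j))" for N :: nat
  proof -
    have "\<bar>\<Sum>k\<in>{- int N..int N}. s k\<bar> = \<bar>\<Sum>k\<in>{- int N..int N} \<inter> {k0..}. s k\<bar>"
      using s(2) by (intro arg_cong[where f = abs] sum.mono_neutral_right) auto
    also have "\<dots> \<le> (\<Sum>k\<in>{- int N..int N} \<inter> {k0..}. c k)"
      using s(1) by (intro order_trans[OF sum_abs] sum_mono) auto
    \<comment> \<open>Substituting k = k0 + j turns the remaining finitely many scales into a
      partial sum of the one-sided series.\<close>
    also have "\<dots> = (\<Sum>j\<in>(\<lambda>k. nat (k - k0)) ` ({- int N..int N} \<inter> {k0..}). c (k0 + int j))"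
      by (subst sum.reindex) (auto simp: inj_on_def)
    also have "\<dots> \<le> (\<Sum>j. c (k0 + int j))"
      by (intro sum_le_suminf c) (auto intro: c0)
    finally show ?thesis .
  qed
  then show ?thesis
    using LIMSEQ_le_const2[OF tendsto_rabs[OF lim]] by blast
qed

text \<open>For \<open>s \<ge> 1\<close> the ratio 2^(-s) is at most 1/2, so the series is at most
  twice its first term. It is used with s = d and s = d + \<eta>, where d is the dimension.\<close>

lemma geometric_scales:
  fixes s :: real
  assumes "1 \<le> s"
  shows "summable (\<lambda>j. 2 powr (- (real_of_int (k0 + int j) * s)))"
    and "(\<Sum>j. 2 powr (- (real_of_int (k0 + int j) * s))) \<le> 2 * 2 powr (- (k0 * s))"
proof -
  define q where "q = 2 powr (- s)"
  have "q \<le> 2 powr (- 1)" unfolding q_def using assms by (intro powr_mono) auto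
  then have q: "0 < q" "q \<le> 1/2" by (auto simp: q_def powr_minus)
  have eq: "2 powr (- (real_of_int (k0 + int j) * s)) = 2 powr (- (k0 * s)) * q ^ j" for j
    by (simp add: q_def powr_realpow[symmetric] powr_powr powr_add[symmetric] algebra_simps)
  show "summable (\<lambda>j. 2 powr (- (real_of_int (k0 + int j) * s)))"
    unfolding eq using q by (intro summable_mult summable_geometric) auto
  have "(\<Sum>j. 2 powr (- (real_of_int (k0 + int j) * s))) = 2 powr (- (k0 * s)) * (1 / (1 - q))"
    unfolding eq using q by (subst suminf_mult) (auto simp: suminf_geometric intro!: summable_geometric)
  also have "\<dots> \<le> 2 powr (- (k0 * s)) * 2"
    using q by (intro mult_left_mono) (auto simp: field_simps)
  finally show "(\<Sum>j. 2 powr (- (real_of_int (k0 + int j) * s))) \<le> 2 * 2 powr (- (k0 * s))"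
    by (simp add: mult.commute)
qed

lemma powr_scale_dim: "(1::real) / (2 powr k) ^ d = 2 powr (- (k * real d))"
  by (simp add: powr_realpow[symmetric] powr_powr powr_minus divide_simps)

text \<open>The largest scale at which cubes are too small to meet both of two \<rho>-separated sets.\<close>

definition base_scale :: "nat \<Rightarrow> real \<Rightarrow> int" where
  "base_scale d \<rho> = \<lfloor>log 2 (\<rho> / real d)\<rfloor>"

lemma base_scale:
  assumes "0 < \<rho>" "0 < d"
  shows "real d * 2 powr (base_scale d \<rho>) \<le> \<rho>" "\<rho> < 2 * real d * 2 powr (base_scale d \<rho>)"
proof -
  have pos: "\<rho> / real d > 0" using assms by simp
  have "2 powr (base_scale d \<rho>) \<le> 2 powr (log 2 (\<rho> / real d))"
    unfolding base_scale_def by (intro powr_mono) auto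
  then show "real d * 2 powr (base_scale d \<rho>) \<le> \<rho>"
    using pos assms by (simp add: field_simps)
  have "2 powr (log 2 (\<rho> / real d)) < 2 powr (base_scale d \<rho> + 1)"
    unfolding base_scale_def by (intro powr_less_mono) linarith+
  then show "\<rho> < 2 * real d * 2 powr (base_scale d \<rho>)"
    using pos assms by (simp add: field_simps powr_add)
qed

text \<open>The factor 2d combines the diameter bound for a cube with the rounding of the logarithm
  to an integer.\<close>

lemma base_scale_powr:
  fixes s :: real
  assumes "0 < \<rho>" "0 < d" "0 \<le> s"
  shows "2 powr (- (base_scale d \<rho> * s)) \<le> (2 * real d) powr s / \<rho> powr s"
proof -
  have "1 / 2 powr (base_scale d \<rho>) \<le> 2 * real d / \<rho>"
    using base_scale[OF assms(1,2)] assms by (simp add: field_simps)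
  then have "(1 / 2 powr (base_scale d \<rho>)) powr s \<le> (2 * real d / \<rho>) powr s"
    using assms by (intro powr_mono2) auto
  then show ?thesis
    using assms by (simp add: powr_divide powr_powr powr_minus divide_simps)
qed

text \<open>Scales below \<open>base_scale\<close> contribute nothing and the others form a
  geometric series, so the first surviving scale, comparable to \<rho>, dominates. The bound depends
  neither on \<open>\<omega>\<close> nor on \<open>m\<close> and \<open>n\<close>.\<close>

lemma haar_shift_size:
  fixes f g :: "'n::finite rfun"
  assumes T: "haar_shift \<omega> m n T" and bc: "bdd_cpt_fun f" "bdd_cpt_fun g"
    and sep: "separated \<rho> f g" "\<rho> > 0"
  shows "\<bar>l2inner (T f) g\<bar> \<le> 2 * (2 * real CARD('n)) ^ CARD('n) / \<rho> ^ CARD('n) * (l1norm f * l1norm g)"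
proof -
  let ?d = "real CARD('n)" and ?N = "l1norm f * l1norm g"
  define k0 where "k0 = base_scale CARD('n) \<rho>"
  obtain hA hB where sd: "shift_data \<omega> m n hA hB" and
    lim: "\<And>f g. L2 f \<Longrightarrow> L2 g \<Longrightarrow>
      (\<lambda>N::nat. \<Sum>k\<in>{- int N..int N}. scale_form \<omega> k m n hA hB f g) \<longlonglongrightarrow> l2inner (T f) g"
    using T by (auto simp: haar_shift_iff)
  note L2 = bc[THEN bdd_cpt_fun_L2]
  have d1: "1 \<le> ?d" by (simp add: Suc_leI)
  have "\<bar>l2inner (T f) g\<bar> \<le> (\<Sum>j. 2 powr (- (real_of_int (k0 + int j) * ?d)) * ?N)"
  proof (rule symmetric_limit_bound[OF lim[OF L2]])
    fix k
    show "\<bar>scale_form \<omega> k m n hA hB f g\<bar> \<le> 2 powr (- (k * ?d)) * ?N"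
      using scale_form_bound[OF sd L2 bc[THEN bdd_cpt_fun_integrable], of k]
      by (simp add: l1norm_def powr_scale_dim[symmetric])
    show "scale_form \<omega> k m n hA hB f g = 0" if "k < k0"
    proof (rule scale_form_separated[OF sd L2])
      fix x y assume "g x \<noteq> 0" "f y \<noteq> 0"
      then have "\<rho> \<le> dist x y" using sep by (simp add: separated_def)
      moreover have "?d * 2 powr k \<le> ?d * 2 powr k0" using that by (intro mult_left_mono powr_mono) auto
      moreover have "?d * 2 powr k0 \<le> \<rho>" unfolding k0_def by (rule base_scale) (use sep in auto)
      ultimately show "?d * 2 powr k \<le> dist x y" by linarith
    qed
  qed (intro summable_mult2 geometric_scales d1)
  also have "\<dots> = (\<Sum>j. 2 powr (- (real_of_int (k0 + int j) * ?d))) * ?N"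
    by (intro suminf_mult2[symmetric] geometric_scales d1)
  also have "\<dots> \<le> (2 * 2 powr (- (k0 * ?d))) * ?N"
    by (intro mult_right_mono geometric_scales d1) simp
  also have "\<dots> \<le> (2 * ((2 * ?d) powr ?d / \<rho> powr ?d)) * ?N"
    unfolding k0_def using sep by (intro mult_right_mono mult_left_mono base_scale_powr) auto
  finally show ?thesis using sep by (simp add: powr_realpow)
qed

text \<open>A bound for each fixed grid, whose right-hand side depends on \<open>\<omega>\<close>
  only through crossing events. It serves as the integrable majorant when the average is
  taken.\<close>

lemma haar_shift_diff:
  fixes f g f' g' :: "'n::finite rfun"
  assumes T: "haar_shift \<omega> m n T"
    and bc: "bdd_cpt_fun f" "bdd_cpt_fun f'" "bdd_cpt_fun g" "bdd_cpt_fun g'"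
    and box: "in_box h b f" "in_box h b f'" "in_box h a g" "in_box h a g'"
    and sep: "separated \<rho> f g" "separated \<rho> f' g'" "\<rho> > 0"
  defines "M \<equiv> \<lambda>u. \<integral>x. u x \<partial>lborel"
    and "k0 \<equiv> base_scale CARD('n) \<rho>"
  shows "\<bar>l2inner (T f) g * (M f' * M g') - l2inner (T f') g' * (M f * M g)\<bar>
     \<le> (\<Sum>j. (if crossing \<omega> m n a b h (k0 + int j) then 2 * 2 powr (- (real_of_int (k0 + int j) * real CARD('n))) else 0))
        * (l1norm f * l1norm g * (l1norm f' * l1norm g'))"
proof -
  let ?d = "real CARD('n)" and ?N = "l1norm f * l1norm g * (l1norm f' * l1norm g')"
  let ?c = "\<lambda>k. if crossing \<omega> m n a b h k then 2 * 2 powr (- (real_of_int k * ?d)) else 0"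
  obtain hA hB where sd: "shift_data \<omega> m n hA hB" and
    lim: "\<And>f g. L2 f \<Longrightarrow> L2 g \<Longrightarrow>
      (\<lambda>N::nat. \<Sum>k\<in>{- int N..int N}. scale_form \<omega> k m n hA hB f g) \<longlonglongrightarrow> l2inner (T f) g"
    using T by (auto simp: haar_shift_iff)
  note L2 = bc[THEN bdd_cpt_fun_L2]
  let ?s = "\<lambda>k. scale_form \<omega> k m n hA hB"
  have d1: "1 \<le> ?d" by (simp add: Suc_leI)
  have sc: "summable (\<lambda>j. ?c (k0 + int j))"
    by (rule summable_comparison_test[OF _ summable_mult[OF geometric_scales(1)[OF d1], of 2 k0]]) auto
  have z: "?s k u v = 0" if "k < k0" "separated \<rho> u v" "L2 u" "L2 v" for k u v
  proof (rule scale_form_separated[OF sd that(3,4)])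
    fix x y assume "v x \<noteq> 0" "u y \<noteq> 0"
    then have "\<rho> \<le> dist x y" using that by (simp add: separated_def)
    moreover have "?d * 2 powr k \<le> ?d * 2 powr k0" using that by (intro mult_left_mono powr_mono) auto
    moreover have "?d * 2 powr k0 \<le> \<rho>" unfolding k0_def by (rule base_scale) (use sep in auto)
    ultimately show "?d * 2 powr k \<le> dist x y" by linarith
  qed
  have "(\<lambda>N::nat. \<Sum>k\<in>{- int N..int N}. ?s k f g * (M f' * M g') - ?s k f' g' * (M f * M g))
     \<longlonglongrightarrow> l2inner (T f) g * (M f' * M g') - l2inner (T f') g' * (M f * M g)"
    unfolding sum_subtractf sum_distrib_right[symmetric] by (intro tendsto_intros lim L2)
  then have "\<bar>l2inner (T f) g * (M f' * M g') - l2inner (T f') g' * (M f * M g)\<bar>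
      \<le> (\<Sum>j. ?c (k0 + int j) * ?N)"
  proof (rule symmetric_limit_bound)
    fix k
    show "\<bar>?s k f g * (M f' * M g') - ?s k f' g' * (M f * M g)\<bar> \<le> ?c k * ?N"
      using scale_form_diff[OF sd bc box, of k] unfolding M_def
      by (simp add: powr_scale_dim[symmetric] split: if_splits)
    show "?s k f g * (M f' * M g') - ?s k f' g' * (M f * M g) = 0" if "k < k0"
      using z[OF that sep(1) L2(1,3)] z[OF that sep(2) L2(2,4)] by simp
  qed (intro summable_mult2 sc)
  also have "\<dots> = (\<Sum>j. ?c (k0 + int j)) * ?N"
    by (intro suminf_mult2[symmetric] sc)
  finally show ?thesis .
qed

section \<open>Probability of a crossing and its expected contribution\<close>

lemma min_one_le_powr:
  fixes p t \<eta> :: real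
  assumes "p \<le> 1" "p \<le> t" "0 \<le> t" "0 < \<eta>" "\<eta> \<le> 1"
  shows "p \<le> t powr \<eta>"
proof (cases "t \<le> 1")
  case True
  have "t powr 1 \<le> t powr \<eta>" if "t > 0"
    using True assms that by (intro powr_mono') auto
  then show ?thesis using assms by (cases "t = 0") auto
next
  case False
  then have "1 \<le> t powr \<eta>" using assms by (intro ge_one_powr_ge_zero) auto
  then show ?thesis using assms by linarith
qed

text \<open>Interpolates between the trivial bound 1 and the linear bound of
  \<open>prob_cut\<close>. Lowering the exponent from 1 to \<open>\<eta>\<close> reduces the growth
  in \<open>m\<close> from 2^m to 2^(m\<eta>), small enough for the coefficients to absorb once
  \<eta> < \<delta>. In \<open>4 * h\<close> one factor 2 is that of \<open>prob_cut\<close>, the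
  other comes from the \<open>- 1\<close> in the scale.\<close>

lemma prob_cut_powr:
  assumes "h \<ge> 0" "0 < \<eta>" "\<eta> \<le> 1"
  shows "measure Omega {\<omega> :: 'n::finite rgrid. cut \<omega> (k - int m - 1) i t (t + h)}
    \<le> (4 * h) powr \<eta> * (2 powr (real m * \<eta>) * 2 powr (- (k * \<eta>)))"
proof -
  let ?l = "k - int m - 1"
  have "measure Omega {\<omega> :: 'n rgrid. cut \<omega> ?l i t (t + h)} \<le> 2 * h / 2 powr ?l"
    using prob_cut[of t "t + h" ?l i] assms by simp
  then have "measure Omega {\<omega> :: 'n rgrid. cut \<omega> ?l i t (t + h)} \<le> (2 * h / 2 powr ?l) powr \<eta>"
    using assms by (intro min_one_le_powr) auto
  also have "2 * h / 2 powr ?l = 4 * h * (2 powr real m * 2 powr (- k))"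
    by (simp add: powr_diff powr_minus powr_add field_simps)
  also have "\<dots> powr \<eta> = (4 * h) powr \<eta> * (2 powr (real m * \<eta>) * 2 powr (- (k * \<eta>)))"
    using assms by (simp add: powr_mult powr_powr)
  finally show ?thesis .
qed

lemma prob_crossing:
  assumes "h \<ge> 0" "0 < \<eta>" "\<eta> \<le> 1"
  shows "measure Omega {\<omega> :: 'n::finite rgrid. crossing \<omega> m n a b h k}
    \<le> 2 * real CARD('n) * (4 * h) powr \<eta> * 2 powr (real (m + n) * \<eta>) * 2 powr (- (k * \<eta>))"
proof -
  let ?A = "\<lambda>i. {\<omega> :: 'n rgrid. cut \<omega> (k - int m - 1) i (a $ i) (a $ i + h)}"
  let ?B = "\<lambda>i. {\<omega> :: 'n rgrid. cut \<omega> (k - int n - 1) i (b $ i) (b $ i + h)}"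
  let ?K = "(4 * h) powr \<eta> * (2 powr (real (m + n) * \<eta>) * 2 powr (- (k * \<eta>)))"
  have meas: "?A i \<in> sets Omega" "?B i \<in> sets Omega" for i
    using measurable_cut unfolding pred_def by auto
  have mono: "(2::real) powr (real m * \<eta>) \<le> 2 powr (real (m + n) * \<eta>)"
     "(2::real) powr (real n * \<eta>) \<le> 2 powr (real (m + n) * \<eta>)"
    using assms by (auto intro!: powr_mono mult_right_mono)
  have "{\<omega>. crossing \<omega> m n a b h k} = (\<Union>i. ?A i \<union> ?B i)"
    by (auto simp: crossing_def)
  also have "measure Omega \<dots> \<le> (\<Sum>i\<in>UNIV. measure Omega (?A i \<union> ?B i))"
    using meas by (intro Omega.finite_measure_subadditive_finite) auto
  also have "\<dots> \<le> (\<Sum>i\<in>(UNIV::'n set). ?K + ?K)"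
  proof (rule sum_mono)
    fix i
    have "measure Omega (?A i) \<le> ?K"
      using assms mono by (intro order_trans[OF prob_cut_powr[OF assms]] mult_left_mono mult_right_mono) auto
    moreover have "measure Omega (?B i) \<le> ?K"
      using assms mono by (intro order_trans[OF prob_cut_powr[OF assms]] mult_left_mono mult_right_mono) auto
    moreover have "measure Omega (?A i \<union> ?B i) \<le> measure Omega (?A i) + measure Omega (?B i)"
      by (intro measure_Un_le meas)
    ultimately show "measure Omega (?A i \<union> ?B i) \<le> ?K + ?K" by linarith
  qed
  finally show ?thesis by (simp add: algebra_simps)
qed

text \<open>The crossing probability at scale \<open>k\<close> contributes an extra 2^(-k\<eta>) to
  the size 2^(-kd), so the first scale, comparable to \<rho>, again dominates and yields h^\<eta> /
  \<rho>^(d+\<eta>). The 8 collects a 2 from \<open>scale_form_diff\<close>, a 2 from the two boxes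
  and a 2 from the geometric series.\<close>

lemma expected_crossing:
  fixes a b :: "real^'n::finite" and m n :: nat
  assumes "h \<ge> 0" "0 < \<eta>" "\<eta> \<le> 1" "\<rho> > 0"
  defines "k0 \<equiv> base_scale CARD('n) \<rho>"
  defines "\<Phi> \<equiv> \<lambda>\<omega> :: 'n rgrid. \<Sum>j. (if crossing \<omega> m n a b h (k0 + int j) then 2 * 2 powr (- (real_of_int (k0 + int j) * real CARD('n))) else 0)"
  shows "integrable Omega \<Phi>"
    and "(\<integral>\<omega>. \<Phi> \<omega> \<partial>Omega) \<le> 8 * real CARD('n) * 4 powr \<eta> * (2 * real CARD('n)) powr (real CARD('n) + \<eta>)
         * h powr \<eta> / \<rho> powr (real CARD('n) + \<eta>) * 2 powr (real (m + n) * \<eta>)"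
proof -
  let ?d = "real CARD('n)"
  let ?c = "\<lambda>j. 2 * 2 powr (- (real_of_int (k0 + int j) * ?d))"
  let ?F = "\<lambda>j \<omega>. if crossing \<omega> m n a b h (k0 + int j) then ?c j else 0"
  let ?K = "2 * ?d * (4 * h) powr \<eta> * 2 powr (real (m + n) * \<eta>)"
  have d1: "1 \<le> ?d" by (simp add: Suc_leI)
  have s1: "1 \<le> ?d + \<eta>" using d1 assms by linarith
  have sc: "summable ?c" by (intro summable_mult geometric_scales d1)
  have c0: "0 \<le> ?c j" for j by simp
  have set: "{\<omega> :: 'n rgrid. crossing \<omega> m n a b h k} \<in> sets Omega" for k
    using measurable_crossing unfolding pred_def by auto
  have F: "?F j = (\<lambda>\<omega>. ?c j * indicator {\<omega>. crossing \<omega> m n a b h (k0 + int j)} \<omega>)" for j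
    by (auto split: split_indicator)
  have int: "integrable Omega (?F j)" for j
    unfolding F using set by (intro integrable_mult_right integrable_real_indicator) (auto simp: Omega.emeasure_eq_measure)
  have E: "(\<integral>\<omega>. ?F j \<omega> \<partial>Omega) = ?c j * measure Omega {\<omega> :: 'n rgrid. crossing \<omega> m n a b h (k0 + int j)}" for j
    unfolding F using set by simp
  have sn: "AE \<omega> in Omega. summable (\<lambda>j. norm (?F j \<omega>))"
    by (intro AE_I2 summable_comparison_test[OF _ sc]) auto
  have sE: "summable (\<lambda>j. \<integral>\<omega>. norm (?F j \<omega>) \<partial>Omega)"
  proof (rule summable_comparison_test[OF _ sc])
    have "(\<integral>\<omega>. norm (?F j \<omega>) \<partial>Omega) = (\<integral>\<omega>. ?F j \<omega> \<partial>Omega)" for j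
      by (intro Bochner_Integration.integral_cong) auto
    then have "norm (\<integral>\<omega>. norm (?F j \<omega>) \<partial>Omega) \<le> ?c j" for j
      unfolding E using mult_left_mono[OF Omega.prob_le_1 c0[of j], of "{\<omega>. crossing \<omega> m n a b h (k0 + int j)}"]
      by (simp add: E)
    then show "\<exists>N. \<forall>j\<ge>N. norm (\<integral>\<omega>. norm (?F j \<omega>) \<partial>Omega) \<le> ?c j" by blast
  qed
  show "integrable Omega \<Phi>"
    unfolding \<Phi>_def by (rule integrable_suminf[OF int sn sE])
  have "(\<integral>\<omega>. \<Phi> \<omega> \<partial>Omega) = (\<Sum>j. \<integral>\<omega>. ?F j \<omega> \<partial>Omega)"
    unfolding \<Phi>_def by (rule integral_suminf[OF int sn sE])
  also have "\<dots> \<le> (\<Sum>j. 2 * ?K * 2 powr (- (real_of_int (k0 + int j) * (?d + \<eta>))))"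
  proof (rule suminf_le)
    fix j
    have "(\<integral>\<omega>. ?F j \<omega> \<partial>Omega) \<le> ?c j * (?K * 2 powr (- ((k0 + int j) * \<eta>)))"
      unfolding E by (intro mult_left_mono prob_crossing assms c0)
    also have "\<dots> = 2 * ?K * (2 powr (- (real_of_int (k0 + int j) * ?d)) * 2 powr (- (real_of_int (k0 + int j) * \<eta>)))"
      by simp
    also have "2 powr (- (real_of_int (k0 + int j) * ?d)) * 2 powr (- (real_of_int (k0 + int j) * \<eta>))
        = 2 powr (- (real_of_int (k0 + int j) * (?d + \<eta>)))"
      unfolding powr_add[symmetric] by (simp add: distrib_left)
    finally show "(\<integral>\<omega>. ?F j \<omega> \<partial>Omega) \<le> 2 * ?K * 2 powr (- (real_of_int (k0 + int j) * (?d + \<eta>)))" .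
  next
    show "summable (\<lambda>j. \<integral>\<omega>. ?F j \<omega> \<partial>Omega)"
      by (rule summable_integral[OF int sn sE])
  qed (intro summable_mult geometric_scales s1)
  also have "\<dots> = 2 * ?K * (\<Sum>j. 2 powr (- (real_of_int (k0 + int j) * (?d + \<eta>))))"
    by (intro suminf_mult geometric_scales s1)
  also have "\<dots> \<le> 2 * ?K * (2 * 2 powr (- (k0 * (?d + \<eta>))))"
    by (intro mult_left_mono geometric_scales s1) auto
  also have "\<dots> \<le> 2 * ?K * (2 * ((2 * ?d) powr (?d + \<eta>) / \<rho> powr (?d + \<eta>)))"
    unfolding k0_def using assms by (intro mult_left_mono base_scale_powr) auto
  also have "\<dots> = 8 * ?d * 4 powr \<eta> * (2 * ?d) powr (?d + \<eta>)
         * h powr \<eta> / \<rho> powr (?d + \<eta>) * 2 powr (real (m + n) * \<eta>)"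
    using assms by (simp add: powr_mult)
  finally show "(\<integral>\<omega>. \<Phi> \<omega> \<partial>Omega) \<le> \<dots>" .
qed

section \<open>The averaged operator\<close>

lemma summable_on_powr_pairs:
  assumes "0 < s"
  shows "(\<lambda>(m, n). 2 powr (- (real (m + n) * s))) summable_on (UNIV :: (nat \<times> nat) set)"
proof -
  define q :: real where "q = 2 powr (- s)"
  have "q < 2 powr 0" unfolding q_def using assms by (intro powr_less_mono) auto
  then have q: "0 < q" "q < 1" by (auto simp: q_def)
  have "((\<lambda>n. q ^ n) has_sum (1 / (1 - q))) UNIV"
    using q by (intro norm_summable_imp_has_sum) (auto intro!: summable_geometric geometric_sums)
  note g = this
  \<comment> \<open>The weight factorises, so the double sum is a product of two geometric
    series.\<close>
  have "(\<lambda>p :: nat \<times> nat. q ^ fst p * q ^ snd p) summable_on (UNIV \<times> UNIV)"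
  proof (rule summable_on_SigmaI)
    show "((\<lambda>n. q ^ fst (m, n) * q ^ snd (m, n)) has_sum (q ^ m * (1 / (1 - q)))) UNIV" for m :: nat
      using has_sum_cmult_right[OF g, of "q ^ m"] by simp
    show "(\<lambda>m. q ^ m * (1 / (1 - q))) summable_on (UNIV :: nat set)"
      using has_sum_cmult_left[OF g] by (rule has_sum_imp_summable)
  qed (use q in auto)
  moreover have "q ^ fst p * q ^ snd p = (case p of (m, n) \<Rightarrow> 2 powr (- (real (m + n) * s)))" for p :: "nat \<times> nat"
    by (cases p) (simp add: q_def powr_realpow[symmetric] powr_powr powr_add[symmetric] algebra_simps)
  ultimately show ?thesis by simp
qed

text \<open>Enumerating the pairs by \<open>prod_decode\<close> gives an ordinary series dominated
  by the constants \<open>w\<close>, which may be integrated term by term. Absolute summability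
  makes the result independent of the enumeration.\<close>

lemma (in prob_space) has_sum_integral_pairs:
  fixes \<Lambda> :: "nat \<times> nat \<Rightarrow> 'a \<Rightarrow> real"
  assumes meas: "\<And>p. \<Lambda> p \<in> borel_measurable M" and bound: "\<And>p \<omega>. \<bar>\<Lambda> p \<omega>\<bar> \<le> w p"
    and w: "w summable_on UNIV"
  shows "((\<lambda>p. \<integral>\<omega>. \<Lambda> p \<omega> \<partial>M) has_sum (\<integral>\<omega>. (\<Sum>\<^sub>\<infinity>p. \<Lambda> p \<omega>) \<partial>M)) UNIV"
proof -
  let ?e = prod_decode
  have e: "bij_betw ?e UNIV UNIV" by (rule bij_prod_decode)
  have w0: "0 \<le> w p" for p using bound[of p undefined] by linarith
  have "(\<lambda>q. w (?e q)) summable_on UNIV"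
    using w by (subst summable_on_reindex_bij_betw[OF e])
  then have sw: "summable (\<lambda>q. w (?e q))"
    by (subst (asm) summable_on_UNIV_nonneg_real_iff) (auto intro: w0)
  have sn: "summable (\<lambda>q. norm (\<Lambda> (?e q) \<omega>))" for \<omega>
    using bound by (intro summable_comparison_test[OF _ sw]) auto
  have int: "integrable M (\<Lambda> p)" for p
    using bound by (intro integrable_const_bound[where B = "w p"] meas) auto
  have "(\<integral>\<omega>. norm (\<Lambda> p \<omega>) \<partial>M) \<le> (\<integral>\<omega>. w p \<partial>M)" for p
    using bound int by (intro integral_mono) auto
  then have "(\<integral>\<omega>. norm (\<Lambda> p \<omega>) \<partial>M) \<le> w p" for p by (simp add: prob_space)
  then have sE: "summable (\<lambda>q. \<integral>\<omega>. norm (\<Lambda> (?e q) \<omega>) \<partial>M)"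
    by (intro summable_comparison_test[OF _ sw]) auto
  have "(\<Sum>\<^sub>\<infinity>p. \<Lambda> p \<omega>) = (\<Sum>q. \<Lambda> (?e q) \<omega>)" for \<omega>
  proof -
    have "((\<lambda>q. \<Lambda> (?e q) \<omega>) has_sum (\<Sum>q. \<Lambda> (?e q) \<omega>)) UNIV"
      by (rule norm_summable_imp_has_sum[OF sn summable_sums[OF summable_norm_cancel[OF sn]]])
    then have "((\<lambda>p. \<Lambda> p \<omega>) has_sum (\<Sum>q. \<Lambda> (?e q) \<omega>)) UNIV"
      by (subst (asm) has_sum_reindex_bij_betw[OF e])
    then show ?thesis by (rule infsumI)
  qed
  then have eq: "(\<integral>\<omega>. (\<Sum>\<^sub>\<infinity>p. \<Lambda> p \<omega>) \<partial>M) = (\<integral>\<omega>. (\<Sum>q. \<Lambda> (?e q) \<omega>) \<partial>M)" by simp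
  have "(\<lambda>q. \<integral>\<omega>. \<Lambda> (?e q) \<omega> \<partial>M) sums (\<integral>\<omega>. (\<Sum>q. \<Lambda> (?e q) \<omega>) \<partial>M)"
    using sn by (intro sums_integral int sE) auto
  moreover have "summable (\<lambda>q. norm (\<integral>\<omega>. \<Lambda> (?e q) \<omega> \<partial>M))"
  proof (rule summable_comparison_test[OF _ sE], intro exI allI impI)
    fix q
    show "norm (norm (\<integral>\<omega>. \<Lambda> (?e q) \<omega> \<partial>M)) \<le> (\<integral>\<omega>. norm (\<Lambda> (?e q) \<omega>) \<partial>M)"
      using integral_norm_bound[of M "\<Lambda> (?e q)"] by simp
  qed
  ultimately have "((\<lambda>q. \<integral>\<omega>. \<Lambda> (?e q) \<omega> \<partial>M) has_sum (\<integral>\<omega>. (\<Sum>q. \<Lambda> (?e q) \<omega>) \<partial>M)) UNIV"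
    by (intro norm_summable_imp_has_sum)
  then show ?thesis
    unfolding eq by (subst (asm) has_sum_reindex_bij_betw[OF e])
qed

text \<open>The second condition says that on \<rho>-separated sets contained in cubes of side \<open>h\<close> the form is,
  up to a small error, a multiple of the product of the integrals; the multiple is never named,
  so that no kernel is needed at this stage.\<close>

definition regular_form :: "real \<Rightarrow> real \<Rightarrow> ('n::finite rfun \<Rightarrow> 'n rfun \<Rightarrow> real) \<Rightarrow> bool" where
  "regular_form C \<eta> B \<longleftrightarrow>
    (\<forall>\<rho> f g. 0 < \<rho> \<longrightarrow> bdd_cpt_fun f \<longrightarrow> bdd_cpt_fun g \<longrightarrow> separated \<rho> f g \<longrightarrow>
       \<bar>B f g\<bar> \<le> C / \<rho> ^ CARD('n) * (l1norm f * l1norm g)) \<and>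
    (\<forall>\<rho> h a b f f' g g'. 0 < \<rho> \<longrightarrow> 0 \<le> h \<longrightarrow>
       bdd_cpt_fun f \<longrightarrow> bdd_cpt_fun f' \<longrightarrow> bdd_cpt_fun g \<longrightarrow> bdd_cpt_fun g' \<longrightarrow>
       in_box h b f \<longrightarrow> in_box h b f' \<longrightarrow> in_box h a g \<longrightarrow> in_box h a g' \<longrightarrow>
       separated \<rho> f g \<longrightarrow> separated \<rho> f' g' \<longrightarrow>
       \<bar>B f g * ((\<integral>x. f' x \<partial>lborel) * (\<integral>x. g' x \<partial>lborel)) -
        B f' g' * ((\<integral>x. f x \<partial>lborel) * (\<integral>x. g x \<partial>lborel))\<bar>
       \<le> C * h powr \<eta> / \<rho> powr (real CARD('n) + \<eta>) * (l1norm f * l1norm g * (l1norm f' * l1norm g')))"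

section \<open>Averages over the grids at fixed complexity, then summed over all
  complexities\<close>

locale haar_average =
  fixes \<delta> :: real
    and lam :: "nat \<Rightarrow> nat \<Rightarrow> 'n::finite rgrid \<Rightarrow> real"
    and Sh :: "nat \<Rightarrow> nat \<Rightarrow> 'n rgrid \<Rightarrow> ('n rfun \<Rightarrow> 'n rfun)"
    and S :: "'n rfun \<Rightarrow> 'n rfun"
  assumes \<delta>: "0 < \<delta>" "\<delta> < 1"
    and lam: "\<And>m n \<omega>. \<bar>lam m n \<omega>\<bar> \<le> 2 powr (- (real (m + n) * \<delta>))"
    and shift: "\<And>m n \<omega>. haar_shift \<omega> m n (Sh m n \<omega>)"
    and contr: "\<And>m n \<omega> f. L2 f \<Longrightarrow> L2 (Sh m n \<omega> f) \<and> l2norm (Sh m n \<omega> f) \<le> l2norm f"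
    and meas: "\<And>m n f g. L2 f \<Longrightarrow> L2 g \<Longrightarrow>
           (\<lambda>\<omega>. lam m n \<omega> * l2inner (Sh m n \<omega> f) g) \<in> borel_measurable Omega"
    and S_L2: "\<And>f. L2 f \<Longrightarrow> L2 (S f)"
    and S_avg: "\<And>f g. L2 f \<Longrightarrow> L2 g \<Longrightarrow>
           l2inner (S f) g = (\<integral>\<omega>. (\<Sum>\<^sub>\<infinity>(m,n)\<in>UNIV. lam m n \<omega> * l2inner (Sh m n \<omega> f) g) \<partial>Omega)"
begin

definition avg :: "'n rfun \<Rightarrow> 'n rfun \<Rightarrow> nat \<times> nat \<Rightarrow> real" where
  "avg f g = (\<lambda>(m, n). \<integral>\<omega>. lam m n \<omega> * l2inner (Sh m n \<omega> f) g \<partial>Omega)"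

lemma lam_inner_bound:
  assumes "L2 f" "L2 g"
  shows "\<bar>lam m n \<omega> * l2inner (Sh m n \<omega> f) g\<bar> \<le> 2 powr (- (real (m + n) * \<delta>)) * (l2norm f * l2norm g)"
proof -
  have "\<bar>l2inner (Sh m n \<omega> f) g\<bar> \<le> l2norm (Sh m n \<omega> f) * l2norm g"
    using assms contr by (intro l2inner_bound) auto
  also have "\<dots> \<le> l2norm f * l2norm g"
    using contr[OF assms(1)] by (intro mult_right_mono) auto
  finally show ?thesis
    unfolding abs_mult using lam by (intro mult_mono) auto
qed

lemma integrable_lam_inner:
  assumes "L2 f" "L2 g"
  shows "integrable Omega (\<lambda>\<omega>. lam m n \<omega> * l2inner (Sh m n \<omega> f) g)"
  using lam_inner_bound[OF assms] meas[OF assms]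
  by (intro Omega.integrable_const_bound) auto

lemma avg_bound:
  assumes "L2 f" "L2 g"
  shows "\<bar>avg f g (m, n)\<bar> \<le> 2 powr (- (real (m + n) * \<delta>)) * (l2norm f * l2norm g)"
proof -
  have "\<bar>avg f g (m, n)\<bar> \<le> (\<integral>\<omega>. 2 powr (- (real (m + n) * \<delta>)) * (l2norm f * l2norm g) \<partial>(Omega :: 'n rgrid measure))"
    unfolding avg_def prod.case using lam_inner_bound[OF assms] by (intro abs_integral_le) auto
  then show ?thesis by (simp add: Omega.prob_space[simplified])
qed

text \<open>Expectation and sum over \<open>(m, n)\<close> are interchanged, so that every later
  estimate can be made for one complexity type at a time and then summed.\<close>

lemma has_sum_avg:
  assumes "L2 f" "L2 g"
  shows "(avg f g has_sum l2inner (S f) g) UNIV"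
proof -
  have "((\<lambda>p. \<integral>\<omega>. (case p of (m, n) \<Rightarrow> lam m n \<omega> * l2inner (Sh m n \<omega> f) g) \<partial>Omega) has_sum
      (\<integral>\<omega>. (\<Sum>\<^sub>\<infinity>p. case p of (m, n) \<Rightarrow> lam m n \<omega> * l2inner (Sh m n \<omega> f) g) \<partial>Omega)) UNIV"
  proof (rule Omega.has_sum_integral_pairs)
    show "(\<lambda>\<omega>. case p of (m, n) \<Rightarrow> lam m n \<omega> * l2inner (Sh m n \<omega> f) g) \<in> borel_measurable Omega" for p
      using meas[OF assms] by (cases p) simp
    show "\<bar>case p of (m, n) \<Rightarrow> lam m n \<omega> * l2inner (Sh m n \<omega> f) g\<bar>
       \<le> (case p of (m, n) \<Rightarrow> 2 powr (- (real (m + n) * \<delta>))) * (l2norm f * l2norm g)" for p \<omega>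
      using lam_inner_bound[OF assms] by (cases p) simp
    show "(\<lambda>p. (case p of (m, n) \<Rightarrow> 2 powr (- (real (m + n) * \<delta>))) * (l2norm f * l2norm g)) summable_on UNIV"
      using summable_on_powr_pairs[OF \<delta>(1)] by (rule summable_on_cmult_left)
  qed
  moreover have "avg f g = (\<lambda>p. \<integral>\<omega>. (case p of (m, n) \<Rightarrow> lam m n \<omega> * l2inner (Sh m n \<omega> f) g) \<partial>Omega)"
    by (auto simp: avg_def fun_eq_iff)
  ultimately show ?thesis
    unfolding S_avg[OF assms] by simp
qed

lemma avg_linear:
  assumes "L2 f" "L2 f'" "L2 g"
  shows "avg (\<lambda>x. a * f x + b * f' x) g p = a * avg f g p + b * avg f' g p"
proof (cases p)
  case (Pair m n)
  have "lam m n \<omega> * l2inner (Sh m n \<omega> (\<lambda>x. a * f x + b * f' x)) g =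
     a * (lam m n \<omega> * l2inner (Sh m n \<omega> f) g) + b * (lam m n \<omega> * l2inner (Sh m n \<omega> f') g)" for \<omega>
    unfolding haar_shift_linear[OF shift assms] by (simp add: algebra_simps)
  then show ?thesis
    using integrable_lam_inner[OF assms(1,3)] integrable_lam_inner[OF assms(2,3)]
    by (simp add: avg_def Pair)
qed

lemma inner_S_linear:
  assumes "L2 f" "L2 f'" "L2 g"
  shows "l2inner (S (\<lambda>x. a * f x + b * f' x)) g = a * l2inner (S f) g + b * l2inner (S f') g"
proof -
  have "((\<lambda>p. a * avg f g p + b * avg f' g p) has_sum (a * l2inner (S f) g + b * l2inner (S f') g)) UNIV"
    using assms by (intro has_sum_add has_sum_cmult_right has_sum_avg)
  moreover have "((\<lambda>p. a * avg f g p + b * avg f' g p) has_sum l2inner (S (\<lambda>x. a * f x + b * f' x)) g) UNIV"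
    using has_sum_avg[OF L2_lincomb[OF assms(1,2)] assms(3), of a b] unfolding avg_linear[OF assms] .
  ultimately show ?thesis by (rule has_sum_unique[symmetric])
qed

definition W :: real where
  "W = (\<Sum>\<^sub>\<infinity>(m, n)\<in>UNIV. 2 powr (- (real (m + n) * \<delta>)))"

lemma has_sum_W: "((\<lambda>(m, n). 2 powr (- (real (m + n) * \<delta>))) has_sum W) UNIV"
  unfolding W_def by (rule has_sum_infsum[OF summable_on_powr_pairs[OF \<delta>(1)]])

lemma S_form_bound:
  assumes "L2 f" "L2 g"
  shows "\<bar>l2inner (S f) g\<bar> \<le> W * (l2norm f * l2norm g)"
proof -
  have "norm (l2inner (S f) g) \<le> W * (l2norm f * l2norm g)"
    using avg_bound[OF assms]
    by (intro norm_infsum_le[OF has_sum_avg[OF assms] has_sum_cmult_left[OF has_sum_W]]) auto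
  then show ?thesis by simp
qed

lemma W_nonneg: "0 \<le> W"
  using has_sum_nonneg[OF has_sum_W] by auto

text \<open>The form bound is tested against \<open>S f\<close> itself and one factor
  \<open>l2norm (S f)\<close> is cancelled.\<close>

lemma l2norm_S:
  assumes "L2 f"
  shows "l2norm (S f) \<le> W * l2norm f"
proof (cases "l2norm (S f) = 0")
  case True
  then show ?thesis using W_nonneg by simp
next
  case False
  have "l2inner (S f) (S f) = (l2norm (S f))\<^sup>2"
    unfolding l2norm_sq by (simp add: l2inner_def power2_eq_square)
  then have "l2norm (S f) * l2norm (S f) \<le> (W * l2norm f) * l2norm (S f)"
    using S_form_bound[OF assms S_L2[OF assms]] by (simp add: power2_eq_square mult.assoc)
  then show ?thesis
    using False l2norm_nonneg[of "S f"] by (simp add: mult_le_cancel_right)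
qed

text \<open>The form is linear against every L^2 test function. Testing with the defect
  \<open>?D\<close> itself shows that its L^2 norm is 0, hence equality almost everywhere.
  \<open>?D\<close> is written with coefficients 1 and -1 to be literally a linear
  combination.\<close>

lemma S_linear:
  assumes "L2 f" "L2 g"
  shows "AE x in lborel. S (\<lambda>y. a * f y + b * g y) x = a * S f x + b * S g x"
proof -
  let ?u = "S (\<lambda>y. a * f y + b * g y)" and ?v = "\<lambda>x. a * S f x + b * S g x"
  let ?D = "\<lambda>x. 1 * ?u x + (- 1) * ?v x"
  have u: "L2 ?u" by (intro S_L2 L2_lincomb assms)
  have v: "L2 ?v" by (intro S_L2 L2_lincomb assms)
  have D: "L2 ?D" by (rule L2_lincomb[OF u v])
  have "l2inner ?v ?D = a * l2inner (S f) ?D + b * l2inner (S g) ?D"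
    using L2_mult_integrable[OF S_L2[OF assms(1)] D] L2_mult_integrable[OF S_L2[OF assms(2)] D]
    unfolding l2inner_def distrib_right mult.assoc by simp
  also have "\<dots> = l2inner ?u ?D"
    using inner_S_linear[OF assms D, of a b] by simp
  finally have eq: "l2inner ?v ?D = l2inner ?u ?D" .
  have "(\<integral>x. (?D x)\<^sup>2 \<partial>lborel) = (\<integral>x. ?u x * ?D x - ?v x * ?D x \<partial>lborel)"
    by (intro Bochner_Integration.integral_cong) (auto simp: power2_eq_square algebra_simps)
  moreover have "(\<integral>x. ?u x * ?D x - ?v x * ?D x \<partial>lborel) = l2inner ?u ?D - l2inner ?v ?D"
    unfolding l2inner_def by (rule Bochner_Integration.integral_diff[OF L2_mult_integrable[OF u D] L2_mult_integrable[OF v D]])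
  ultimately have "(\<integral>x. (?D x)\<^sup>2 \<partial>lborel) = 0" using eq by linarith
  then have "AE x in lborel. (?D x)\<^sup>2 = 0"
    using integral_nonneg_eq_0_iff_AE[OF L2_sq_integrable[OF D]] by auto
  then show ?thesis by eventually_elim simp
qed

lemma bounded_linear_S: "bounded_linear_L2 S"
  unfolding bounded_linear_L2_def using S_L2 S_linear l2norm_S by blast

lemma avg_size:
  assumes bc: "bdd_cpt_fun f" "bdd_cpt_fun g" and sep: "separated \<rho> f g" "0 < \<rho>"
  shows "\<bar>avg f g (m, n)\<bar> \<le> 2 powr (- (real (m + n) * \<delta>)) *
    (2 * (2 * real CARD('n)) ^ CARD('n) / \<rho> ^ CARD('n) * (l1norm f * l1norm g))"
    (is "_ \<le> ?w * ?N")
proof -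
  have "\<bar>lam m n \<omega> * l2inner (Sh m n \<omega> f) g\<bar> \<le> ?w * ?N" for \<omega>
    unfolding abs_mult by (intro mult_mono lam haar_shift_size[OF shift bc sep]) auto
  then have "\<bar>avg f g (m, n)\<bar> \<le> (\<integral>\<omega>. ?w * ?N \<partial>(Omega :: 'n rgrid measure))"
    unfolding avg_def prod.case by (intro abs_integral_le) auto
  then show ?thesis by (simp add: Omega.prob_space[simplified])
qed

text \<open>The bound of \<open>haar_shift_diff\<close> is integrated over the grids. The expected
  crossings cost 2^((m+n)\<eta>), the coefficients gain 2^(-(m+n)\<delta>); the exponent
  \<open>\<eta>\<close> is still free here.\<close>

lemma avg_diff:
  assumes bc: "bdd_cpt_fun f" "bdd_cpt_fun f'" "bdd_cpt_fun g" "bdd_cpt_fun g'"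
    and box: "in_box h b f" "in_box h b f'" "in_box h a g" "in_box h a g'"
    and sep: "separated \<rho> f g" "separated \<rho> f' g'" "0 < \<rho>" and h: "0 \<le> h" and \<eta>: "0 < \<eta>" "\<eta> \<le> 1"
  defines "M \<equiv> \<lambda>u :: 'n rfun. \<integral>x. u x \<partial>lborel"
  shows "\<bar>avg f g (m, n) * (M f' * M g') - avg f' g' (m, n) * (M f * M g)\<bar>
    \<le> 2 powr (- (real (m + n) * (\<delta> - \<eta>))) *
      (8 * real CARD('n) * 4 powr \<eta> * (2 * real CARD('n)) powr (real CARD('n) + \<eta>)
         * h powr \<eta> / \<rho> powr (real CARD('n) + \<eta>) * (l1norm f * l1norm g * (l1norm f' * l1norm g')))"
proof -
  let ?w = "2 powr (- (real (m + n) * \<delta>))" and ?N = "l1norm f * l1norm g * (l1norm f' * l1norm g')"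
  let ?K = "8 * real CARD('n) * 4 powr \<eta> * (2 * real CARD('n)) powr (real CARD('n) + \<eta>)
         * h powr \<eta> / \<rho> powr (real CARD('n) + \<eta>)"
  let ?k0 = "base_scale CARD('n) \<rho>"
  let ?\<Phi> = "\<lambda>\<omega> :: 'n rgrid. \<Sum>j. (if crossing \<omega> m n a b h (?k0 + int j)
     then 2 * 2 powr (- (real_of_int (?k0 + int j) * real CARD('n))) else 0)"
  let ?t = "\<lambda>f g \<omega>. lam m n \<omega> * l2inner (Sh m n \<omega> f) g"
  note L2 = bc[THEN bdd_cpt_fun_L2]
  note \<Phi> = expected_crossing[OF h \<eta> sep(3), of m n a b]
  have avg: "avg f g (m, n) * (M f' * M g') - avg f' g' (m, n) * (M f * M g)
     = (\<integral>\<omega>. ?t f g \<omega> * (M f' * M g') - ?t f' g' \<omega> * (M f * M g) \<partial>Omega)"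
    using integrable_lam_inner[OF L2(1,3)] integrable_lam_inner[OF L2(2,4)]
    unfolding avg_def by simp
  have "\<bar>avg f g (m, n) * (M f' * M g') - avg f' g' (m, n) * (M f * M g)\<bar>
     \<le> (\<integral>\<omega>. ?w * (?\<Phi> \<omega> * ?N) \<partial>Omega)"
    unfolding avg
  proof (rule abs_integral_le)
    show "integrable Omega (\<lambda>\<omega>. ?w * (?\<Phi> \<omega> * ?N))"
      by (intro integrable_mult_right integrable_mult_left \<Phi>(1))
    fix \<omega> :: "'n rgrid"
    have eq: "?t f g \<omega> * (M f' * M g') - ?t f' g' \<omega> * (M f * M g) =
       lam m n \<omega> * (l2inner (Sh m n \<omega> f) g * (M f' * M g') - l2inner (Sh m n \<omega> f') g' * (M f * M g))"
      by (simp add: algebra_simps)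
    show "\<bar>?t f g \<omega> * (M f' * M g') - ?t f' g' \<omega> * (M f * M g)\<bar> \<le> ?w * (?\<Phi> \<omega> * ?N)"
      unfolding eq abs_mult[of "lam m n \<omega>"] unfolding M_def
      by (rule mult_mono[OF lam haar_shift_diff[OF shift bc box sep]]) auto
  qed
  also have "\<dots> = ?w * ((\<integral>\<omega>. ?\<Phi> \<omega> \<partial>Omega) * ?N)" by simp
  also have "\<dots> \<le> ?w * ((?K * 2 powr (real (m + n) * \<eta>)) * ?N)"
    by (intro mult_left_mono mult_right_mono \<Phi>(2)) auto
  also have "\<dots> = (?w * 2 powr (real (m + n) * \<eta>)) * (?K * ?N)"
    by (simp only: mult_ac)
  also have "?w * 2 powr (real (m + n) * \<eta>) = 2 powr (- (real (m + n) * (\<delta> - \<eta>)))"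
    unfolding powr_add[symmetric] by (simp add: algebra_simps)
  finally show ?thesis .
qed

text \<open>With \<eta> = \<delta>/2 the weights in \<open>avg_diff\<close> become
  2^(-(m+n)\<delta>/2), whose sum over all pairs is \<open>V\<close>; any \<eta> strictly between 0
  and \<delta> would leave a summable weight.\<close>

lemma regular_form_S:
  obtains C where "0 < C" "regular_form C (\<delta> / 2) (\<lambda>f g. l2inner (S f) g)"
proof -
  let ?\<eta> = "\<delta> / 2" and ?d = "real CARD('n)"
  define V where "V = (\<Sum>\<^sub>\<infinity>(m, n)\<in>UNIV. 2 powr (- (real (m + n) * (\<delta> / 2))))"
  have V: "((\<lambda>(m, n). 2 powr (- (real (m + n) * (\<delta> / 2)))) has_sum V) UNIV"
    unfolding V_def using \<delta> by (intro has_sum_infsum summable_on_powr_pairs) auto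
  have V0: "0 \<le> V" using has_sum_nonneg[OF V] by auto
  define C1 where "C1 = 2 * (2 * ?d) ^ CARD('n)"
  define C2 where "C2 = 8 * ?d * 4 powr ?\<eta> * (2 * ?d) powr (?d + ?\<eta>)"
  have C0: "0 \<le> C1" "0 \<le> C2" by (auto simp: C1_def C2_def)
  \<comment> \<open>One constant dominating both conditions; the summand 1 makes it strictly
    positive.\<close>
  let ?C = "W * C1 + V * C2 + 1"
  have C: "W * C1 \<le> ?C" "V * C2 \<le> ?C" "0 < ?C"
    using mult_nonneg_nonneg[OF W_nonneg C0(1)] mult_nonneg_nonneg[OF V0 C0(2)] by auto
  have "regular_form ?C ?\<eta> (\<lambda>f g. l2inner (S f) g)"
    unfolding regular_form_def
  proof (intro conjI allI impI)
    fix \<rho> :: real and f g :: "'n rfun"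
    assume a: "0 < \<rho>" "bdd_cpt_fun f" "bdd_cpt_fun g" "separated \<rho> f g"
    let ?N = "l1norm f * l1norm g"
    have "norm (l2inner (S f) g) \<le> W * (C1 / \<rho> ^ CARD('n) * ?N)"
      unfolding C1_def using avg_size[OF a(2,3,4,1)] a(2,3)[THEN bdd_cpt_fun_L2]
      by (intro norm_infsum_le[OF has_sum_avg has_sum_cmult_left[OF has_sum_W]]) auto
    also have "\<dots> = W * C1 / \<rho> ^ CARD('n) * ?N" by simp
    also have "\<dots> \<le> ?C / \<rho> ^ CARD('n) * ?N"
      using C a by (intro mult_right_mono divide_right_mono) auto
    finally show "\<bar>l2inner (S f) g\<bar> \<le> ?C / \<rho> ^ CARD('n) * ?N" by simp
  next
    fix \<rho> h :: real and a b and f f' g g' :: "'n rfun"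
    assume \<rho>h: "0 < \<rho>" "0 \<le> h" and bc: "bdd_cpt_fun f" "bdd_cpt_fun f'" "bdd_cpt_fun g" "bdd_cpt_fun g'"
      and box: "in_box h b f" "in_box h b f'" "in_box h a g" "in_box h a g'"
      and sep: "separated \<rho> f g" "separated \<rho> f' g'"
    let ?N = "l1norm f * l1norm g * (l1norm f' * l1norm g')"
    let ?M = "\<lambda>u :: 'n rfun. \<integral>x. u x \<partial>lborel"
    note L2 = bc[THEN bdd_cpt_fun_L2]
    have "((\<lambda>p. avg f g p * (?M f' * ?M g') - avg f' g' p * (?M f * ?M g)) has_sum
        (l2inner (S f) g * (?M f' * ?M g') - l2inner (S f') g' * (?M f * ?M g))) UNIV"
      using has_sum_add[OF has_sum_cmult_left[OF has_sum_avg[OF L2(1,3)], of "?M f' * ?M g'"]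
          has_sum_cmult_left[OF has_sum_avg[OF L2(2,4)], of "- (?M f * ?M g)"]] by simp
    then have "norm (l2inner (S f) g * (?M f' * ?M g') - l2inner (S f') g' * (?M f * ?M g))
       \<le> V * (C2 * h powr ?\<eta> / \<rho> powr (?d + ?\<eta>) * ?N)"
    proof (rule norm_infsum_le[OF _ has_sum_cmult_left[OF V]])
      fix p :: "nat \<times> nat"
      show "norm (avg f g p * (?M f' * ?M g') - avg f' g' p * (?M f * ?M g))
        \<le> (case p of (m, n) \<Rightarrow> 2 powr (- (real (m + n) * (\<delta> / 2)))) * (C2 * h powr ?\<eta> / \<rho> powr (?d + ?\<eta>) * ?N)"
        using avg_diff[OF bc box sep \<rho>h, of ?\<eta> "fst p" "snd p"] \<delta>
        by (cases p) (simp add: C2_def)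
    qed
    also have "\<dots> = V * C2 * h powr ?\<eta> / \<rho> powr (?d + ?\<eta>) * ?N" by simp
    also have "\<dots> \<le> ?C * h powr ?\<eta> / \<rho> powr (?d + ?\<eta>) * ?N"
      using C by (intro mult_right_mono divide_right_mono) auto
    finally show "\<bar>l2inner (S f) g * (?M f' * ?M g') - l2inner (S f') g' * (?M f * ?M g)\<bar>
       \<le> ?C * h powr ?\<eta> / \<rho> powr (?d + ?\<eta>) * ?N" by simp
  qed
  with C(3) show ?thesis by (rule that)
qed

end

section \<open>The kernel of a regular form\<close>

text \<open>The point \<open>a\<close> is the lower corner, not the centre, in accordance with
  \<open>in_box\<close>; the closed cube has compact support at once.\<close>

definition cube_ind :: "real \<Rightarrow> real^'n::finite \<Rightarrow> 'n rfun" where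
  "cube_ind r a = indicator (cbox a (\<chi> i. a $ i + r))"

lemma cube_ind_nonzero: "cube_ind r a x \<noteq> 0 \<longleftrightarrow> (\<forall>i. a $ i \<le> x $ i \<and> x $ i \<le> a $ i + r)"
  by (simp add: cube_ind_def indicator_def mem_box_cart)

lemma bdd_cpt_fun_cube_ind: "bdd_cpt_fun (cube_ind r a)"
proof -
  have "{x. cube_ind r a x \<noteq> 0} = cbox a (\<chi> i. a $ i + r)"
    by (auto simp: cube_ind_def indicator_def)
  moreover have "\<bar>cube_ind r a x\<bar> \<le> 1" for x
    by (simp add: cube_ind_def indicator_def)
  moreover have "cube_ind r a \<in> borel_measurable lborel"
    by (simp add: cube_ind_def)
  ultimately show ?thesis
    unfolding bdd_cpt_fun_def by (metis closure_closed closed_cbox compact_cbox)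
qed

lemma integral_cube_ind:
  fixes a :: "real^'n::finite"
  assumes "0 \<le> r"
  shows "(\<integral>x. cube_ind r a x \<partial>lborel) = r ^ CARD('n)"
proof -
  have "a \<in> cbox a (\<chi> i. a $ i + r)"
    using assms by (simp add: mem_box_cart)
  then have ne: "cbox a (\<chi> i. a $ i + r) \<noteq> {}"
    by blast
  have "(\<integral>x. cube_ind r a x \<partial>lborel) = measure lborel (cbox a (\<chi> i. a $ i + r))"
    unfolding cube_ind_def by simp
  also have "\<dots> = r ^ CARD('n)"
    using content_cbox_cart[OF ne] by simp
  finally show ?thesis .
qed

lemma l1norm_cube_ind:
  fixes a :: "real^'n::finite"
  assumes "0 \<le> r"
  shows "l1norm (cube_ind r a) = r ^ CARD('n)"
proof -
  have "\<bar>cube_ind r a x\<bar> = cube_ind r a x" for x by (simp add: cube_ind_def)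
  then show ?thesis using integral_cube_ind[OF assms, of a] by (simp add: l1norm_def)
qed

lemma in_box_cube_ind:
  assumes "\<And>i. b $ i \<le> a $ i \<and> a $ i + r \<le> b $ i + h"
  shows "in_box h b (cube_ind r a)"
  unfolding in_box_def cube_ind_nonzero
proof (intro allI impI)
  fix x i assume "\<forall>i. a $ i \<le> x $ i \<and> x $ i \<le> a $ i + r"
  then show "b $ i \<le> x $ i \<and> x $ i \<le> b $ i + h"
    using assms[of i] by (meson order_trans)
qed

lemma cube_ind_dist:
  fixes a :: "real^'n::finite"
  assumes "cube_ind r a x \<noteq> 0"
  shows "dist x a \<le> real CARD('n) * r"
proof -
  have "\<bar>(x - a) $ i\<bar> \<le> r" for i using assms by (simp add: cube_ind_nonzero abs_le_iff algebra_simps)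
  then have "(\<Sum>i\<in>UNIV. \<bar>(x - a) $ i\<bar>) \<le> (\<Sum>i\<in>(UNIV::'n set). r)"
    by (intro sum_mono)
  then show ?thesis using norm_le_l1_cart[of "x - a"] by (simp add: dist_norm)
qed

lemma separated_cube_ind:
  fixes x y :: "real^'n::finite"
  assumes "\<rho> + 2 * real CARD('n) * r \<le> dist x y"
  shows "separated \<rho> (cube_ind r y) (cube_ind r x)"
  unfolding separated_def
proof (intro allI impI)
  fix x' y' assume "cube_ind r y y' \<noteq> 0" "cube_ind r x x' \<noteq> 0"
  then have "dist y' y \<le> real CARD('n) * r" "dist x' x \<le> real CARD('n) * r"
    by (simp_all add: cube_ind_dist)
  moreover have "dist x y \<le> dist x' x + dist x' y' + dist y' y"
    using dist_triangle[of x y x'] dist_triangle[of x' y y'] unfolding dist_commute[of x x'] by linarith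
  ultimately show "\<rho> \<le> dist x' y'" using assms by linarith
qed

lemma eventually_separated_cube_ind:
  fixes x y :: "real^'n::finite"
  assumes "\<rho> < dist x y"
  shows "\<forall>\<^sub>F j in sequentially. separated \<rho> (cube_ind ((1/2)^j) y) (cube_ind ((1/2)^j) x)"
proof -
  have "(\<lambda>j. \<rho> + 2 * real CARD('n) * (1/2)^j) \<longlonglongrightarrow> \<rho> + 2 * real CARD('n) * 0"
    by (intro tendsto_intros LIMSEQ_realpow_zero) auto
  then have "\<forall>\<^sub>F j in sequentially. \<rho> + 2 * real CARD('n) * (1/2)^j < dist x y"
    using assms by (intro order_tendstoD) auto
  then show ?thesis
    by eventually_elim (auto intro!: separated_cube_ind)
qed

section \<open>The kernel as a limit of normalised cube tests\<close>

locale regular_operator =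
  fixes S :: "'n::finite rfun \<Rightarrow> 'n rfun" and C \<eta> :: real
  assumes bl: "bounded_linear_L2 S" and C: "0 < C" and \<eta>: "0 < \<eta>"
    and reg: "regular_form C \<eta> (\<lambda>f g. l2inner (S f) g)"
begin

abbreviation form :: "'n rfun \<Rightarrow> 'n rfun \<Rightarrow> real" where
  "form f g \<equiv> l2inner (S f) g"

lemma form_size:
  "0 < \<rho> \<Longrightarrow> bdd_cpt_fun f \<Longrightarrow> bdd_cpt_fun g \<Longrightarrow> separated \<rho> f g \<Longrightarrow>
     \<bar>form f g\<bar> \<le> C / \<rho> ^ CARD('n) * (l1norm f * l1norm g)"
  using reg unfolding regular_form_def by blast

lemma form_diff:
  assumes "0 < \<rho>" "0 \<le> h" "bdd_cpt_fun f" "bdd_cpt_fun f'" "bdd_cpt_fun g" "bdd_cpt_fun g'"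
       "in_box h b f" "in_box h b f'" "in_box h a g" "in_box h a g'"
       "separated \<rho> f g" "separated \<rho> f' g'"
  shows "\<bar>form f g * ((\<integral>x. f' x \<partial>lborel) * (\<integral>x. g' x \<partial>lborel)) -
        form f' g' * ((\<integral>x. f x \<partial>lborel) * (\<integral>x. g x \<partial>lborel))\<bar>
       \<le> C * h powr \<eta> / \<rho> powr (real CARD('n) + \<eta>) * (l1norm f * l1norm g * (l1norm f' * l1norm g'))"
  using reg assms unfolding regular_form_def by blast

text \<open>The mean value that a kernel would have over the product of the two cubes. The cube at
  \<open>y\<close> is the input of \<open>S\<close> and stands in the first slot of the form; the
  cube at \<open>x\<close> is the test function.\<close>

definition approx_kernel :: "nat \<Rightarrow> real^'n \<Rightarrow> real^'n \<Rightarrow> real" where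
  "approx_kernel j x y = form (cube_ind ((1/2)^j) y) (cube_ind ((1/2)^j) x)
      / (((1/2)^j) ^ CARD('n) * ((1/2)^j) ^ CARD('n))"

text \<open>Convergence is established only off the diagonal; for \<open>x = y\<close> the value
  carries no information.\<close>

definition kernel :: "real^'n \<Rightarrow> real^'n \<Rightarrow> real" where
  "kernel x y = lim (\<lambda>j. approx_kernel j x y)"

text \<open>The regularity condition is applied with the second pair equal to the two small cubes.
  Enlarging the boxes from side h to h + 2^(-j) makes room for cubes whose corners lie anywhere in
  the original boxes; dividing by the product of their volumes gives the claim.\<close>

lemma form_approx_kernel:
  assumes \<rho>: "0 < \<rho>" "0 \<le> h" and bc: "bdd_cpt_fun f" "bdd_cpt_fun g"
    and box: "in_box h b f" "in_box h a g"
    and sep: "separated \<rho> f g" "separated \<rho> (cube_ind ((1/2)^j) y) (cube_ind ((1/2)^j) x)"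
    and pts: "\<And>i. b $ i \<le> y $ i \<and> y $ i \<le> b $ i + h" "\<And>i. a $ i \<le> x $ i \<and> x $ i \<le> a $ i + h"
  shows "\<bar>form f g - approx_kernel j x y * ((\<integral>x. f x \<partial>lborel) * (\<integral>x. g x \<partial>lborel))\<bar>
     \<le> C * (h + (1/2)^j) powr \<eta> / \<rho> powr (real CARD('n) + \<eta>) * (l1norm f * l1norm g)"
proof -
  let ?r = "(1/2) ^ j :: real" and ?FG = "(\<integral>x. f x \<partial>lborel) * (\<integral>x. g x \<partial>lborel)"
  let ?u = "cube_ind ?r y" and ?v = "cube_ind ?r x" and ?V = "((1/2)^j) ^ CARD('n) * ((1/2)^j) ^ CARD('n) :: real"
  have V: "0 < ?V" by simp
  have mono: "in_box (h + ?r) c w" if "in_box h c w" for c and w :: "'n rfun"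
    unfolding in_box_def
  proof (intro allI impI)
    fix x i assume "w x \<noteq> 0"
    then have "c $ i \<le> x $ i \<and> x $ i \<le> c $ i + h" using that by (auto simp: in_box_def)
    moreover have "0 \<le> ?r" by simp
    ultimately show "c $ i \<le> x $ i \<and> x $ i \<le> c $ i + (h + ?r)" by linarith
  qed
  have "\<bar>form f g * ((\<integral>x. ?u x \<partial>lborel) * (\<integral>x. ?v x \<partial>lborel)) - form ?u ?v * ?FG\<bar>
     \<le> C * (h + ?r) powr \<eta> / \<rho> powr (real CARD('n) + \<eta>) * (l1norm f * l1norm g * (l1norm ?u * l1norm ?v))"
    using pts \<rho> by (intro form_diff[OF _ _ bc(1) _ bc(2) _ mono[OF box(1)] _ mono[OF box(2)] _ sep]
        bdd_cpt_fun_cube_ind in_box_cube_ind) (auto simp: add.assoc[symmetric])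
  then have "\<bar>form f g * ?V - form ?u ?v * ?FG\<bar>
     \<le> C * (h + ?r) powr \<eta> / \<rho> powr (real CARD('n) + \<eta>) * (l1norm f * l1norm g) * ?V"
    by (simp add: integral_cube_ind l1norm_cube_ind mult.assoc)
  moreover have "form f g * ?V - form ?u ?v * ?FG = (form f g - approx_kernel j x y * ?FG) * ?V"
    using V by (simp add: approx_kernel_def left_diff_distrib)
  ultimately have "\<bar>form f g - approx_kernel j x y * ?FG\<bar> * ?V
     \<le> C * (h + ?r) powr \<eta> / \<rho> powr (real CARD('n) + \<eta>) * (l1norm f * l1norm g) * ?V"
    using V by (simp only: abs_mult abs_of_pos)
  then show ?thesis using V by (simp only: mult_le_cancel_right_pos)
qed

text \<open>The cubes of index i themselves are used as \<open>f\<close> and \<open>g\<close> in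
  \<open>form_approx_kernel\<close>, so two approximations with the same corners differ by the
  Hoelder error of the larger side.\<close>

lemma approx_kernel_Cauchy:
  assumes "x \<noteq> y"
  shows "Cauchy (\<lambda>j. approx_kernel j x y)"
proof (rule metric_CauchyI)
  fix e :: real assume e: "0 < e"
  define \<rho> where "\<rho> = dist x y / 2"
  have \<rho>: "0 < \<rho>" "\<rho> < dist x y" using assms by (auto simp: \<rho>_def)
  obtain J where J: "\<And>j. j \<ge> J \<Longrightarrow> separated \<rho> (cube_ind ((1/2)^j) y) (cube_ind ((1/2)^j) x)"
    using eventually_separated_cube_ind[OF \<rho>(2)] unfolding eventually_sequentially by blast
  let ?b = "\<lambda>N. C * (2 * (1/2)^N) powr \<eta> / \<rho> powr (real CARD('n) + \<eta>)"
  have B: "\<bar>approx_kernel i x y - approx_kernel j x y\<bar> \<le> ?b N" if "N \<ge> J" "i \<ge> N" "j \<ge> N" for i j N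
  proof -
    let ?r = "(1/2) ^ i :: real"
    have r: "?r \<le> (1/2)^N" "(1/2)^j \<le> (1/2 :: real)^N" using that by (auto intro!: power_decreasing)
    then have rr: "?r + (1/2)^j \<le> 2 * (1/2)^N" by linarith
    have "\<bar>form (cube_ind ?r y) (cube_ind ?r x) -
        approx_kernel j x y * ((\<integral>z. cube_ind ?r y z \<partial>lborel) * (\<integral>z. cube_ind ?r x z \<partial>lborel))\<bar>
      \<le> C * (?r + (1/2)^j) powr \<eta> / \<rho> powr (real CARD('n) + \<eta>) * (l1norm (cube_ind ?r y) * l1norm (cube_ind ?r x))"
      using that by (intro form_approx_kernel[where b = y and a = x] \<rho> J bdd_cpt_fun_cube_ind in_box_cube_ind) auto
    then have "\<bar>(approx_kernel i x y - approx_kernel j x y) * (?r ^ CARD('n) * ?r ^ CARD('n))\<bar>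
      \<le> C * (?r + (1/2)^j) powr \<eta> / \<rho> powr (real CARD('n) + \<eta>) * (?r ^ CARD('n) * ?r ^ CARD('n))"
      by (simp add: integral_cube_ind l1norm_cube_ind left_diff_distrib approx_kernel_def)
    then have "\<bar>approx_kernel i x y - approx_kernel j x y\<bar> * (?r ^ CARD('n) * ?r ^ CARD('n))
      \<le> C * (?r + (1/2)^j) powr \<eta> / \<rho> powr (real CARD('n) + \<eta>) * (?r ^ CARD('n) * ?r ^ CARD('n))"
      by (simp add: abs_mult)
    then have "\<bar>approx_kernel i x y - approx_kernel j x y\<bar> \<le> C * (?r + (1/2)^j) powr \<eta> / \<rho> powr (real CARD('n) + \<eta>)"
      by (rule mult_right_le_imp_le) simp
    also have "C * (?r + (1/2)^j) powr \<eta> / \<rho> powr (real CARD('n) + \<eta>) \<le> ?b N"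
      using C \<eta> rr by (intro divide_right_mono mult_left_mono powr_mono2) auto
    finally show ?thesis .
  qed
  have "?b \<longlonglongrightarrow> C * (2 * 0) powr \<eta> / \<rho> powr (real CARD('n) + \<eta>)"
    using \<eta> \<rho> by (intro tendsto_intros tendsto_powr' LIMSEQ_realpow_zero) auto
  then have "\<forall>\<^sub>F N in sequentially. ?b N < e"
    using e \<eta> by (intro order_tendstoD) auto
  then obtain N where N: "N \<ge> J" "?b N < e"
    unfolding eventually_sequentially by (metis nle_le)
  have "dist (approx_kernel i x y) (approx_kernel j x y) < e" if "i \<ge> N" "j \<ge> N" for i j
    using B[OF N(1) that] N(2) by (simp add: dist_real_def)
  then show "\<exists>M. \<forall>m\<ge>M. \<forall>n\<ge>M. dist (approx_kernel m x y) (approx_kernel n x y) < e"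
    by blast
qed

lemma approx_kernel_tendsto:
  "x \<noteq> y \<Longrightarrow> (\<lambda>j. approx_kernel j x y) \<longlonglongrightarrow> kernel x y"
  unfolding kernel_def using approx_kernel_Cauchy Cauchy_convergent convergent_LIMSEQ_iff by blast

lemma half_powr_tendsto:
  assumes "0 \<le> h"
  shows "(\<lambda>j. C * (h + (1/2)^j) powr \<eta> / D * E) \<longlonglongrightarrow> C * h powr \<eta> / D * E"
proof -
  have "(\<lambda>j. h + (1/2)^j) \<longlonglongrightarrow> h + 0"
    by (intro tendsto_intros LIMSEQ_realpow_zero) auto
  then have "(\<lambda>j. (h + (1/2)^j) powr \<eta>) \<longlonglongrightarrow> (h + 0) powr \<eta>"
    using assms \<eta> by (intro tendsto_powr' tendsto_const) auto
  then have "(\<lambda>j. (h + (1/2)^j) powr \<eta>) \<longlonglongrightarrow> h powr \<eta>" by simp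
  then have "(\<lambda>j. C * (h + (1/2)^j) powr \<eta> * (inverse D * E)) \<longlonglongrightarrow> C * h powr \<eta> * (inverse D * E)"
    by (intro tendsto_mult tendsto_const)
  then show ?thesis unfolding divide_inverse[of _ D] mult.assoc[of _ "inverse D" E] .
qed

text \<open>The limit j to infinity in \<open>form_approx_kernel\<close>. Strictness of
  \<open>\<rho> < dist x y\<close> ensures that the small cubes are eventually
  \<rho>-separated.\<close>

lemma form_kernel:
  assumes \<rho>: "0 < \<rho>" "0 \<le> h" and bc: "bdd_cpt_fun f" "bdd_cpt_fun g"
    and box: "in_box h b f" "in_box h a g"
    and sep: "separated \<rho> f g" "\<rho> < dist x y"
    and pts: "\<And>i. b $ i \<le> y $ i \<and> y $ i \<le> b $ i + h" "\<And>i. a $ i \<le> x $ i \<and> x $ i \<le> a $ i + h"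
  shows "\<bar>form f g - kernel x y * ((\<integral>x. f x \<partial>lborel) * (\<integral>x. g x \<partial>lborel))\<bar>
     \<le> C * h powr \<eta> / \<rho> powr (real CARD('n) + \<eta>) * (l1norm f * l1norm g)"
proof (rule tendsto_le)
  have ne: "x \<noteq> y" using \<rho> sep(2) by auto
  show "(\<lambda>j. \<bar>form f g - approx_kernel j x y * ((\<integral>x. f x \<partial>lborel) * (\<integral>x. g x \<partial>lborel))\<bar>)
    \<longlonglongrightarrow> \<bar>form f g - kernel x y * ((\<integral>x. f x \<partial>lborel) * (\<integral>x. g x \<partial>lborel))\<bar>"
    by (intro tendsto_intros approx_kernel_tendsto ne)
  show "(\<lambda>j. C * (h + (1/2)^j) powr \<eta> / \<rho> powr (real CARD('n) + \<eta>) * (l1norm f * l1norm g))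
    \<longlonglongrightarrow> C * h powr \<eta> / \<rho> powr (real CARD('n) + \<eta>) * (l1norm f * l1norm g)"
    by (rule half_powr_tendsto[OF \<rho>(2)])
  show "\<forall>\<^sub>F j in sequentially. \<bar>form f g - approx_kernel j x y * ((\<integral>x. f x \<partial>lborel) * (\<integral>x. g x \<partial>lborel))\<bar>
     \<le> C * (h + (1/2)^j) powr \<eta> / \<rho> powr (real CARD('n) + \<eta>) * (l1norm f * l1norm g)"
    using eventually_separated_cube_ind[OF sep(2)]
    by eventually_elim (rule form_approx_kernel[OF \<rho> bc box sep(1) _ pts])
qed simp

lemma kernel_size:
  assumes "0 < \<rho>" "\<rho> < dist x y"
  shows "\<bar>kernel x y\<bar> \<le> C / \<rho> ^ CARD('n)"
proof (rule tendsto_upperbound)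
  show "(\<lambda>j. \<bar>approx_kernel j x y\<bar>) \<longlonglongrightarrow> \<bar>kernel x y\<bar>"
    using assms by (intro tendsto_intros approx_kernel_tendsto) auto
  show "\<forall>\<^sub>F j in sequentially. \<bar>approx_kernel j x y\<bar> \<le> C / \<rho> ^ CARD('n)"
    using eventually_separated_cube_ind[OF assms(2)]
  proof eventually_elim
    case (elim j)
    let ?V = "((1/2)^j) ^ CARD('n) * ((1/2)^j) ^ CARD('n) :: real"
    have "\<bar>form (cube_ind ((1/2)^j) y) (cube_ind ((1/2)^j) x)\<bar> \<le> C / \<rho> ^ CARD('n) * ?V"
      using form_size[OF assms(1) bdd_cpt_fun_cube_ind bdd_cpt_fun_cube_ind elim]
      by (simp add: l1norm_cube_ind)
    then have "\<bar>form (cube_ind ((1/2)^j) y) (cube_ind ((1/2)^j) x)\<bar> / ?V \<le> C / \<rho> ^ CARD('n)"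
      by (subst pos_divide_le_eq) simp_all
    then show ?case
      unfolding approx_kernel_def abs_divide by simp
  qed
qed simp

text \<open>The cubes shrinking to \<open>(x', y')\<close> are compared with the value at
  \<open>(x, y)\<close> through \<open>form_kernel\<close>, in boxes large enough for both. Moving
  both variables at once serves the two Hoelder conditions, the continuity and the comparison on
  small cubes alike.\<close>

lemma kernel_Holder:
  assumes \<rho>: "0 < \<rho>" "\<rho> < dist x y" "\<rho> < dist x' y'" and t: "dist x x' \<le> t" "dist y y' \<le> t"
  shows "\<bar>kernel x' y' - kernel x y\<bar> \<le> C * t powr \<eta> / \<rho> powr (real CARD('n) + \<eta>)"
proof (rule tendsto_le)
  \<comment> \<open>Corners taken componentwise as minima: boxes of side t + 2^(-j) based there
    contain the old points together with the cubes attached to the new ones.\<close>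
  let ?a = "\<chi> i. min (x $ i) (x' $ i)" and ?b = "\<chi> i. min (y $ i) (y' $ i)"
  have t0: "0 \<le> t" using t(1) zero_le_dist order_trans by blast
  have cx: "\<bar>x $ i - x' $ i\<bar> \<le> t" for i
    using component_le_norm_cart[of "x - x'" i] t(1) by (simp add: dist_norm)
  have cy: "\<bar>y $ i - y' $ i\<bar> \<le> t" for i
    using component_le_norm_cart[of "y - y'" i] t(2) by (simp add: dist_norm)
  show "(\<lambda>j. \<bar>approx_kernel j x' y' - kernel x y\<bar>) \<longlonglongrightarrow> \<bar>kernel x' y' - kernel x y\<bar>"
    using \<rho> by (intro tendsto_intros approx_kernel_tendsto) auto
  show "(\<lambda>j. C * (t + (1/2)^j) powr \<eta> / \<rho> powr (real CARD('n) + \<eta>)) \<longlonglongrightarrow> C * t powr \<eta> / \<rho> powr (real CARD('n) + \<eta>)"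
    using half_powr_tendsto[OF t0, of _ 1] by simp
  show "\<forall>\<^sub>F j in sequentially. \<bar>approx_kernel j x' y' - kernel x y\<bar>
     \<le> C * (t + (1/2)^j) powr \<eta> / \<rho> powr (real CARD('n) + \<eta>)"
    using eventually_separated_cube_ind[OF \<rho>(3)]
  proof eventually_elim
    case (elim j)
    let ?r = "(1/2)^j :: real"
    have r: "0 < ?r" by simp
    have "\<bar>form (cube_ind ?r y') (cube_ind ?r x') -
        kernel x y * ((\<integral>z. cube_ind ?r y' z \<partial>lborel) * (\<integral>z. cube_ind ?r x' z \<partial>lborel))\<bar>
      \<le> C * (t + ?r) powr \<eta> / \<rho> powr (real CARD('n) + \<eta>) * (l1norm (cube_ind ?r y') * l1norm (cube_ind ?r x'))"
    proof (rule form_kernel[OF \<rho>(1) _ bdd_cpt_fun_cube_ind bdd_cpt_fun_cube_ind _ _ elim \<rho>(2)])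
      show "0 \<le> t + ?r" using t0 r by linarith
      show "in_box (t + ?r) ?b (cube_ind ?r y')"
      proof (rule in_box_cube_ind)
        fix i show "?b $ i \<le> y' $ i \<and> y' $ i + ?r \<le> ?b $ i + (t + ?r)"
          using cy[of i] unfolding vec_lambda_beta by linarith
      qed
      show "in_box (t + ?r) ?a (cube_ind ?r x')"
      proof (rule in_box_cube_ind)
        fix i show "?a $ i \<le> x' $ i \<and> x' $ i + ?r \<le> ?a $ i + (t + ?r)"
          using cx[of i] unfolding vec_lambda_beta by linarith
      qed
      show "?b $ i \<le> y $ i \<and> y $ i \<le> ?b $ i + (t + ?r)" for i
        using cy[of i] r unfolding vec_lambda_beta by linarith
      show "?a $ i \<le> x $ i \<and> x $ i \<le> ?a $ i + (t + ?r)" for i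
        using cx[of i] r unfolding vec_lambda_beta by linarith
    qed
    then have "\<bar>approx_kernel j x' y' - kernel x y\<bar> * (?r ^ CARD('n) * ?r ^ CARD('n))
      \<le> C * (t + ?r) powr \<eta> / \<rho> powr (real CARD('n) + \<eta>) * (?r ^ CARD('n) * ?r ^ CARD('n))"
      using abs_mult[of "approx_kernel j x' y' - kernel x y" "?r ^ CARD('n) * ?r ^ CARD('n)"]
      by (simp add: integral_cube_ind l1norm_cube_ind left_diff_distrib approx_kernel_def)
    then show ?case by (rule mult_right_le_imp_le) simp
  qed
qed simp

lemma standard_kernel_kernel: "standard_kernel kernel"
proof -
  let ?d = "real CARD('n)"
  let ?C = "2 * C * 4 powr (?d + \<eta>)"
  have d1: "1 \<le> ?d" by (simp add: Suc_leI)
  have "\<bar>kernel x y\<bar> \<le> ?C / dist x y ^ CARD('n)" if "x \<noteq> y" for x y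
  proof -
    have "\<bar>kernel x y\<bar> \<le> C / (dist x y / 2) ^ CARD('n)"
      using that by (intro kernel_size) auto
    also have "\<dots> = C * 2 powr ?d / dist x y ^ CARD('n)"
      by (simp add: power_divide powr_realpow)
    also have "\<dots> \<le> ?C / dist x y ^ CARD('n)"
    proof (intro divide_right_mono)
      have "2 powr ?d \<le> 4 powr (?d + \<eta>)"
        using \<eta> by (intro order_trans[OF powr_mono2 powr_mono]) auto
      then have "C * 2 powr ?d \<le> C * 4 powr (?d + \<eta>)" using C by simp
      also have "\<dots> \<le> ?C" using C by simp
      finally show "C * 2 powr ?d \<le> ?C" .
    qed simp
    finally show ?thesis .
  qed
  moreover have "\<bar>kernel x y - kernel x' y\<bar> + \<bar>kernel y x - kernel y x'\<bar>
        \<le> ?C * dist x x' powr \<eta> / dist x y powr (\<eta> + ?d)" if "x \<noteq> y" "dist x x' < dist x y / 2" for x x' y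
  proof -
    \<comment> \<open>The triangle inequality leaves more than half of the distance after moving x
      to x', so a quarter lies strictly below both distances; this produces the power of 4 in
      \<open>?C\<close>.\<close>
    let ?\<rho> = "dist x y / 4"
    have \<rho>: "0 < ?\<rho>" "?\<rho> < dist x y" "?\<rho> < dist y x" using that by (auto simp: dist_commute)
    have "dist x y \<le> dist x x' + dist x' y" by (rule dist_triangle)
    with that have \<rho>': "?\<rho> < dist x' y" "?\<rho> < dist y x'"
      unfolding dist_commute[of y x'] using \<rho>(1) by linarith+
    have "\<bar>kernel x y - kernel x' y\<bar> \<le> C * dist x x' powr \<eta> / ?\<rho> powr (?d + \<eta>)"
      by (rule kernel_Holder[OF \<rho>(1) \<rho>'(1) \<rho>(2)]) (auto simp: dist_commute)
    moreover have "\<bar>kernel y x - kernel y x'\<bar> \<le> C * dist x x' powr \<eta> / ?\<rho> powr (?d + \<eta>)"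
      by (rule kernel_Holder[OF \<rho>(1) \<rho>'(2) \<rho>(3)]) (auto simp: dist_commute)
    ultimately have "\<bar>kernel x y - kernel x' y\<bar> + \<bar>kernel y x - kernel y x'\<bar>
        \<le> 2 * (C * dist x x' powr \<eta> / ?\<rho> powr (?d + \<eta>))" by linarith
    also have "\<dots> = ?C * dist x x' powr \<eta> / dist x y powr (\<eta> + ?d)"
      by (simp add: powr_divide add.commute)
    finally show ?thesis .
  qed
  moreover have "0 < ?C" using C by simp
  ultimately show ?thesis
    unfolding standard_kernel_def using \<eta> by blast
qed

end

section \<open>Representation by the kernel\<close>

text \<open>A bounded support confines each integer coordinate of such a cube to a finite
  interval.\<close>

lemma finite_cubes_meeting_support:
  fixes f :: "'n::finite rfun"
  assumes "bdd_cpt_fun f"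
  shows "finite {Q \<in> dlevel \<omega> k. \<exists>y\<in>Q. f y \<noteq> 0}"
proof -
  have "compact (closure {x. f x \<noteq> 0})" using assms by (simp add: bdd_cpt_fun_def)
  then have "bounded {x. f x \<noteq> 0}"
    using bounded_subset[OF compact_imp_bounded closure_subset] by blast
  then obtain M where M: "\<And>x. f x \<noteq> 0 \<Longrightarrow> norm x \<le> M" by (auto simp: bounded_iff)
  let ?c = "\<lambda>i t. \<lfloor>(t - gshift \<omega> k i) / 2 powr k\<rfloor>"
  let ?A = "\<lambda>i. {?c i (- M)..?c i M}"
  have "{Q \<in> dlevel \<omega> k. \<exists>y\<in>Q. f y \<noteq> 0} \<subseteq> dcube \<omega> k ` Pi\<^sub>E UNIV ?A"
  proof
    fix Q assume "Q \<in> {Q \<in> dlevel \<omega> k. \<exists>y\<in>Q. f y \<noteq> 0}"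
    then obtain n y where Q: "Q = dcube \<omega> k n" "y \<in> Q" "f y \<noteq> 0" by (auto simp: dlevel_def)
    then have n: "n = cell \<omega> k y" by (simp add: mem_dcube_iff)
    have "n i \<in> ?A i" for i
    proof -
      have "\<bar>y $ i\<bar> \<le> M" using component_le_norm_cart[of y i] M[OF Q(3)] by linarith
      then show ?thesis unfolding n cell_def by (auto intro!: floor_mono divide_right_mono)
    qed
    then show "Q \<in> dcube \<omega> k ` Pi\<^sub>E UNIV ?A" using Q(1) by (auto simp: PiE_UNIV_domain)
  qed
  then show ?thesis
    by (rule finite_subset) (intro finite_imageI finite_PiE finite finite_atLeastAtMost_int)
qed

lemma sum_pieces:
  assumes F: "finite F" "F \<subseteq> dlevel \<omega> k" and cover: "\<And>Q. Q \<in> dlevel \<omega> k \<Longrightarrow> x \<in> Q \<Longrightarrow> f x \<noteq> 0 \<Longrightarrow> Q \<in> F"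
  shows "(\<Sum>Q\<in>F. indicator Q x * f x) = (f x :: real)"
proof (cases "f x = 0")
  case False
  let ?Q = "dcube \<omega> k (cell \<omega> k x)"
  have Q: "?Q \<in> dlevel \<omega> k" "x \<in> ?Q" by (auto simp: dlevel_def mem_dcube_iff)
  then have "?Q \<in> F" using cover False by blast
  have "indicator Q x = (if Q = ?Q then 1 else 0 :: real)" if "Q \<in> F" for Q
    using dlevel_disjoint[of Q \<omega> k ?Q] that F(2) Q by (auto split: split_indicator)
  then have "(\<Sum>Q\<in>F. indicator Q x * f x) = (\<Sum>Q\<in>F. (if Q = ?Q then f x else 0))"
    by (intro sum.cong) auto
  also have "\<dots> = f x" using F(1) \<open>?Q \<in> F\<close> by simp
  finally show ?thesis .
qed simp

lemma bdd_cpt_fun_piece: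
  assumes "bdd_cpt_fun f" "Q \<in> sets borel"
  shows "bdd_cpt_fun (\<lambda>x. indicator Q x * f x)"
proof -
  obtain B where B: "\<And>x. \<bar>f x\<bar> \<le> B" using assms by (auto simp: bdd_cpt_fun_def)
  have "\<bar>indicator Q x * f x\<bar> \<le> B" for x
    using B[of x] by (auto split: split_indicator)
  moreover have "closure {x. indicator Q x * f x \<noteq> 0} \<subseteq> closure {x. f x \<noteq> 0}"
    by (intro closure_mono) auto
  then have "closure {x. f x \<noteq> 0} \<inter> closure {x. indicator Q x * f x \<noteq> 0} = closure {x. indicator Q x * f x \<noteq> 0}"
    by blast
  then have "compact (closure {x. indicator Q x * f x \<noteq> 0})"
    using assms(1) compact_Int_closed[OF _ closed_closure, of "closure {x. f x \<noteq> 0}" "{x. indicator Q x * f x \<noteq> 0}"]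
    unfolding bdd_cpt_fun_def by simp
  moreover have "(\<lambda>x. indicator Q x * f x) \<in> borel_measurable lborel"
    using assms by (intro borel_measurable_times borel_measurable_indicator) (auto simp: bdd_cpt_fun_def)
  ultimately show ?thesis unfolding bdd_cpt_fun_def by blast
qed

lemma l1norm_piece: "l1norm (\<lambda>x. indicator Q x * f x) = mass f Q"
  by (simp add: l1norm_def mass_def abs_mult)

lemma sum_l1norm_pieces_le:
  assumes "bdd_cpt_fun f" "F \<subseteq> dlevel \<omega> k"
  shows "(\<Sum>Q\<in>F. l1norm (\<lambda>x. indicator Q x * f x)) \<le> l1norm f"
  unfolding l1norm_piece
  using sum_mass_le[OF bdd_cpt_fun_L2[OF assms(1)] assms(2), of UNIV] bdd_cpt_fun_integrable[OF assms(1)]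
  by (simp add: mass_def l1norm_def)

lemma dlevel_in_box:
  assumes "Q \<in> dlevel \<omega> k"
  obtains a :: "real^'n::finite" where "\<And>x i. x \<in> Q \<Longrightarrow> a $ i \<le> x $ i \<and> x $ i \<le> a $ i + 2 powr k"
proof -
  obtain n where Q: "Q = dcube \<omega> k n" using assms by (auto simp: dlevel_def)
  show ?thesis
    by (rule that[of "\<chi> i. 2 powr k * of_int (n i) + gshift \<omega> k i"]) (auto simp: Q dcube_def algebra_simps less_imp_le)
qed

lemma integrable_tensor:
  fixes u v :: "'n::finite rfun"
  assumes "integrable lborel u" "integrable lborel v"
  shows "integrable (lborel \<Otimes>\<^sub>M lborel) (\<lambda>(x, y). u y * v x)"
    and "(\<integral>(x, y). u y * v x \<partial>(lborel \<Otimes>\<^sub>M lborel)) = (\<integral>y. u y \<partial>lborel) * (\<integral>x. v x \<partial>lborel)"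
proof -
  have [measurable]: "u \<in> borel_measurable borel" "v \<in> borel_measurable borel"
    using assms[THEN borel_measurable_integrable] by simp_all
  show int: "integrable (lborel \<Otimes>\<^sub>M lborel) (\<lambda>(x, y). u y * v x)"
  proof (rule lborel_pair.Fubini_integrable)
    show "(\<lambda>(x, y). u y * v x) \<in> borel_measurable (lborel \<Otimes>\<^sub>M lborel)" by measurable
    show "integrable lborel (\<lambda>x. \<integral>y. norm (case (x, y) of (x, y) \<Rightarrow> u y * v x) \<partial>lborel)"
      using assms by (simp add: abs_mult)
    show "AE x in lborel. integrable lborel (\<lambda>y. case (x, y) of (x, y) \<Rightarrow> u y * v x)"
      using assms by simp
  qed
  show "(\<integral>(x, y). u y * v x \<partial>(lborel \<Otimes>\<^sub>M lborel)) = (\<integral>y. u y \<partial>lborel) * (\<integral>x. v x \<partial>lborel)"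
    using lborel_pair.integral_fst'[OF int] by simp
qed

section \<open>Cutting the functions into small cubes and comparing form and integral\<close>

context regular_operator
begin

lemma S_L2: "L2 f \<Longrightarrow> L2 (S f)"
  using bl by (simp add: bounded_linear_L2_def)

text \<open>\<open>S\<close> is linear only up to null sets, which the pairing with \<open>g\<close>
  does not see.\<close>

lemma form_linear:
  assumes "L2 f" "L2 f'" "L2 g"
  shows "form (\<lambda>x. a * f x + b * f' x) g = a * form f g + b * form f' g"
proof -
  have AE: "AE x in lborel. S (\<lambda>y. a * f y + b * f' y) x = a * S f x + b * S f' x"
    using bl assms unfolding bounded_linear_L2_def by blast
  have [measurable]: "S (\<lambda>y. a * f y + b * f' y) \<in> borel_measurable borel" "S f \<in> borel_measurable borel"
      "S f' \<in> borel_measurable borel" "g \<in> borel_measurable borel"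
    using assms by (auto intro!: L2_measurable S_L2 L2_lincomb)
  have "form (\<lambda>x. a * f x + b * f' x) g = (\<integral>x. a * (S f x * g x) + b * (S f' x * g x) \<partial>lborel)"
    unfolding l2inner_def
  proof (rule integral_cong_AE)
    show "AE x in lborel. S (\<lambda>x. a * f x + b * f' x) x * g x = a * (S f x * g x) + b * (S f' x * g x)"
      using AE by eventually_elim (simp add: algebra_simps)
  qed measurable
  also have "\<dots> = a * form f g + b * form f' g"
    using L2_mult_integrable[OF S_L2[OF assms(1)] assms(3)] L2_mult_integrable[OF S_L2[OF assms(2)] assms(3)]
    by (simp add: l2inner_def)
  finally show ?thesis .
qed

lemma form_sum_left:
  assumes "finite F" "\<And>i. i \<in> F \<Longrightarrow> L2 (u i)" "L2 g"
  shows "form (\<lambda>x. \<Sum>i\<in>F. u i x) g = (\<Sum>i\<in>F. form (u i) g)"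
  using assms(1,2)
proof (induction F rule: finite_induct)
  case empty
  \<comment> \<open>The empty sum is the zero function, obtained as a combination with both
    coefficients 0.\<close>
  show ?case using form_linear[OF assms(3,3,3), of 0 0] by simp
next
  case (insert i F)
  then show ?case
    using form_linear[OF _ L2_sum[of F u] assms(3), of "u i" 1 1] by simp
qed

lemma form_sum_right:
  assumes "L2 f" "\<And>i. i \<in> F \<Longrightarrow> L2 (v i)"
  shows "form f (\<lambda>x. \<Sum>i\<in>F. v i x) = (\<Sum>i\<in>F. form f (v i))"
  unfolding l2inner_def sum_distrib_left
  by (intro Bochner_Integration.integral_sum L2_mult_integrable S_L2 assms)

text \<open>Needed for measurability of the kernel in both variables jointly, without which the
  double integral could not be handled.\<close>

lemma kernel_continuous: "continuous_on {p. fst p \<noteq> snd p} (\<lambda>p. kernel (fst p) (snd p))"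
proof (rule continuous_onI)
  fix p :: "(real^'n) \<times> (real^'n)" and e :: real
  assume p: "p \<in> {p. fst p \<noteq> snd p}" and e: "0 < e"
  obtain x y where xy: "p = (x, y)" by (cases p)
  define \<rho> where "\<rho> = dist x y / 2"
  have \<rho>: "0 < \<rho>" "\<rho> < dist x y" using p by (auto simp: \<rho>_def xy)
  let ?b = "\<lambda>t. C * t powr \<eta> / \<rho> powr (real CARD('n) + \<eta>)"
  have "((\<lambda>t. t powr \<eta>) \<longlongrightarrow> 0 powr \<eta>) (at_right 0)"
    using \<eta> by (intro tendsto_powr' tendsto_const tendsto_ident_at) (auto simp: eventually_at_right_less intro: eventually_at_right_less[THEN eventually_mono])
  then have "(?b \<longlongrightarrow> C * 0 powr \<eta> / \<rho> powr (real CARD('n) + \<eta>)) (at_right 0)"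
    using \<rho> by (intro tendsto_divide tendsto_mult tendsto_const) auto
  then have "\<forall>\<^sub>F t in at_right 0. ?b t < e"
    using e by (intro order_tendstoD) auto
  moreover have "\<forall>\<^sub>F t in at_right 0. t < \<rho> / 2"
    using \<rho> eventually_at_right_real[of 0 "\<rho> / 2"] by (auto elim: eventually_mono)
  \<comment> \<open>With \<rho> half the distance of the points, moving each of them by at most t <
    \<rho>/2 keeps them more than \<rho> apart, so that \<open>kernel_Holder\<close>
    applies.\<close>
  ultimately have "\<forall>\<^sub>F t in at_right 0. ?b t < e \<and> t < \<rho> / 2 \<and> 0 < t"
    using eventually_at_right_less by eventually_elim auto
  then obtain t where t: "?b t < e" "t < \<rho> / 2" "0 < t"
    using eventually_happens[of _ "at_right (0::real)"] by auto
  show "\<exists>d>0. \<forall>p'\<in>{p. fst p \<noteq> snd p}. dist p' p < d \<longrightarrow> dist (kernel (fst p') (snd p')) (kernel (fst p) (snd p)) \<le> e"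
  proof (intro exI[of _ t] conjI ballI impI t)
    fix p' :: "(real^'n) \<times> (real^'n)" assume d: "dist p' p < t"
    have "dist x (fst p') \<le> t" "dist y (snd p') \<le> t"
      using d dist_fst_le[of p' p] dist_snd_le[of p' p] by (auto simp: xy dist_commute)
    moreover have "dist x y \<le> dist x (fst p') + dist (fst p') (snd p') + dist y (snd p')"
      using dist_triangle[of x y "fst p'"] dist_triangle[of "fst p'" y "snd p'"]
      unfolding dist_commute[of y "snd p'"] by linarith
    ultimately have "\<bar>kernel (fst p') (snd p') - kernel x y\<bar> \<le> ?b t"
      using t \<rho> by (intro kernel_Holder) (auto simp: \<rho>_def)
    then show "dist (kernel (fst p') (snd p')) (kernel (fst p) (snd p)) \<le> e"
      using t by (simp add: xy dist_real_def)
  qed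
qed

text \<open>The indicator removes the diagonal, where nothing is known of \<open>kernel\<close>;
  separated supports make this harmless in \<open>integrable_kernel\<close>.\<close>

lemma kernel_measurable:
  "(\<lambda>p. indicator {p. fst p \<noteq> snd p} p * kernel (fst p) (snd p)) \<in> borel_measurable borel"
proof -
  have "open {p :: (real^'n) \<times> (real^'n). fst p \<noteq> snd p}"
    by (intro open_Collect_neq continuous_intros)
  then show ?thesis
    using borel_measurable_continuous_on_indicator[OF _ kernel_continuous] by simp
qed

lemma integrable_kernel:
  assumes u: "bdd_cpt_fun u" and v: "bdd_cpt_fun v" and \<rho>: "0 < \<rho>"
    and sep: "\<And>x y. u y \<noteq> 0 \<Longrightarrow> v x \<noteq> 0 \<Longrightarrow> \<rho> < dist x y"
  shows "integrable (lborel \<Otimes>\<^sub>M lborel) (\<lambda>(x, y). u y * v x * kernel x y)"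
proof (rule Bochner_Integration.integrable_bound)
  note [measurable] = u v
  show "integrable (lborel \<Otimes>\<^sub>M lborel) (\<lambda>p. C / \<rho> ^ CARD('n) * (case p of (x, y) \<Rightarrow> u y * v x))"
    using u v by (intro integrable_mult_right integrable_tensor bdd_cpt_fun_integrable)
  have "(\<lambda>(x, y). u y * v x * kernel x y) = (\<lambda>p. u (snd p) * v (fst p) * (indicator {p. fst p \<noteq> snd p} p * kernel (fst p) (snd p)))"
  proof
    fix p show "(\<lambda>(x, y). u y * v x * kernel x y) p
       = u (snd p) * v (fst p) * (indicator {p. fst p \<noteq> snd p} p * kernel (fst p) (snd p))"
    proof (cases "fst p = snd p")
      case True
      then have "u (snd p) = 0 \<or> v (fst p) = 0" using sep[of "snd p" "fst p"] \<rho> by force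
      then show ?thesis by (auto simp: case_prod_beta)
    qed (simp add: case_prod_beta)
  qed
  moreover have "(\<lambda>p. u (snd p) * v (fst p) * (indicator {p. fst p \<noteq> snd p} p * kernel (fst p) (snd p))) \<in> borel_measurable (borel \<Otimes>\<^sub>M borel)"
    by (rule borel_measurable_times[OF borel_measurable_times[OF
          measurable_compose[OF measurable_snd bdd_cpt_fun_measurable[OF u]]
          measurable_compose[OF measurable_fst bdd_cpt_fun_measurable[OF v]]]
          kernel_measurable[folded borel_prod]])
  ultimately show "(\<lambda>(x, y). u y * v x * kernel x y) \<in> borel_measurable (lborel \<Otimes>\<^sub>M lborel)"
    by (simp add: lborel_prod borel_prod)
  show "AE p in lborel \<Otimes>\<^sub>M lborel. norm (case p of (x, y) \<Rightarrow> u y * v x * kernel x y)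
     \<le> norm (C / \<rho> ^ CARD('n) * (case p of (x, y) \<Rightarrow> u y * v x))"
  proof (rule AE_I2, clarify)
    fix x y
    show "norm (u y * v x * kernel x y) \<le> norm (C / \<rho> ^ CARD('n) * (u y * v x))"
    proof (cases "u y = 0 \<or> v x = 0")
      case False
      then have "\<bar>kernel x y\<bar> \<le> C / \<rho> ^ CARD('n)" using sep \<rho> by (intro kernel_size) auto
      then have "\<bar>u y * v x\<bar> * \<bar>kernel x y\<bar> \<le> \<bar>u y * v x\<bar> * (C / \<rho> ^ CARD('n))"
        by (rule mult_left_mono) simp
      moreover have "\<bar>C / \<rho> ^ CARD('n)\<bar> = C / \<rho> ^ CARD('n)" using C \<rho> by simp
      ultimately show ?thesis by (simp only: real_norm_def abs_mult mult_ac)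
    qed auto
  qed
qed

text \<open>Both the form and the integral are compared with the kernel value at one point
  \<open>(x0, y0)\<close> times the product of the integrals. The form costs h^\<eta> by
  \<open>form_kernel\<close>; the integral costs (d h)^\<eta> by \<open>kernel_Holder\<close>, as d
  h bounds the diameter of a cube. This explains the factor 1 + d^\<eta>.\<close>

lemma form_kernel_piece:
  fixes u v :: "'n rfun"
  assumes bc: "bdd_cpt_fun u" "bdd_cpt_fun v" and \<rho>: "0 < \<rho>"
    and sep: "\<And>x y. u y \<noteq> 0 \<Longrightarrow> v x \<noteq> 0 \<Longrightarrow> \<rho> < dist x y"
    and R: "R \<in> dlevel \<omega> k" "\<And>y. u y \<noteq> 0 \<Longrightarrow> y \<in> R" "u y0 \<noteq> 0"
    and P: "P \<in> dlevel \<omega> k" "\<And>x. v x \<noteq> 0 \<Longrightarrow> x \<in> P" "v x0 \<noteq> 0"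
  defines "h \<equiv> 2 powr k"
  shows "\<bar>form u v - (\<integral>(x, y). u y * v x * kernel x y \<partial>(lborel \<Otimes>\<^sub>M lborel))\<bar>
    \<le> C * (1 + real CARD('n) powr \<eta>) / \<rho> powr (real CARD('n) + \<eta>) * h powr \<eta> * (l1norm u * l1norm v)"
proof -
  let ?D = "\<rho> powr (real CARD('n) + \<eta>)" and ?d = "real CARD('n)" and ?N = "l1norm u * l1norm v"
  let ?I = "\<integral>(x, y). u y * v x * kernel x y \<partial>(lborel \<Otimes>\<^sub>M lborel)"
  let ?FG = "(\<integral>x. u x \<partial>lborel) * (\<integral>x. v x \<partial>lborel)"
  have h: "0 < h" by (simp add: h_def)
  obtain b where b: "\<And>x i. x \<in> R \<Longrightarrow> b $ i \<le> x $ i \<and> x $ i \<le> b $ i + h"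
    unfolding h_def using dlevel_in_box[OF R(1)] by metis
  obtain a where a: "\<And>x i. x \<in> P \<Longrightarrow> a $ i \<le> x $ i \<and> x $ i \<le> a $ i + h"
    unfolding h_def using dlevel_in_box[OF P(1)] by metis
  have 1: "\<bar>form u v - kernel x0 y0 * ?FG\<bar> \<le> C * h powr \<eta> / ?D * ?N"
  proof (rule form_kernel[OF \<rho> _ bc])
    show "in_box h b u" "in_box h a v" using a b R(2) P(2) unfolding in_box_def by blast+
    show "separated \<rho> u v" using sep unfolding separated_def by (auto intro: less_imp_le)
    show "\<rho> < dist x0 y0" using sep R(3) P(3) by blast
    show "b $ i \<le> y0 $ i \<and> y0 $ i \<le> b $ i + h" for i using b R by blast
    show "a $ i \<le> x0 $ i \<and> x0 $ i \<le> a $ i + h" for i using a P by blast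
  qed (use h in simp)
  note int = bc[THEN bdd_cpt_fun_integrable]
  note tens = integrable_tensor[OF int] and ker = integrable_kernel[OF bc \<rho> sep]
  have I: "?I - kernel x0 y0 * ?FG = (\<integral>p. (case p of (x, y) \<Rightarrow> u y * v x * kernel x y)
      - kernel x0 y0 * (case p of (x, y) \<Rightarrow> u y * v x) \<partial>(lborel \<Otimes>\<^sub>M lborel))"
    using ker tens by simp
  have le: "\<bar>\<integral>p. (case p of (x, y) \<Rightarrow> u y * v x * kernel x y)
      - kernel x0 y0 * (case p of (x, y) \<Rightarrow> u y * v x) \<partial>(lborel \<Otimes>\<^sub>M lborel)\<bar>
     \<le> (\<integral>p. C * (?d * h) powr \<eta> / ?D * (case p of (x, y) \<Rightarrow> \<bar>u y\<bar> * \<bar>v x\<bar>) \<partial>(lborel \<Otimes>\<^sub>M lborel))"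
  proof (rule abs_integral_le)
    show "integrable (lborel \<Otimes>\<^sub>M lborel) (\<lambda>p. C * (?d * h) powr \<eta> / ?D * (case p of (x, y) \<Rightarrow> \<bar>u y\<bar> * \<bar>v x\<bar>))"
      using int by (intro integrable_mult_right integrable_tensor integrable_abs)
    fix p :: "(real^'n) \<times> (real^'n)"
    obtain x y where p: "p = (x, y)" by (cases p)
    show "\<bar>(case p of (x, y) \<Rightarrow> u y * v x * kernel x y) - kernel x0 y0 * (case p of (x, y) \<Rightarrow> u y * v x)\<bar>
      \<le> C * (?d * h) powr \<eta> / ?D * (case p of (x, y) \<Rightarrow> \<bar>u y\<bar> * \<bar>v x\<bar>)"
    proof (cases "u y = 0 \<or> v x = 0")
      case False
      then have "x0 \<in> P" "x \<in> P" "y0 \<in> R" "y \<in> R" using R(2,3) P(2,3) by blast+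
      then have "dist x0 x < ?d * h" "dist y0 y < ?d * h"
        unfolding h_def using cell_eq_dist dlevel_cell_eq[OF P(1)] dlevel_cell_eq[OF R(1)] by blast+
      then have "\<bar>kernel x y - kernel x0 y0\<bar> \<le> C * (?d * h) powr \<eta> / ?D"
        using False R(3) P(3) sep by (intro kernel_Holder \<rho>) (auto intro: less_imp_le)
      then have "\<bar>u y * v x\<bar> * \<bar>kernel x y - kernel x0 y0\<bar> \<le> \<bar>u y * v x\<bar> * (C * (?d * h) powr \<eta> / ?D)"
        by (rule mult_left_mono) simp
      moreover have "u y * v x * kernel x y - kernel x0 y0 * (u y * v x) = (u y * v x) * (kernel x y - kernel x0 y0)"
        by (simp add: algebra_simps)
      ultimately show ?thesis unfolding p prod.case by (simp only: abs_mult mult_ac)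
    qed (auto simp: p)
  qed
  have N: "(\<integral>p. C * (?d * h) powr \<eta> / ?D * (case p of (x, y) \<Rightarrow> \<bar>u y\<bar> * \<bar>v x\<bar>) \<partial>(lborel \<Otimes>\<^sub>M lborel))
      = C * (?d * h) powr \<eta> / ?D * ?N"
    using integrable_tensor(2)[OF int[THEN integrable_abs]] by (simp add: l1norm_def)
  have 2: "\<bar>?I - kernel x0 y0 * ?FG\<bar> \<le> C * (?d * h) powr \<eta> / ?D * ?N"
    unfolding I using le unfolding N .
  have "\<bar>form u v - ?I\<bar> \<le> C * h powr \<eta> / ?D * ?N + C * (?d * h) powr \<eta> / ?D * ?N"
    using 1 2 by linarith
  also have "\<dots> = C * (1 + ?d powr \<eta>) / ?D * h powr \<eta> * ?N"
    using h by (simp add: powr_mult algebra_simps add_divide_distrib)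
  finally show ?thesis .
qed

lemma form_eq_kernel_integral:
  assumes bc: "bdd_cpt_fun f" "bdd_cpt_fun g"
    and disj: "closure {x. f x \<noteq> 0} \<inter> closure {x. g x \<noteq> 0} = {}"
  shows "form f g = (\<integral>(x, y). f y * g x * kernel x y \<partial>(lborel \<Otimes>\<^sub>M lborel))"
proof -
  let ?d = "real CARD('n)"
  obtain \<rho>0 where \<rho>0: "0 < \<rho>0" "\<And>x y. x \<in> closure {x. f x \<noteq> 0} \<Longrightarrow> y \<in> closure {x. g x \<noteq> 0} \<Longrightarrow> \<rho>0 \<le> dist x y"
    using separate_compact_closed[OF _ closed_closure disj] bc(1) unfolding bdd_cpt_fun_def by blast
  \<comment> \<open>Halving the distance of the supports turns the weak inequality into the strict
    one required for the kernel estimates.\<close>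
  define \<rho> where "\<rho> = \<rho>0 / 2"
  have \<rho>: "0 < \<rho>" using \<rho>0(1) by (simp add: \<rho>_def)
  have sep: "\<rho> < dist x y" if "f y \<noteq> 0" "g x \<noteq> 0" for x y
  proof -
    have "y \<in> closure {x. f x \<noteq> 0}" "x \<in> closure {x. g x \<noteq> 0}"
      using that by (auto intro!: subsetD[OF closure_subset])
    then have "\<rho>0 \<le> dist y x" by (rule \<rho>0(2))
    then show ?thesis using \<rho>0(1) by (simp add: \<rho>_def dist_commute)
  qed
  let ?I = "\<integral>(x, y). f y * g x * kernel x y \<partial>(lborel \<Otimes>\<^sub>M lborel)"
  let ?E = "C * (1 + ?d powr \<eta>) / \<rho> powr (?d + \<eta>)" and ?N = "l1norm f * l1norm g"
  \<comment> \<open>With all bits zero there is no translation: the standard grid serves for the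
    decomposition, and randomness plays no further part.\<close>
  let ?\<omega> = "\<lambda>(_::int) (_::'n). False"
  have main: "\<bar>form f g - ?I\<bar> \<le> ?E * (2 powr k) powr \<eta> * ?N" for k :: int
  proof -
    define F where "F = {Q \<in> dlevel ?\<omega> k. \<exists>y\<in>Q. f y \<noteq> 0}"
    define G where "G = {Q \<in> dlevel ?\<omega> k. \<exists>y\<in>Q. g y \<noteq> 0}"
    have F: "finite F" "F \<subseteq> dlevel ?\<omega> k" and G: "finite G" "G \<subseteq> dlevel ?\<omega> k"
      unfolding F_def G_def using finite_cubes_meeting_support bc by auto
    let ?f = "\<lambda>Q x. indicator Q x * f x" and ?g = "\<lambda>Q x. indicator Q x * g x"
    let ?J = "\<lambda>R P. \<integral>(x, y). ?f R y * ?g P x * kernel x y \<partial>(lborel \<Otimes>\<^sub>M lborel)"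
    have fs: "(\<Sum>Q\<in>F. ?f Q x) = f x" for x
      by (rule sum_pieces[OF F]) (auto simp: F_def)
    have gs: "(\<Sum>Q\<in>G. ?g Q x) = g x" for x
      by (rule sum_pieces[OF G]) (auto simp: G_def)
    have bf: "bdd_cpt_fun (?f R)" if "R \<in> F" for R
      using that F(2) dlevel_borel by (intro bdd_cpt_fun_piece bc) blast
    have bg: "bdd_cpt_fun (?g R)" if "R \<in> G" for R
      using that G(2) dlevel_borel by (intro bdd_cpt_fun_piece bc) blast
    have "form f g = form (\<lambda>x. \<Sum>R\<in>F. ?f R x) g" unfolding fs ..
    also have "\<dots> = (\<Sum>R\<in>F. form (?f R) g)"
      by (intro form_sum_left F bdd_cpt_fun_L2 bc bf)
    also have "\<dots> = (\<Sum>R\<in>F. form (?f R) (\<lambda>x. \<Sum>P\<in>G. ?g P x))" unfolding gs ..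
    also have "\<dots> = (\<Sum>R\<in>F. \<Sum>P\<in>G. form (?f R) (?g P))"
      by (intro sum.cong form_sum_right bdd_cpt_fun_L2 bf bg refl)
    finally have 1: "form f g = (\<Sum>R\<in>F. \<Sum>P\<in>G. form (?f R) (?g P))" .
    have int: "integrable (lborel \<Otimes>\<^sub>M lborel) (\<lambda>(x, y). ?f R y * ?g P x * kernel x y)" if "R \<in> F" "P \<in> G" for R P
      by (rule integrable_kernel[OF bf[OF that(1)] bg[OF that(2)] \<rho>]) (auto intro: sep)
    have "(case p of (x, y) \<Rightarrow> f y * g x * kernel x y)
       = (\<Sum>R\<in>F. \<Sum>P\<in>G. case p of (x, y) \<Rightarrow> ?f R y * ?g P x * kernel x y)" for p
    proof (cases p)
      case (Pair x y)
      have "f y * g x * kernel x y = (\<Sum>R\<in>F. ?f R y) * (\<Sum>P\<in>G. ?g P x) * kernel x y"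
        unfolding fs gs ..
      also have "\<dots> = (\<Sum>R\<in>F. \<Sum>P\<in>G. ?f R y * ?g P x * kernel x y)"
        unfolding sum_product[of "\<lambda>R. ?f R y"] by (simp only: sum_distrib_right)
      finally show ?thesis unfolding Pair prod.case .
    qed
    then have "?I = (\<integral>p. (\<Sum>R\<in>F. \<Sum>P\<in>G. case p of (x, y) \<Rightarrow> ?f R y * ?g P x * kernel x y) \<partial>(lborel \<Otimes>\<^sub>M lborel))"
      by (intro Bochner_Integration.integral_cong refl)
    also have "\<dots> = (\<Sum>R\<in>F. \<integral>p. (\<Sum>P\<in>G. case p of (x, y) \<Rightarrow> ?f R y * ?g P x * kernel x y) \<partial>(lborel \<Otimes>\<^sub>M lborel))"
      by (intro Bochner_Integration.integral_sum Bochner_Integration.integrable_sum int)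
    also have "\<dots> = (\<Sum>R\<in>F. \<Sum>P\<in>G. ?J R P)"
      by (intro sum.cong Bochner_Integration.integral_sum int refl)
    finally have 2: "?I = (\<Sum>R\<in>F. \<Sum>P\<in>G. ?J R P)" .
    have "\<bar>form f g - ?I\<bar> = \<bar>\<Sum>R\<in>F. \<Sum>P\<in>G. form (?f R) (?g P) - ?J R P\<bar>"
      unfolding 1 2 sum_subtractf ..
    also have "\<dots> \<le> (\<Sum>R\<in>F. \<Sum>P\<in>G. ?E * (2 powr k) powr \<eta> * (l1norm (?f R) * l1norm (?g P)))"
    proof (rule order_trans[OF sum_abs], rule sum_mono, rule order_trans[OF sum_abs], rule sum_mono)
      fix R P assume RP: "R \<in> F" "P \<in> G"
      then obtain y0 x0 where y0: "y0 \<in> R" "f y0 \<noteq> 0" and x0: "x0 \<in> P" "g x0 \<noteq> 0"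
        by (auto simp: F_def G_def)
      show "\<bar>form (?f R) (?g P) - ?J R P\<bar> \<le> ?E * (2 powr k) powr \<eta> * (l1norm (?f R) * l1norm (?g P))"
      proof (rule form_kernel_piece[OF bf[OF RP(1)] bg[OF RP(2)] \<rho>])
        show "\<rho> < dist x y" if "?f R y \<noteq> 0" "?g P x \<noteq> 0" for x y using that by (auto intro: sep)
        show "R \<in> dlevel ?\<omega> k" "P \<in> dlevel ?\<omega> k" using RP F G by auto
        show "y \<in> R" if "?f R y \<noteq> 0" for y using that by (auto simp: indicator_def split: if_splits)
        show "y \<in> P" if "?g P y \<noteq> 0" for y using that by (auto simp: indicator_def split: if_splits)
        show "?f R y0 \<noteq> 0" "?g P x0 \<noteq> 0" using y0 x0 by auto
      qed
    qed
    also have "\<dots> = ?E * (2 powr k) powr \<eta> * ((\<Sum>R\<in>F. l1norm (?f R)) * (\<Sum>P\<in>G. l1norm (?g P)))"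
      unfolding sum_product by (simp only: sum_distrib_left)
    \<comment> \<open>The L^1 norms of the pieces sum to at most those of \<open>f\<close> and
      \<open>g\<close>, so the total error is independent of the number of cubes and vanishes as k
      tends to minus infinity.\<close>
    also have "\<dots> \<le> ?E * (2 powr k) powr \<eta> * ?N"
      using C sum_l1norm_pieces_le[OF bc(1) F(2)] sum_l1norm_pieces_le[OF bc(2) G(2)]
      by (intro mult_left_mono mult_mono) (auto intro!: sum_nonneg)
    finally show ?thesis .
  qed
  have "(\<lambda>j. ?E * (2 powr (- \<eta>)) ^ j * ?N) \<longlonglongrightarrow> ?E * 0 * ?N"
  proof (intro tendsto_mult tendsto_const LIMSEQ_realpow_zero)
    have "2 powr (- \<eta>) < 2 powr 0" using \<eta> by (intro powr_less_mono) auto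
    then show "2 powr (- \<eta>) < 1" by simp
  qed simp
  moreover have "\<bar>form f g - ?I\<bar> \<le> ?E * (2 powr (- \<eta>)) ^ j * ?N" for j
  proof -
    have "(2 powr (- int j)) powr \<eta> = (2 powr (- \<eta>)) ^ j"
      by (simp add: powr_powr powr_realpow[symmetric] mult.commute)
    then show ?thesis using main[of "- int j"] by simp
  qed
  ultimately have "\<bar>form f g - ?I\<bar> \<le> ?E * 0 * ?N"
    by (intro LIMSEQ_le_const) auto
  then show ?thesis by simp
qed

lemma CZO_S: "CZO S"
  unfolding CZO_def using bl standard_kernel_kernel form_eq_kernel_integral by blast

end

theorem theorem3p1:
  fixes \<delta> :: real
    and lam :: "nat \<Rightarrow> nat \<Rightarrow> 'n::finite rgrid \<Rightarrow> real"
    and Sh :: "nat \<Rightarrow> nat \<Rightarrow> 'n rgrid \<Rightarrow> ('n rfun \<Rightarrow> 'n rfun)"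
    and S :: "'n rfun \<Rightarrow> 'n rfun"
  assumes "0 < \<delta>" and "\<delta> < 1"
    and "\<And>m n \<omega>. \<bar>lam m n \<omega>\<bar> \<le> 2 powr (- (real (m + n) * \<delta>))"
    and "\<And>m n \<omega>. haar_shift \<omega> m n (Sh m n \<omega>)"
    and "\<And>m n \<omega> f. L2 f \<Longrightarrow> L2 (Sh m n \<omega> f) \<and> l2norm (Sh m n \<omega> f) \<le> l2norm f"
    and "\<And>m n f g. L2 f \<Longrightarrow> L2 g \<Longrightarrow>
           (\<lambda>\<omega>. lam m n \<omega> * l2inner (Sh m n \<omega> f) g) \<in> borel_measurable Omega"
    and "\<And>f. L2 f \<Longrightarrow> L2 (S f)"
    and "\<And>f g. L2 f \<Longrightarrow> L2 g \<Longrightarrow>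
           l2inner (S f) g = (\<integral>\<omega>. (\<Sum>\<^sub>\<infinity>(m,n)\<in>UNIV. lam m n \<omega> * l2inner (Sh m n \<omega> f) g) \<partial>Omega)"
  shows "CZO S"
proof -
  interpret haar_average \<delta> lam Sh S
    by unfold_locales (fact assms)+
  obtain C where C: "0 < C" "regular_form C (\<delta> / 2) (\<lambda>f g. l2inner (S f) g)"
    by (rule regular_form_S)
  have "regular_operator S C (\<delta> / 2)"
    using C \<open>0 < \<delta>\<close> bounded_linear_S by (simp add: regular_operator_def)
  then show "CZO S"
    by (rule regular_operator.CZO_S)
qed

end
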